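(* Let $B\subset A$ be an inclusion of simple unital $C^*$-algebras admitting a conditional expectation $A\to B$ of finite index, with tower of $C^*$-basic constructions $B\subset A\subset A_1\subset A_2\subset\cdots$. Then for $k\in\{0,1\}$ the rotation map $\gamma_k:B'\cap A_{2k+1}\to B'\cap A_{2k+1}$ is a $*$-preserving anti-automorphism.
   Context: Inclusions of unital $C^*$-algebras have common identity. A conditional expectation $E:A\to B$ is a positive norm-one projection onto $B$ with $E(axb)=aE(x)b$ for $a,b\in B$, $x\in A$. It has finite index if there is a finite set $\{\lambda_i\}\subset A$ (a quasi-basis) with $x=\sum_i\lambda_iE(\lambda_i^*x)=\sum_iE(x\lambda_i)\lambda_i^*$ for all $x\in A$; then $\mathrm{Ind}(E)=\sum_i\lambda_i\lambda_i^*$. If $A,B$ are simple unital and a finite-index conditional expectation exists, all finite-index ones have scalar index and there is a unique one $E_0=E^A_B$ of minimal index; $[A:B]_0:=\mathrm{Ind}(E^A_B)$ and $\tau:=[A:B]_0^{-1}$. Basic construction: $A$ is a Hilbert $B$-module with $\langle x,y\rangle_B=E_0(x^*y)$; $A$ acts by left multiplication; $e_1$ is the projection $x\mapsto E_0(x)$; $A_1$ is the $C^*$-algebra of adjointable $B$-linear maps on $A$ generated by $A$ and $e_1$. It is simple and unital, with minimal (dual) conditional expectation $E_1:A_1\to A$, $E_1(xe_1y)=\tau xy$ for $x,y\in A$, and $[A_1:A]_0=[A:B]_0$. Iterating, with $A_{-1}=B$, $A_0=A$, one gets the tower with minimal conditional expectations $E_k:A_k\to A_{k-1}$ and Jones projections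 $e_k\in A_k$ implementing $E_{k-1}$. $\mathrm{tr}=(E_0\circ\cdots\circ E_k)|_{B'\cap A_k}$ are consistent faithful tracial states, and $E^{B'\cap A_k}_{A'\cap A_k}$ is the $\mathrm{tr}$-preserving conditional expectation. Fourier transforms: $\mathcal{F}_k(x)=\tau^{-\frac{k+2}{2}}E^{B'\cap A_{k+1}}_{A'\cap A_{k+1}}(xe_{k+1}\cdots e_2e_1)$ for $x\in B'\cap A_k$, with inverse $\mathcal{F}_k^{-1}(x)=\tau^{-\frac{k+2}{2}}E_{k+1}(xe_1e_2\cdots e_{k+1})$ for $x\in A'\cap A_{k+1}$. Rotation maps: $\rho^{B\subset A}_k:B'\cap A_k\to B'\cap A_k$, $\rho^{B\subset A}_k(x)=\big(\mathcal{F}_k^{-1}(\mathcal{F}_k(x)^* )\big)^*$. The tower of basic constructions of $B\subset A_1$ (with minimal conditional expectation $E_0\circ E_1$) is identified with $B\subset A_1\subset A_3\subset A_5\subset\cdots$, the Jones projections being $\tau^{-1}e_2e_1e_3e_2\in A_3$, $\tau^{-1}e_4e_3e_5e_4\in A_5$, etc. Define $\gamma_0:=\rho^{B\subset A}_1$ on $B'\cap A_1$ and $\gamma_1:=\rho^{B\subset A_1}_1$ on $B'\cap A_3$. Explicitly, for any quasi-basis $\{\lambda_i\}$ of $E_0$, $\gamma_0(x)=\tau^{-1}\sum_iE_1(e_1\lambda_ix)e_1\lambda_i^*$ and $\gamma_1(y)=\tau^{-5}\sum_{i,j}E_2\circ E_3(e_2e_1e_3e_2\lambda_ie_1\lambda_jy)\,e_2e_1e_3e_2\lambda_j^*e_1\lambda_i^*$.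 *)

theory Defs
  imports "HOL-Analysis.Analysis"
begin

section \<open>Unital C*-algebras\<close>

text \<open>
  The type class describes an ambient unital C*-algebra; the algebras of the tower
  are C*-subalgebras (subsets) of it that contain its unit.
\<close>

class cstar_algebra = banach + real_normed_algebra_1 +
  fixes scaleC :: "complex \<Rightarrow> 'a \<Rightarrow> 'a" (infixr "*\<^sub>C" 75)
    and star :: "'a \<Rightarrow> 'a" ("(_\<^sup>\<star>)" [1000] 999)
  assumes scaleC_add_right: "c *\<^sub>C (x + y) = c *\<^sub>C x + c *\<^sub>C y"
    and scaleC_add_left: "(c + d) *\<^sub>C x = c *\<^sub>C x + d *\<^sub>C x"
    and scaleC_scaleC: "c *\<^sub>C d *\<^sub>C x = (c * d) *\<^sub>C x"
    and scaleR_scaleC: "r *\<^sub>R x = complex_of_real r *\<^sub>C x"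
    and norm_scaleC: "norm (c *\<^sub>C x) = cmod c * norm x"
    and mult_scaleC_left: "(c *\<^sub>C x) * y = c *\<^sub>C (x * y)"
    and mult_scaleC_right: "x * (c *\<^sub>C y) = c *\<^sub>C (x * y)"
    and star_star: "(x\<^sup>\<star>)\<^sup>\<star> = x"
    and star_add: "(x + y)\<^sup>\<star> = x\<^sup>\<star> + y\<^sup>\<star>"
    and star_scaleC: "(c *\<^sub>C x)\<^sup>\<star> = cnj c *\<^sub>C x\<^sup>\<star>"
    and star_mult: "(x * y)\<^sup>\<star> = y\<^sup>\<star> * x\<^sup>\<star>"
    and cstar_identity: "norm (x\<^sup>\<star> * x) = (norm x)\<^sup>2"

definition cstar_subalgebra :: "'a::cstar_algebra set \<Rightarrow> bool" where
  "cstar_subalgebra S \<longleftrightarrow>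
     closed S \<and> 1 \<in> S \<and>
     (\<forall>x\<in>S. \<forall>y\<in>S. x + y \<in> S \<and> x * y \<in> S) \<and>
     (\<forall>c. \<forall>x\<in>S. c *\<^sub>C x \<in> S) \<and>
     (\<forall>x\<in>S. x\<^sup>\<star> \<in> S)"

definition closed_ideal :: "'a::cstar_algebra set \<Rightarrow> 'a set \<Rightarrow> bool" where
  "closed_ideal S I \<longleftrightarrow>
     I \<subseteq> S \<and> closed I \<and> 0 \<in> I \<and>
     (\<forall>x\<in>I. \<forall>y\<in>I. x + y \<in> I) \<and>
     (\<forall>c. \<forall>x\<in>I. c *\<^sub>C x \<in> I) \<and>
     (\<forall>s\<in>S. \<forall>x\<in>I. s * x \<in> I \<and> x * s \<in> I)"

definition simple_cstar :: "'a::cstar_algebra set \<Rightarrow> bool" where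
  "simple_cstar S \<longleftrightarrow>
     cstar_subalgebra S \<and> (\<forall>I. closed_ideal S I \<longrightarrow> I = {0} \<or> I = S)"

definition rel_commutant :: "'a::cstar_algebra set \<Rightarrow> 'a set \<Rightarrow> 'a set" where
  "rel_commutant B C = {x \<in> C. \<forall>b\<in>B. b * x = x * b}"

definition star_anti_automorphism :: "'a::cstar_algebra set \<Rightarrow> ('a \<Rightarrow> 'a) \<Rightarrow> bool" where
  "star_anti_automorphism S f \<longleftrightarrow>
     bij_betw f S S \<and>
     (\<forall>x\<in>S. \<forall>y\<in>S. f (x + y) = f x + f y) \<and>
     (\<forall>c. \<forall>x\<in>S. f (c *\<^sub>C x) = c *\<^sub>C f x) \<and>
     (\<forall>x\<in>S. \<forall>y\<in>S. f (x * y) = f y * f x) \<and>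
     (\<forall>x\<in>S. f (x\<^sup>\<star>) = (f x)\<^sup>\<star>)"


section \<open>Conditional expectations and index\<close>

text \<open>
  Maps are total functions on the ambient type and matter only on their carrier.
  Positivity of an element means having the form \<open>b\<^sup>\<star> b\<close>.  Since \<open>E 1 = 1\<close>,
  contractivity says that \<open>E\<close> has norm one.
\<close>

definition cond_exp :: "'a::cstar_algebra set \<Rightarrow> 'a set \<Rightarrow> ('a \<Rightarrow> 'a) \<Rightarrow> bool" where
  "cond_exp A B E \<longleftrightarrow>
     (\<forall>x\<in>A. E x \<in> B) \<and>
     (\<forall>b\<in>B. E b = b) \<and>
     (\<forall>x\<in>A. \<forall>y\<in>A. E (x + y) = E x + E y) \<and>
     (\<forall>c. \<forall>x\<in>A. E (c *\<^sub>C x) = c *\<^sub>C E x) \<and>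
     (\<forall>x\<in>A. \<exists>b\<in>B. E (x\<^sup>\<star> * x) = b\<^sup>\<star> * b) \<and>
     (\<forall>x\<in>A. norm (E x) \<le> norm x) \<and>
     (\<forall>a\<in>B. \<forall>b\<in>B. \<forall>x\<in>A. E (a * x * b) = a * E x * b)"

definition quasi_basis ::
  "'a::cstar_algebra set \<Rightarrow> ('a \<Rightarrow> 'a) \<Rightarrow> nat \<Rightarrow> (nat \<Rightarrow> 'a) \<Rightarrow> bool" where
  "quasi_basis A E n l \<longleftrightarrow>
     (\<forall>i<n. l i \<in> A) \<and>
     (\<forall>x\<in>A. x = (\<Sum>i<n. l i * E ((l i)\<^sup>\<star> * x)) \<and>
            x = (\<Sum>i<n. E (x * l i) * (l i)\<^sup>\<star>))"

definition finite_index_exp :: "'a::cstar_algebra set \<Rightarrow> 'a set \<Rightarrow> ('a \<Rightarrow> 'a) \<Rightarrow> bool" where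
  "finite_index_exp A B E \<longleftrightarrow> cond_exp A B E \<and> (\<exists>n l. quasi_basis A E n l)"

text \<open>The index does not depend on the quasi-basis, so the description below is definite.\<close>

definition Ind :: "'a::cstar_algebra set \<Rightarrow> ('a \<Rightarrow> 'a) \<Rightarrow> 'a" where
  "Ind A E = (THE s. \<exists>n l. quasi_basis A E n l \<and> s = (\<Sum>i<n. l i * (l i)\<^sup>\<star>))"

definition scalar_index :: "'a::cstar_algebra set \<Rightarrow> ('a \<Rightarrow> 'a) \<Rightarrow> real" where
  "scalar_index A E = (THE c. Ind A E = c *\<^sub>R 1)"

text \<open>
  For simple unital \<open>B \<subseteq> A\<close> every finite-index expectation has scalar index, and on \<open>A\<close>
  exactly one map satisfies the following predicate.
\<close>

definition minimal_exp :: "'a::cstar_algebra set \<Rightarrow> 'a set \<Rightarrow> ('a \<Rightarrow> 'a) \<Rightarrow> bool" where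
  "minimal_exp A B E \<longleftrightarrow>
     finite_index_exp A B E \<and>
     (\<forall>F. finite_index_exp A B F \<longrightarrow> scalar_index A E \<le> scalar_index A F)"


section \<open>The basic construction\<close>

text \<open>
  \<open>A\<close> is a right Hilbert \<open>B\<close>-module with inner product \<open>E (x\<^sup>\<star> y)\<close>.  Operators on \<open>A\<close>
  are functions restricted to \<open>A\<close>, so that equality is equality on \<open>A\<close>.
\<close>

definition module_norm :: "('a::cstar_algebra \<Rightarrow> 'a) \<Rightarrow> 'a \<Rightarrow> real" where
  "module_norm E x = sqrt (norm (E (x\<^sup>\<star> * x)))"

definition module_map :: "'a::cstar_algebra set \<Rightarrow> 'a set \<Rightarrow> ('a \<Rightarrow> 'a) \<Rightarrow> bool" where
  "module_map A B T \<longleftrightarrow>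
     T \<in> A \<rightarrow>\<^sub>E A \<and>
     (\<forall>x\<in>A. \<forall>y\<in>A. T (x + y) = T x + T y) \<and>
     (\<forall>c. \<forall>x\<in>A. T (c *\<^sub>C x) = c *\<^sub>C T x) \<and>
     (\<forall>x\<in>A. \<forall>b\<in>B. T (x * b) = T x * b)"

definition module_adjoint ::
  "'a::cstar_algebra set \<Rightarrow> 'a set \<Rightarrow> ('a \<Rightarrow> 'a) \<Rightarrow> ('a \<Rightarrow> 'a) \<Rightarrow> ('a \<Rightarrow> 'a) \<Rightarrow> bool" where
  "module_adjoint A B E T S \<longleftrightarrow>
     module_map A B T \<and> module_map A B S \<and>
     (\<forall>x\<in>A. \<forall>y\<in>A. E ((T x)\<^sup>\<star> * y) = E (x\<^sup>\<star> * S y))"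

text \<open>
  The C*-algebra of adjointable operators generated by the left multiplications and the
  projection \<open>x \<mapsto> E x\<close>; the last rule is closure in the operator norm.
\<close>

inductive_set basic_ops ::
  "'a::cstar_algebra set \<Rightarrow> 'a set \<Rightarrow> ('a \<Rightarrow> 'a) \<Rightarrow> ('a \<Rightarrow> 'a) set"
  for A B :: "'a::cstar_algebra set" and E :: "'a \<Rightarrow> 'a" where
  left_mult: "a \<in> A \<Longrightarrow> restrict ((*) a) A \<in> basic_ops A B E"
| proj: "restrict E A \<in> basic_ops A B E"
| add: "T \<in> basic_ops A B E \<Longrightarrow> S \<in> basic_ops A B E \<Longrightarrow>
    restrict (\<lambda>x. T x + S x) A \<in> basic_ops A B E"
| scale: "T \<in> basic_ops A B E \<Longrightarrow> restrict (\<lambda>x. c *\<^sub>C T x) A \<in> basic_ops A B E"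
| comp: "T \<in> basic_ops A B E \<Longrightarrow> S \<in> basic_ops A B E \<Longrightarrow>
    restrict (\<lambda>x. T (S x)) A \<in> basic_ops A B E"
| adjoint: "T \<in> basic_ops A B E \<Longrightarrow> module_adjoint A B E T S \<Longrightarrow> S \<in> basic_ops A B E"
| closure: "module_adjoint A B E T T' \<Longrightarrow>
    (\<And>\<epsilon>. \<epsilon> > (0::real) \<Longrightarrow> \<exists>S. S \<in> basic_ops A B E \<and>
        (\<forall>x\<in>A. module_norm E (T x - S x) \<le> \<epsilon> * module_norm E x)) \<Longrightarrow>
    T \<in> basic_ops A B E"

text \<open>
  \<open>C\<close>, with projection \<open>e\<close>, is a copy of the basic construction of \<open>B \<subseteq> A\<close> in which
  \<open>a \<in> A\<close> is identified with left multiplication by \<open>a\<close>.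
\<close>

definition basic_construction ::
  "'a::cstar_algebra set \<Rightarrow> 'a set \<Rightarrow> ('a \<Rightarrow> 'a) \<Rightarrow> 'a set \<Rightarrow> 'a \<Rightarrow> bool" where
  "basic_construction B A E C e \<longleftrightarrow>
     cstar_subalgebra C \<and> A \<subseteq> C \<and> e \<in> C \<and>
     (\<exists>\<pi>. bij_betw \<pi> C (basic_ops A B E) \<and>
          (\<forall>a\<in>A. \<pi> a = restrict ((*) a) A) \<and>
          \<pi> e = restrict E A \<and>
          (\<forall>x\<in>C. \<forall>y\<in>C. \<pi> (x + y) = restrict (\<lambda>a. \<pi> x a + \<pi> y a) A) \<and>
          (\<forall>c. \<forall>x\<in>C. \<pi> (c *\<^sub>C x) = restrict (\<lambda>a. c *\<^sub>C \<pi> x a) A) \<and>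
          (\<forall>x\<in>C. \<forall>y\<in>C. \<pi> (x * y) = restrict (\<lambda>a. \<pi> x (\<pi> y a)) A) \<and>
          (\<forall>x\<in>C. module_adjoint A B E (\<pi> x) (\<pi> (x\<^sup>\<star>))))"

text \<open>
  \<open>E1 : C \<rightarrow> A\<close> is dual to \<open>E\<close>.  The formula determines \<open>E1\<close>, because \<open>C\<close> is the linear
  span of \<open>A e A\<close> when \<open>E\<close> has finite index.
\<close>

definition dual_exp ::
  "'a::cstar_algebra set \<Rightarrow> ('a \<Rightarrow> 'a) \<Rightarrow> 'a set \<Rightarrow> 'a \<Rightarrow> ('a \<Rightarrow> 'a) \<Rightarrow> bool" where
  "dual_exp A E C e E1 \<longleftrightarrow>
     cond_exp C A E1 \<and>
     (\<forall>x\<in>A. \<forall>y\<in>A. E1 (x * e * y) = (1 / scalar_index A E) *\<^sub>R (x * y))"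


section \<open>The tower\<close>

text \<open>
  A tower consists of \<open>B = A\<^sub>-\<^sub>1\<close>, the algebras \<open>A k\<close>, the expectations
  \<open>E k : A k \<rightarrow> A (k - 1)\<close> and the Jones projections \<open>e k \<in> A k\<close> for \<open>k \<ge> 1\<close>
  (\<open>e 0\<close> is not used).  Only \<open>E 0\<close> is required to be minimal: the dual of a minimal
  expectation is again minimal, with the same index.
\<close>

definition below :: "'a set \<Rightarrow> (nat \<Rightarrow> 'a set) \<Rightarrow> nat \<Rightarrow> 'a set" where
  "below B A k = (case k of 0 \<Rightarrow> B | Suc j \<Rightarrow> A j)"

definition jones_tower ::
  "'a::cstar_algebra set \<Rightarrow> (nat \<Rightarrow> 'a set) \<Rightarrow> (nat \<Rightarrow> 'a \<Rightarrow> 'a) \<Rightarrow> (nat \<Rightarrow> 'a) \<Rightarrow> bool" where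
  "jones_tower B A E e \<longleftrightarrow>
     minimal_exp (A 0) B (E 0) \<and>
     (\<forall>k. basic_construction (below B A k) (A k) (E k) (A (Suc k)) (e (Suc k)) \<and>
          dual_exp (A k) (E k) (A (Suc k)) (e (Suc k)) (E (Suc k)))"

definition tau :: "(nat \<Rightarrow> 'a::cstar_algebra set) \<Rightarrow> (nat \<Rightarrow> 'a \<Rightarrow> 'a) \<Rightarrow> real" where
  "tau A E = 1 / scalar_index (A 0) (E 0)"

text \<open>
  \<open>trace_upto E k = E 0 \<circ> \<dots> \<circ> E k\<close>.  On \<open>B' \<inter> A k\<close> its values lie in \<open>B' \<inter> B = \<complex> 1\<close>,
  so there it is the trace, with scalars regarded as multiples of the unit.
\<close>

primrec trace_upto :: "(nat \<Rightarrow> 'a \<Rightarrow> 'a) \<Rightarrow> nat \<Rightarrow> 'a \<Rightarrow> 'a" where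
  "trace_upto E 0 = E 0"
| "trace_upto E (Suc k) = trace_upto E k \<circ> E (Suc k)"

text \<open>
  The trace-preserving expectation of \<open>B' \<inter> A k\<close> onto \<open>A' \<inter> A k\<close> (with \<open>A = A 0\<close>) is
  unique on \<open>B' \<inter> A k\<close>; the choice affects only values outside it.
\<close>

definition commutant_exp ::
  "'a::cstar_algebra set \<Rightarrow> (nat \<Rightarrow> 'a set) \<Rightarrow> (nat \<Rightarrow> 'a \<Rightarrow> 'a) \<Rightarrow> nat \<Rightarrow> 'a \<Rightarrow> 'a" where
  "commutant_exp B A E k =
     (SOME F. cond_exp (rel_commutant B (A k)) (rel_commutant (A 0) (A k)) F \<and>
              (\<forall>x \<in> rel_commutant B (A k). trace_upto E k (F x) = trace_upto E k x))"


section \<open>Fourier transforms and rotations\<close>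

text \<open>\<open>descend e n = e n \<cdots> e 2 e 1\<close> and \<open>ascend e n = e 1 e 2 \<cdots> e n\<close>.\<close>

primrec descend :: "(nat \<Rightarrow> 'a::monoid_mult) \<Rightarrow> nat \<Rightarrow> 'a" where
  "descend e 0 = 1"
| "descend e (Suc n) = e (Suc n) * descend e n"

primrec ascend :: "(nat \<Rightarrow> 'a::monoid_mult) \<Rightarrow> nat \<Rightarrow> 'a" where
  "ascend e 0 = 1"
| "ascend e (Suc n) = ascend e n * e (Suc n)"

definition fourier ::
  "'a::cstar_algebra set \<Rightarrow> (nat \<Rightarrow> 'a set) \<Rightarrow> (nat \<Rightarrow> 'a \<Rightarrow> 'a) \<Rightarrow> (nat \<Rightarrow> 'a) \<Rightarrow> nat \<Rightarrow> 'a \<Rightarrow> 'a"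
  where
  "fourier B A E e k x =
     tau A E powr (- ((real k + 2) / 2)) *\<^sub>R
       commutant_exp B A E (k + 1) (x * descend e (k + 1))"

definition inv_fourier ::
  "(nat \<Rightarrow> 'a::cstar_algebra set) \<Rightarrow> (nat \<Rightarrow> 'a \<Rightarrow> 'a) \<Rightarrow> (nat \<Rightarrow> 'a) \<Rightarrow> nat \<Rightarrow> 'a \<Rightarrow> 'a"
  where
  "inv_fourier A E e k x =
     tau A E powr (- ((real k + 2) / 2)) *\<^sub>R E (k + 1) (x * ascend e (k + 1))"

definition rotation ::
  "'a::cstar_algebra set \<Rightarrow> (nat \<Rightarrow> 'a set) \<Rightarrow> (nat \<Rightarrow> 'a \<Rightarrow> 'a) \<Rightarrow> (nat \<Rightarrow> 'a) \<Rightarrow> nat \<Rightarrow> 'a \<Rightarrow> 'a"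
  where
  "rotation B A E e k x = (inv_fourier A E e k ((fourier B A E e k x)\<^sup>\<star>))\<^sup>\<star>"

text \<open>
  The tower of \<open>B \<subseteq> A 1\<close>, identified with \<open>B \<subseteq> A 1 \<subseteq> A 3 \<subseteq> A 5 \<subseteq> \<dots>\<close>,
  with expectations \<open>E (2 j) \<circ> E (2 j + 1)\<close>; the Jones projections \<open>odd_proj A E e j\<close>
  are meaningful for \<open>j \<ge> 1\<close>.
\<close>

definition odd_alg :: "(nat \<Rightarrow> 'a set) \<Rightarrow> nat \<Rightarrow> 'a set" where
  "odd_alg A j = A (2 * j + 1)"

definition odd_exp :: "(nat \<Rightarrow> 'a \<Rightarrow> 'a) \<Rightarrow> nat \<Rightarrow> 'a \<Rightarrow> 'a" where
  "odd_exp E j = E (2 * j) \<circ> E (2 * j + 1)"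

definition odd_proj ::
  "(nat \<Rightarrow> 'a::cstar_algebra set) \<Rightarrow> (nat \<Rightarrow> 'a \<Rightarrow> 'a) \<Rightarrow> (nat \<Rightarrow> 'a) \<Rightarrow> nat \<Rightarrow> 'a" where
  "odd_proj A E e j =
     (1 / tau A E) *\<^sub>R (e (2 * j) * e (2 * j - 1) * e (2 * j + 1) * e (2 * j))"

definition rotation_0 ::
  "'a::cstar_algebra set \<Rightarrow> (nat \<Rightarrow> 'a set) \<Rightarrow> (nat \<Rightarrow> 'a \<Rightarrow> 'a) \<Rightarrow> (nat \<Rightarrow> 'a) \<Rightarrow> 'a \<Rightarrow> 'a" where
  "rotation_0 B A E e = rotation B A E e 1"

definition rotation_1 ::
  "'a::cstar_algebra set \<Rightarrow> (nat \<Rightarrow> 'a set) \<Rightarrow> (nat \<Rightarrow> 'a \<Rightarrow> 'a) \<Rightarrow> (nat \<Rightarrow> 'a) \<Rightarrow> 'a \<Rightarrow> 'a" where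
  "rotation_1 B A E e = rotation B (odd_alg A) (odd_exp E) (odd_proj A E e) 1"

end

theory Submission
  imports Defs
begin

text \<open>
  The algebra \<open>A\<^sub>1\<close> acts on the Hilbert module \<open>A\<close>, and \<open>B' \<inter> A\<^sub>1\<close> acts by maps that are
  \<open>B\<close>-linear on both sides.  A computation with a quasi-basis shows that the rotation is
  conjugation of these maps by the involution of the module:
  \<open>\<gamma>\<^sub>0 x (a) = (x\<^sup>\<star> (a\<^sup>\<star>))\<^sup>\<star>\<close> for \<open>a\<close> in \<open>A\<close>.  This formula makes linearity and
  anti-multiplicativity evident, and it gives \<open>\<gamma>\<^sub>0 (\<gamma>\<^sub>0 x) = x\<close>, hence bijectivity, as soon
  as \<open>\<gamma>\<^sub>0\<close> preserves adjoints.  The adjoint is taken with respect to the inner product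
  \<open>E\<^sub>0 (a\<^sup>\<star> b)\<close>, whereas \<open>a \<mapsto> a\<^sup>\<star>\<close> exchanges it with \<open>E\<^sub>0 (a b\<^sup>\<star>)\<close>; the two are reconciled by
  the trace property \<open>E\<^sub>0 E\<^sub>1 (x z) = E\<^sub>0 E\<^sub>1 (z x)\<close> for \<open>x\<close> in \<open>B' \<inter> A\<^sub>1\<close> and \<open>z\<close> in \<open>A\<^sub>1\<close>
  (\<open>markov.tracial\<close>, \<open>\<gamma>_anti_automorphism\<close>).

  The trace property comes from minimality.  For a quasi-basis \<open>l\<close> put
  \<open>\<Phi> x = \<Sum> l\<^sub>i x l\<^sub>i\<^sup>\<star>\<close>.  Perturbing the minimal \<open>E\<^sub>0\<close> to \<open>E\<^sub>0 (u x u) / E\<^sub>0 (u u)\<close>, with \<open>u\<close> close to \<open>1\<close>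
  in \<open>B' \<inter> A\<close>, the first-order condition is \<open>\<Phi> x = c E\<^sub>0 x\<close> on \<open>B' \<inter> A\<close>, where \<open>c\<close> is the index
  (\<open>markov_of_minimal\<close>; simplicity enters here, since it makes the values scalars).  This condition,
  collected in the locale \<open>markov\<close>, implies that the modular automorphism
  of \<open>E\<^sub>0\<close> on \<open>B' \<inter> A\<close> is a positive operator with square \<open>1\<close>, hence trivial.  It is inherited by the
  dual expectation (\<open>dual_markov\<close>) and by compositions (\<open>markov_comp\<close>), and so it is available at every
  level of the tower.

  The Fourier transform contains the trace-preserving expectation onto \<open>A' \<inter> A\<^sub>2\<close>, which is fixed
  only by its defining properties.  It is \<open>(1/c) \<Phi>\<close>: trace preservation is again
  the condition \<open>\<Phi> = c E\<^sub>0\<close>, and uniqueness is faithfulness of \<open>E\<^sub>0 E\<^sub>1 E\<^sub>2\<close>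
  (\<open>commutant_expectation\<close>, \<open>commutant_expectation_unique\<close>, \<open>rotation_formula\<close>).  That \<open>\<Phi>\<close> is positive,
  in the sense that \<open>\<Phi> (x\<^sup>\<star> x)\<close> has the form \<open>b\<^sup>\<star> b\<close>, rests on the elementary theory of positive
  elements, in particular on square roots and on the positivity of \<open>b\<^sup>\<star> b\<close>.

  All this uses only a few algebraic properties of the basic construction, collected in the locale
  \<open>jones\<close>.  The sequence \<open>B \<subseteq> A\<^sub>1 \<subseteq> A\<^sub>3 \<subseteq> A\<^sub>5\<close> with the projections built from
  \<open>e\<^sub>2 e\<^sub>1 e\<^sub>3 e\<^sub>2\<close> and \<open>e\<^sub>4 e\<^sub>3 e\<^sub>5 e\<^sub>4\<close> has them too (\<open>jones_two_step\<close>), so the statement about \<open>\<gamma>\<^sub>1\<close> is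
  the statement about \<open>\<gamma>\<^sub>0\<close> for that tower.
\<close>

section \<open>Arithmetic in a C*-algebra\<close>

lemma star_zero [simp]: "(0::'a::cstar_algebra)\<^sup>\<star> = 0"
  by (metis add_cancel_left_left star_add)

lemma star_one [simp]: "(1::'a::cstar_algebra)\<^sup>\<star> = 1"
  by (metis mult.right_neutral star_mult star_star mult.left_neutral)

lemma star_scaleR [simp]: "(r *\<^sub>R x)\<^sup>\<star> = r *\<^sub>R (x::'a::cstar_algebra)\<^sup>\<star>"
  by (simp add: scaleR_scaleC star_scaleC)

lemma star_minus [simp]: "(- x)\<^sup>\<star> = - (x::'a::cstar_algebra)\<^sup>\<star>"
  using star_scaleR[of "-1" x] by simp

lemma star_diff: "(x - y)\<^sup>\<star> = (x::'a::cstar_algebra)\<^sup>\<star> - y\<^sup>\<star>"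
  using star_add[of x "-y"] by simp

lemma star_sum: "(\<Sum>i\<in>I. f i)\<^sup>\<star> = (\<Sum>i\<in>I. (f i :: 'a::cstar_algebra)\<^sup>\<star>)"
  by (induction I rule: infinite_finite_induct) (auto simp: star_add)

lemmas star_simps = star_add star_diff star_mult star_star star_sum

lemma norm_star [simp]: "norm ((x::'a::cstar_algebra)\<^sup>\<star>) = norm x"
proof -
  have *: "norm y \<le> norm (y\<^sup>\<star>)" for y :: 'a
  proof (cases "y = 0")
    case False
    have "norm y * norm y \<le> norm (y\<^sup>\<star>) * norm y"
      using cstar_identity[of y] norm_mult_ineq[of "y\<^sup>\<star>" y] by (simp add: power2_eq_square)
    thus ?thesis using False by (simp add: mult_le_cancel_right)
  qed auto
  show ?thesis using *[of x] *[of "x\<^sup>\<star>"] by (simp add: star_star)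
qed

lemma star_mult_self_eq_0: "(x::'a::cstar_algebra)\<^sup>\<star> * x = 0 \<Longrightarrow> x = 0"
  using cstar_identity[of x] by simp

lemma bounded_linear_star: "bounded_linear (star :: 'a::cstar_algebra \<Rightarrow> 'a)"
  by (rule bounded_linear_intro[where K = 1]) (auto simp: star_add)

lemmas tendsto_star = bounded_linear.tendsto[OF bounded_linear_star]

lemma scaleC_zero_left [simp]: "0 *\<^sub>C (x::'a::cstar_algebra) = 0"
  using scaleR_scaleC[of 0 x] by simp

lemma scaleC_one [simp]: "1 *\<^sub>C (x::'a::cstar_algebra) = x"
  using scaleR_scaleC[of 1 x] by simp

lemma scaleC_zero_right [simp]: "c *\<^sub>C (0::'a::cstar_algebra) = 0"
  by (metis scaleC_add_right add_cancel_right_right)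

lemma scaleC_minus_left: "(- c) *\<^sub>C (x::'a::cstar_algebra) = - (c *\<^sub>C x)"
  by (metis add.inverse_unique add.right_inverse scaleC_add_left scaleC_zero_left)

lemma scaleC_minus_right: "c *\<^sub>C (- x::'a::cstar_algebra) = - (c *\<^sub>C x)"
  by (metis add.inverse_unique add.right_inverse scaleC_add_right scaleC_zero_right)

lemma scaleC_diff_right: "c *\<^sub>C (x - y::'a::cstar_algebra) = c *\<^sub>C x - c *\<^sub>C y"
  using scaleC_add_right[of c x "-y"] by (simp add: scaleC_minus_right)

lemma scaleC_scaleR: "c *\<^sub>C r *\<^sub>R (x::'a::cstar_algebra) = r *\<^sub>R c *\<^sub>C x"
  by (simp add: scaleR_scaleC scaleC_scaleC mult.commute)

lemma scaleC_sum: "c *\<^sub>C (\<Sum>i\<in>I. f i) = (\<Sum>i\<in>I. c *\<^sub>C (f i :: 'a::cstar_algebra))"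
  by (induction I rule: infinite_finite_induct) (auto simp: scaleC_add_right)

lemma subalgD:
  assumes "cstar_subalgebra S"
  shows subalg_closed: "closed S" and subalg_one: "1 \<in> S"
    and subalg_add: "x \<in> S \<Longrightarrow> y \<in> S \<Longrightarrow> x + y \<in> S"
    and subalg_mult: "x \<in> S \<Longrightarrow> y \<in> S \<Longrightarrow> x * y \<in> S"
    and subalg_scaleC: "x \<in> S \<Longrightarrow> c *\<^sub>C x \<in> S"
    and subalg_star: "x \<in> S \<Longrightarrow> x\<^sup>\<star> \<in> S"
  using assms unfolding cstar_subalgebra_def by auto

lemma subalg_scaleR: "cstar_subalgebra S \<Longrightarrow> x \<in> S \<Longrightarrow> r *\<^sub>R x \<in> S"
  by (simp add: scaleR_scaleC subalg_scaleC)

lemma subalg_zero: "cstar_subalgebra S \<Longrightarrow> 0 \<in> S"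
  using subalg_scaleR[of S 1 0] subalg_one by auto

lemma subalg_uminus: "cstar_subalgebra S \<Longrightarrow> x \<in> S \<Longrightarrow> - x \<in> S"
  using subalg_scaleR[of S x "-1"] by auto

lemma subalg_diff: "cstar_subalgebra S \<Longrightarrow> x \<in> S \<Longrightarrow> y \<in> S \<Longrightarrow> x - y \<in> S"
  using subalg_add[of S x "-y"] subalg_uminus by auto

lemma subalg_sum: "cstar_subalgebra S \<Longrightarrow> (\<And>i. i \<in> I \<Longrightarrow> f i \<in> S) \<Longrightarrow> (\<Sum>i\<in>I. f i) \<in> S"
  by (induction I rule: infinite_finite_induct) (auto simp: subalg_add subalg_zero)

lemmas subalg_intros = subalg_one subalg_add subalg_mult subalg_scaleC subalg_star subalg_scaleR
  subalg_zero subalg_uminus subalg_diff subalg_sum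

lemma cstar_subalgebra_UNIV: "cstar_subalgebra UNIV"
  by (auto simp: cstar_subalgebra_def)

lemma rel_commutantI: "x \<in> C \<Longrightarrow> (\<And>b. b \<in> B \<Longrightarrow> b * x = x * b) \<Longrightarrow> x \<in> rel_commutant B C"
  and rel_commutant_mem: "x \<in> rel_commutant B C \<Longrightarrow> x \<in> C"
  and rel_commutant_comm: "x \<in> rel_commutant B C \<Longrightarrow> b \<in> B \<Longrightarrow> b * x = x * b"
  by (auto simp: rel_commutant_def)

lemma cstar_subalgebra_rel_commutant:
  fixes B :: "'a::cstar_algebra set"
  assumes C: "cstar_subalgebra C" and B: "\<And>b. b \<in> B \<Longrightarrow> b\<^sup>\<star> \<in> B"
  shows "cstar_subalgebra (rel_commutant B C)"
  unfolding cstar_subalgebra_def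
proof (intro conjI ballI allI)
  have "rel_commutant B C = C \<inter> (\<Inter>b\<in>B. {x. b * x = x * b})"
    by (auto simp: rel_commutant_def)
  moreover have "closed {x. b * x = x * b}" for b :: 'a
    by (intro closed_Collect_eq continuous_intros)
  ultimately show "closed (rel_commutant B C)"
    using subalg_closed[OF C] by (auto intro!: closed_Int closed_INT)
  show "1 \<in> rel_commutant B C" by (auto simp: rel_commutant_def C subalg_one)
  fix x assume x: "x \<in> rel_commutant B C"
  show "c *\<^sub>C x \<in> rel_commutant B C" for c
    using x C by (auto simp: rel_commutant_def subalg_scaleC mult_scaleC_left mult_scaleC_right)
  show "x\<^sup>\<star> \<in> rel_commutant B C"
  proof (rule rel_commutantI)
    show "x\<^sup>\<star> \<in> C" using x C by (auto simp: rel_commutant_def subalg_star)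
    fix b assume "b \<in> B"
    hence "b\<^sup>\<star> * x = x * b\<^sup>\<star>" using B rel_commutant_comm[OF x] by blast
    hence "(b\<^sup>\<star> * x)\<^sup>\<star> = (x * b\<^sup>\<star>)\<^sup>\<star>" by simp
    thus "b * x\<^sup>\<star> = x\<^sup>\<star> * b" by (simp add: star_simps)
  qed
  fix y assume y: "y \<in> rel_commutant B C"
  show "x + y \<in> rel_commutant B C"
    using x y C by (auto simp: rel_commutant_def subalg_add algebra_simps)
  show "x * y \<in> rel_commutant B C"
    using x y C by (auto simp: rel_commutant_def subalg_mult) (metis mult.assoc)
qed

section \<open>Positive elements\<close>

text \<open>
  The equation \<open>(1 - s)\<^sup>2 = 1 - x\<close> reads \<open>s = (x + s\<^sup>2)/2\<close>.  Iterating from \<open>0\<close>, the increments are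
  dominated in norm by those of the scalar iteration for \<open>x = 1\<close>, which is increasing and bounded
  by \<open>1\<close>; so the iteration converges up to and including \<open>norm x = 1\<close>.
\<close>
lemma sqrt_one_minus:
  fixes x :: "'a::cstar_algebra"
  assumes S: "cstar_subalgebra S" "x \<in> S" and sa: "x\<^sup>\<star> = x" and le: "norm x \<le> 1"
  obtains s where "s \<in> S" "s\<^sup>\<star> = s" "norm s \<le> 1" "(1 - s) * (1 - s) = 1 - x"
    "\<And>y. y * x = x * y \<Longrightarrow> y * s = s * y"
proof -
  define f where "f = rec_nat (0::'a) (\<lambda>_ s. (1/2) *\<^sub>R (x + s * s))"
  define g where "g = rec_nat (0::real) (\<lambda>_ s. (1/2) * (1 + s * s))"
  have f0: "f 0 = 0" and fS: "f (Suc n) = (1/2) *\<^sub>R (x + f n * f n)" for n by (auto simp: f_def)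
  have g0: "g 0 = 0" and gS: "g (Suc n) = (1/2) * (1 + g n * g n)" for n by (auto simp: g_def)
  have g01: "0 \<le> g n \<and> g n \<le> 1" for n
    by (induction n) (auto simp: g0 gS mult_le_one)
  have "g n \<le> g (Suc n)" for n
  proof -
    have "0 \<le> (1 - g n) * (1 - g n)" by simp
    thus ?thesis by (simp add: gS algebra_simps)
  qed
  hence inc: "incseq g" by (rule incseq_SucI)
  then obtain L where L: "g \<longlonglongrightarrow> L" using incseq_convergent[of g 1] g01 by blast
  have fg: "norm (f n) \<le> g n" for n
  proof (induction n)
    case (Suc n)
    have "norm (f n * f n) \<le> g n * g n"
      using Suc norm_mult_ineq[of "f n" "f n"] g01[of n] mult_mono[OF Suc Suc] by force
    hence "norm (x + f n * f n) \<le> 1 + g n * g n" using norm_triangle_ineq[of x "f n * f n"] le by linarith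
    thus ?case by (simp add: fS gS)
  qed (auto simp: f0 g0)
  have diff: "norm (f (Suc n) - f n) \<le> g (Suc n) - g n" for n
  proof (induction n)
    case 0 thus ?case using le by (simp add: f0 g0 fS gS)
  next
    case (Suc n)
    let ?d = "f (Suc n) - f n"
    have "f (Suc (Suc n)) - f (Suc n) = (1/2) *\<^sub>R (f (Suc n) * ?d + ?d * f n)"
      unfolding fS[of "Suc n"] fS[of n] scaleR_diff_right[symmetric]
      unfolding fS[of n, symmetric] by (simp add: algebra_simps)
    hence "norm (f (Suc (Suc n)) - f (Suc n)) = (1/2) * norm (f (Suc n) * ?d + ?d * f n)" by simp
    also have "norm (f (Suc n) * ?d + ?d * f n) \<le> norm (f (Suc n)) * norm ?d + norm ?d * norm (f n)"
      by (intro order.trans[OF norm_triangle_ineq] add_mono norm_mult_ineq)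
    also have "\<dots> \<le> g (Suc n) * (g (Suc n) - g n) + (g (Suc n) - g n) * g n"
      using fg[of n] fg[of "Suc n"] Suc g01[of n] g01[of "Suc n"] inc[THEN incseq_SucD, of n]
      by (intro add_mono mult_mono) (auto intro: order.trans[OF norm_ge_zero])
    finally show ?case by (simp add: gS[of "Suc n"] gS[of n] algebra_simps)
  qed
  have "summable (\<lambda>n. g (Suc n) - g n)" using telescope_summable[OF L] .
  hence "summable (\<lambda>n. f (Suc n) - f n)"
    by (rule summable_comparison_test'[where N = 0]) (rule diff)
  hence "(\<lambda>n. \<Sum>k<n. f (Suc k) - f k) \<longlonglongrightarrow> (\<Sum>k. f (Suc k) - f k)" by (rule summable_LIMSEQ)
  then obtain s where lim: "f \<longlonglongrightarrow> s" by (auto simp: sum_lessThan_telescope f0)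
  have limS: "(\<lambda>n. f (Suc n)) \<longlonglongrightarrow> s" using lim by (rule LIMSEQ_Suc)
  have "(\<lambda>n. (1/2) *\<^sub>R (x + f n * f n)) \<longlonglongrightarrow> (1/2) *\<^sub>R (x + s * s)"
    by (intro tendsto_intros lim)
  hence "s = (1/2) *\<^sub>R (x + s * s)" using limS LIMSEQ_unique by (auto simp: fS)
  hence "2 *\<^sub>R s = x + s * s" by (metis scaleR_scaleR scaleR_one field_sum_of_halves
        divide_self_if mult.commute nonzero_mult_div_cancel_right times_divide_eq_left zero_neq_numeral
        mult_numeral_1 mult_1_right times_divide_eq_right)
  hence eq: "(1 - s) * (1 - s) = 1 - x" by (simp add: algebra_simps scaleR_2)
  show thesis
  proof (rule that)
    have "f n \<in> S" for n by (induction n) (auto simp: f0 fS S subalg_intros)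
    thus "s \<in> S" using lim subalg_closed[OF S(1)] closed_sequentially by blast
    have "(f n)\<^sup>\<star> = f n" for n by (induction n) (auto simp: f0 fS star_simps sa)
    hence "f \<longlonglongrightarrow> s\<^sup>\<star>" using tendsto_star[OF lim] by simp
    thus "s\<^sup>\<star> = s" using lim LIMSEQ_unique by blast
    show "norm s \<le> 1" using fg g01 by (intro Lim_bounded[OF tendsto_norm[OF lim], of 0]) (metis order.trans)
    show "(1 - s) * (1 - s) = 1 - x" by (rule eq)
    fix y assume y: "y * x = x * y"
    have "y * f n = f n * y" for n
    proof (induction n)
      case (Suc n)
      have "y * (f n * f n) = f n * f n * y" using Suc by (metis mult.assoc)
      thus ?case by (simp add: fS y distrib_left distrib_right)
    qed (simp add: f0)
    moreover have "(\<lambda>n. y * f n) \<longlonglongrightarrow> y * s" "(\<lambda>n. f n * y) \<longlonglongrightarrow> s * y" by (intro tendsto_intros lim)+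
    ultimately show "y * s = s * y" using LIMSEQ_unique by auto
  qed
qed

text \<open>
  Squares of self-adjoint elements.  This form makes the norm estimates below accessible; by
  \<open>pos_star_mult_self\<close> it describes the same elements as \<open>b\<^sup>\<star> b\<close>.
\<close>
definition pos :: "'a::cstar_algebra \<Rightarrow> bool" where
  "pos h \<longleftrightarrow> (\<exists>w. w\<^sup>\<star> = w \<and> h = w * w)"

lemma pos_zero [simp]: "pos 0" unfolding pos_def by (intro exI[of _ 0]) auto

lemma pos_star: "pos h \<Longrightarrow> h\<^sup>\<star> = h" by (auto simp: pos_def star_simps)

text \<open>
  For self-adjoint \<open>h\<close>, the estimate \<open>norm (t - h) \<le> t\<close> says that the spectrum of \<open>h\<close> lies
  in \<open>[0, 2t]\<close>.  It is stable under sums and limits, which squares are not visibly, and this lemma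
  converts it back into a square.
\<close>
lemma sqrt_of_near_scalar:
  fixes h :: "'a::cstar_algebra"
  assumes S: "cstar_subalgebra S" "h \<in> S" and sa: "h\<^sup>\<star> = h" and le: "norm (t *\<^sub>R 1 - h) \<le> t"
  obtains w where "w \<in> S" "w\<^sup>\<star> = w" "w * w = h" "norm (sqrt t *\<^sub>R 1 - w) \<le> sqrt t"
    "\<And>y. y * h = h * y \<Longrightarrow> y * w = w * y"
proof (cases "t = 0")
  case True
  with le have "h = 0" by simp
  thus ?thesis using that[of 0] True S subalg_zero by auto
next
  case False
  have "t > 0" using False le norm_ge_zero[of "t *\<^sub>R 1 - h"] by linarith
  define x where "x = 1 - (1/t) *\<^sub>R h"
  have "x = (1/t) *\<^sub>R (t *\<^sub>R 1 - h)" using \<open>t > 0\<close> by (simp add: x_def algebra_simps)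
  hence "norm x = (1/t) * norm (t *\<^sub>R 1 - h)" using \<open>t > 0\<close> by (simp del: scaleR_diff_right)
  hence "t * norm x \<le> t * 1" using le \<open>t > 0\<close> by simp
  hence "norm x \<le> 1" using \<open>t > 0\<close> by (rule mult_left_le_imp_le)
  moreover have "x \<in> S" "x\<^sup>\<star> = x" using S sa by (auto simp: x_def subalg_intros star_simps)
  ultimately obtain s where s: "s \<in> S" "s\<^sup>\<star> = s" "norm s \<le> 1" "(1 - s) * (1 - s) = 1 - x"
    "\<And>y. y * x = x * y \<Longrightarrow> y * s = s * y" using sqrt_one_minus S(1) by metis
  show ?thesis
  proof (rule that)
    let ?w = "sqrt t *\<^sub>R (1 - s)"
    show "?w \<in> S" "?w\<^sup>\<star> = ?w" using S s by (auto simp: subalg_intros star_simps)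
    show "?w * ?w = h" using \<open>t > 0\<close> s(4) by (simp add: x_def)
    have "sqrt t *\<^sub>R 1 - ?w = sqrt t *\<^sub>R s" by (simp add: algebra_simps)
    thus "norm (sqrt t *\<^sub>R 1 - ?w) \<le> sqrt t" using s(3) \<open>t > 0\<close> mult_left_mono[of "norm s" 1 "sqrt t"] by simp
    fix y assume "y * h = h * y"
    hence "y * x = x * y" by (simp add: x_def algebra_simps)
    hence "y * s = s * y" by (rule s(5))
    thus "y * ?w = ?w * y" by (simp add: algebra_simps)
  qed
qed

text \<open>
  The element \<open>u = a + \<i> c\<close> satisfies \<open>u\<^sup>\<star> u = a\<^sup>2 + c\<^sup>2 = t\<close>, so its norm is the square root of \<open>t\<close>,
  and \<open>c\<close> is its imaginary part.
\<close>
lemma norm_square_le_of_sum_squares: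
  fixes a c :: "'a::cstar_algebra"
  assumes "a\<^sup>\<star> = a" "c\<^sup>\<star> = c" "a * c = c * a" "a * a + c * c = t *\<^sub>R 1" "t \<ge> 0"
  shows "norm (c * c) \<le> t"
proof -
  define u where "u = a + \<i> *\<^sub>C c"
  have us: "u\<^sup>\<star> = a - \<i> *\<^sub>C c"
    using assms by (simp add: u_def star_simps star_scaleC scaleC_minus_left)
  have "u\<^sup>\<star> * u = t *\<^sub>R 1"
    unfolding us unfolding u_def using assms(3,4)
    by (simp add: algebra_simps mult_scaleC_left mult_scaleC_right scaleC_scaleC scaleC_minus_left
        scaleC_add_right scaleC_diff_right)
  hence nu: "(norm u)\<^sup>2 = \<bar>t\<bar>" using cstar_identity[of u] by simp
  have "2 *\<^sub>R (\<i> *\<^sub>C c) = u - u\<^sup>\<star>" unfolding us unfolding u_def by (simp add: scaleR_2)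
  hence "2 * norm c = norm (u - u\<^sup>\<star>)" by (metis norm_scaleC norm_scaleR norm_ii mult_1 abs_numeral)
  also have "\<dots> \<le> norm u + norm u" using norm_triangle_ineq4[of u "u\<^sup>\<star>"] by simp
  finally have "norm c \<le> norm u" by simp
  thus ?thesis
    using nu cstar_identity[of c] assms(2,5) power_mono[of "norm c" "norm u" 2] by auto
qed

lemma pos_square: "w\<^sup>\<star> = w \<Longrightarrow> pos (w * w)"
  by (auto simp: pos_def)

lemma pos_of_near_scalar: "h\<^sup>\<star> = h \<Longrightarrow> norm (t *\<^sub>R 1 - h) \<le> t \<Longrightarrow> pos h"
  by (rule sqrt_of_near_scalar[OF cstar_subalgebra_UNIV UNIV_I]) (auto simp: pos_def)

text \<open>
  Write \<open>h = a\<^sup>2\<close>.  Since \<open>t - (t - h)\<close> has norm at most \<open>t\<close>, the element \<open>t - h\<close> has a square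
  root commuting with \<open>a\<close>, and the two squares add up to \<open>t\<close>.
\<close>
lemma near_scalar_of_pos:
  assumes "pos h" "norm h \<le> t"
  shows "norm (t *\<^sub>R 1 - h) \<le> t"
proof -
  obtain a where a: "a\<^sup>\<star> = a" "h = a * a" using assms(1) by (auto simp: pos_def)
  have "(t *\<^sub>R 1 - h)\<^sup>\<star> = t *\<^sub>R 1 - h" using a by (simp add: star_simps)
  moreover have "norm (t *\<^sub>R 1 - (t *\<^sub>R 1 - h)) \<le> t" using assms by simp
  ultimately obtain c where c: "c\<^sup>\<star> = c" "c * c = t *\<^sub>R 1 - h"
    "\<And>y. y * (t *\<^sub>R 1 - h) = (t *\<^sub>R 1 - h) * y \<Longrightarrow> y * c = c * y"
    using sqrt_of_near_scalar[OF cstar_subalgebra_UNIV UNIV_I] by metis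
  have "a * c = c * a" by (rule c(3)) (simp add: a algebra_simps)
  moreover have "t \<ge> 0" using assms(2) norm_ge_zero order.trans by blast
  ultimately show ?thesis
    using norm_square_le_of_sum_squares[of a c t] a c(1,2) by simp
qed

lemma pos_sqrt:
  fixes h :: "'a::cstar_algebra"
  assumes S: "cstar_subalgebra S" "h \<in> S" and h: "pos h"
  obtains w where "w \<in> S" "w\<^sup>\<star> = w" "w * w = h" "pos w" "\<And>y. y * h = h * y \<Longrightarrow> y * w = w * y"
  using sqrt_of_near_scalar[OF S pos_star[OF h] near_scalar_of_pos[OF h order.refl]]
    pos_of_near_scalar by metis

lemma pos_add:
  assumes "pos x" "pos y" shows "pos (x + y)"
proof (rule pos_of_near_scalar)
  show "(x + y)\<^sup>\<star> = x + y" using assms by (simp add: star_simps pos_star)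
  have eq: "(norm x + norm y) *\<^sub>R 1 - (x + y) = (norm x *\<^sub>R 1 - x) + (norm y *\<^sub>R 1 - y)"
    by (simp add: algebra_simps)
  show "norm ((norm x + norm y) *\<^sub>R 1 - (x + y)) \<le> norm x + norm y"
    unfolding eq using assms
    by (intro order.trans[OF norm_triangle_ineq] add_mono near_scalar_of_pos order.refl)
qed

lemma pos_sum: "(\<And>i. i \<in> I \<Longrightarrow> pos (f i)) \<Longrightarrow> pos (\<Sum>i\<in>I. f i)"
  by (induction I rule: infinite_finite_induct) (auto simp: pos_add)

lemma pos_scaleR: "pos x \<Longrightarrow> r \<ge> 0 \<Longrightarrow> pos (r *\<^sub>R x)"
proof -
  assume "pos x" "r \<ge> 0"
  then obtain w where "w\<^sup>\<star> = w" "x = w * w" by (auto simp: pos_def)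
  thus "pos (r *\<^sub>R x)" using \<open>r \<ge> 0\<close> unfolding pos_def by (intro exI[of _ "sqrt r *\<^sub>R w"]) auto
qed

lemma pos_norm_minus:
  assumes "x\<^sup>\<star> = x" "norm x \<le> t" shows "pos (t *\<^sub>R 1 - x)"
  by (rule pos_of_near_scalar[of _ t]) (use assms in \<open>auto simp: star_simps\<close>)

text \<open>
  With \<open>t = norm y\<close>, both \<open>x\<close> and \<open>t - x = (t - y) + (y - x)\<close> are squares of commuting
  self-adjoint elements.
\<close>
lemma norm_mono_pos:
  assumes x: "pos x" and yx: "pos (y - x)"
  shows "norm x \<le> norm y"
proof -
  let ?t = "norm y"
  have "pos (x + (y - x))" using x yx by (rule pos_add)
  hence "pos y" by simp
  hence "pos (?t *\<^sub>R 1 - y)" by (intro pos_norm_minus) (auto simp: pos_star)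
  hence "pos ((?t *\<^sub>R 1 - y) + (y - x))" using yx by (rule pos_add)
  hence p: "pos (?t *\<^sub>R 1 - x)" by simp
  obtain d where d: "d\<^sup>\<star> = d" "d * d = ?t *\<^sub>R 1 - x"
    "\<And>z. z * (?t *\<^sub>R 1 - x) = (?t *\<^sub>R 1 - x) * z \<Longrightarrow> z * d = d * z"
    using pos_sqrt[OF cstar_subalgebra_UNIV UNIV_I p] by metis
  obtain w where w: "w\<^sup>\<star> = w" "x = w * w" using x by (auto simp: pos_def)
  have "w * d = d * w" by (rule d(3)) (simp add: w algebra_simps)
  thus ?thesis using norm_square_le_of_sum_squares[of d w ?t] d(1,2) w by simp
qed

lemma pos_antisym: "pos x \<Longrightarrow> pos (- x) \<Longrightarrow> x = 0"
  using norm_mono_pos[of x 0] by simp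

lemma pos_add_eq_0: "pos x \<Longrightarrow> pos y \<Longrightarrow> x + y = 0 \<Longrightarrow> x = 0"
  using pos_antisym[of x] by (simp add: add_eq_0_iff)

lemma pos_scalarD: "pos (r *\<^sub>R (1::'a::cstar_algebra)) \<Longrightarrow> r \<ge> 0"
proof (rule ccontr)
  assume p: "pos (r *\<^sub>R (1::'a))" and "\<not> r \<ge> 0"
  have "pos ((- r) *\<^sub>R (1::'a))" using pos_square[of "1::'a"] \<open>\<not> r \<ge> 0\<close> by (intro pos_scaleR) auto
  hence "r *\<^sub>R (1::'a) = 0" using p by (intro pos_antisym) auto
  thus False using \<open>\<not> r \<ge> 0\<close> by simp
qed

lemma pos_LIMSEQ:
  assumes p: "\<And>n. pos (f n)" and lim: "f \<longlonglongrightarrow> h" shows "pos h"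
proof -
  have "Bseq f" using lim convergentI convergent_imp_Bseq by blast
  then obtain t where "\<forall>n. norm (f n) \<le> t" unfolding Bseq_def by auto
  hence t: "norm (f n) \<le> t" for n by simp
  have "f \<longlonglongrightarrow> h\<^sup>\<star>" using tendsto_star[OF lim] by (simp add: pos_star[OF p])
  hence "h\<^sup>\<star> = h" using lim by (rule LIMSEQ_unique)
  moreover have "norm (t *\<^sub>R 1 - h) \<le> t"
  proof (rule Lim_bounded)
    show "(\<lambda>n. norm (t *\<^sub>R 1 - f n)) \<longlonglongrightarrow> norm (t *\<^sub>R 1 - h)" by (intro tendsto_intros lim)
    show "\<forall>n\<ge>0. norm (t *\<^sub>R 1 - f n) \<le> t" using near_scalar_of_pos[OF p t] by simp
  qed
  ultimately show ?thesis by (rule pos_of_near_scalar)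
qed

text \<open>
  The Jordan decomposition, with \<open>p + n\<close> the square root of \<open>h\<^sup>2\<close> and \<open>r\<close> a square root of
  that absolute value.
\<close>
lemma pos_parts:
  fixes h :: "'a::cstar_algebra"
  assumes sa: "h\<^sup>\<star> = h" and S: "cstar_subalgebra S" "h \<in> S"
  obtains p n r where "p \<in> S" "n \<in> S" "r \<in> S" "h = p - n" "p * n = 0" "n * p = 0" "p\<^sup>\<star> = p" "n\<^sup>\<star> = n" "r\<^sup>\<star> = r" "pos (p + n)"
    "p + n = r * r" "\<And>y. y * h = h * y \<Longrightarrow> y * p = p * y \<and> y * n = n * y \<and> y * r = r * y"
proof -
  have "pos (h * h)" "h * h \<in> S" using sa S by (auto simp: pos_square subalg_mult)
  then obtain a where a: "a \<in> S" "a\<^sup>\<star> = a" "a * a = h * h" "pos a" "\<And>y. y * (h * h) = h * h * y \<Longrightarrow> y * a = a * y"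
    using pos_sqrt[OF S(1)] by metis
  obtain r where r: "r \<in> S" "r\<^sup>\<star> = r" "r * r = a" "\<And>y. y * a = a * y \<Longrightarrow> y * r = r * y"
    using pos_sqrt[OF S(1) a(1,4)] by metis
  have ya: "y * a = a * y" if "y * h = h * y" for y
  proof (rule a(5))
    have "y * (h * h) = (y * h) * h" by (simp add: mult.assoc)
    also have "\<dots> = h * (y * h)" by (simp add: that mult.assoc)
    also have "\<dots> = h * h * y" by (simp add: that mult.assoc)
    finally show "y * (h * h) = h * h * y" .
  qed
  have ha: "h * a = a * h" by (rule ya) simp
  define p where "p = (1/2) *\<^sub>R (a + h)"
  define n where "n = (1/2) *\<^sub>R (a - h)"
  have "p + n = (1/2) *\<^sub>R (2 *\<^sub>R a)" "p - n = (1/2) *\<^sub>R (2 *\<^sub>R h)"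
    unfolding p_def n_def scaleR_2 by (simp_all add: algebra_simps)
  hence pn: "p + n = a" "p - n = h" by simp_all
  show thesis
  proof (rule that[of p n r])
    show "p \<in> S" "n \<in> S" "r \<in> S" using a(1) r(1) S by (auto simp: p_def n_def subalg_intros)
    show "p\<^sup>\<star> = p" "n\<^sup>\<star> = n" "r\<^sup>\<star> = r" using a(2) r(2) sa by (auto simp: p_def n_def star_simps)
    show "h = p - n" "p + n = r * r" "pos (p + n)" using pn r(3) a(4) by auto
    show "p * n = 0" "n * p = 0" by (auto simp: p_def n_def algebra_simps ha a(3))
    fix y assume "y * h = h * y"
    thus "y * p = p * y \<and> y * n = n * y \<and> y * r = r * y"
      using ya[of y] r(4)[of y] by (auto simp: p_def n_def algebra_simps)
  qed
qed

text \<open>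
  The core of the Kelley--Vaught theorem.  For \<open>c = x + \<i> y\<close> the identity
  \<open>c c\<^sup>\<star> + c\<^sup>\<star> c = 2 (x\<^sup>2 + y\<^sup>2)\<close> makes \<open>c c\<^sup>\<star>\<close> positive.  Let \<open>q\<close> be its norm, which is also the norm
  of \<open>k\<^sup>2\<close>.  Then \<open>q - c c\<^sup>\<star>\<close> has norm at most \<open>q\<close>, and compressing it by \<open>c\<close> yields
  \<open>norm (q k\<^sup>2 + k\<^sup>4) \<le> q\<^sup>2\<close>.  But \<open>q k\<^sup>2 + k\<^sup>4\<close> dominates \<open>2 k\<^sup>4\<close>, whose norm is \<open>2 q\<^sup>2\<close>.
\<close>
lemma no_negative_star_square:
  fixes c k :: "'a::cstar_algebra"
  assumes cc: "c\<^sup>\<star> * c = - (k * k)" and k: "k\<^sup>\<star> = k" shows "c = 0"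
proof -
  define q where "q = norm (k * k)"
  have q: "q = (norm c)\<^sup>2" using cstar_identity[of c] cc by (simp add: q_def)
  define x y where "x = (1/2) *\<^sub>R (c + c\<^sup>\<star>)" and "y = (1/2) *\<^sub>R (- \<i> *\<^sub>C (c - c\<^sup>\<star>))"
  have xy: "x\<^sup>\<star> = x" "y\<^sup>\<star> = y"
    by (simp_all add: x_def y_def star_simps star_scaleC scaleC_minus_left scaleC_diff_right add.commute)
  have xx: "4 *\<^sub>R (x * x) = c * c + c * c\<^sup>\<star> + c\<^sup>\<star> * c + c\<^sup>\<star> * c\<^sup>\<star>"
    by (simp add: x_def algebra_simps)
  have yy: "4 *\<^sub>R (y * y) = - (c * c) + c * c\<^sup>\<star> + c\<^sup>\<star> * c - c\<^sup>\<star> * c\<^sup>\<star>"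
    by (simp add: y_def algebra_simps scaleC_minus_left mult_scaleC_left mult_scaleC_right scaleC_scaleC
        scaleC_diff_right scaleC_scaleR)
  have "4 *\<^sub>R (x * x) + 4 *\<^sub>R (y * y) = 2 *\<^sub>R (c * c\<^sup>\<star>) + 2 *\<^sub>R (c\<^sup>\<star> * c)"
    unfolding xx yy by (simp add: scaleR_2)
  hence "c * c\<^sup>\<star> = 2 *\<^sub>R (x * x) + 2 *\<^sub>R (y * y) + k * k"
  proof -
    assume "4 *\<^sub>R (x * x) + 4 *\<^sub>R (y * y) = 2 *\<^sub>R (c * c\<^sup>\<star>) + 2 *\<^sub>R (c\<^sup>\<star> * c)"
    hence "(1/2) *\<^sub>R (2 *\<^sub>R (c * c\<^sup>\<star>)) = (1/2) *\<^sub>R (4 *\<^sub>R (x * x) + 4 *\<^sub>R (y * y) + 2 *\<^sub>R (k * k))"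
      unfolding cc by simp
    thus ?thesis by (simp add: scaleR_add_right)
  qed
  moreover have "pos (2 *\<^sub>R (x * x) + 2 *\<^sub>R (y * y) + k * k)"
    using xy k by (intro pos_add pos_scaleR pos_square) auto
  ultimately have p: "pos (c * c\<^sup>\<star>)" by simp
  have "norm (c * c\<^sup>\<star>) = q" using cstar_identity[of "c\<^sup>\<star>"] unfolding q by (simp add: star_star)
  with near_scalar_of_pos[OF p] have "norm (q *\<^sub>R 1 - c * c\<^sup>\<star>) \<le> q" by simp
  moreover define z where "z = q *\<^sub>R 1 - c * c\<^sup>\<star>"
  ultimately have nz: "norm z \<le> q" by simp
  let ?k2 = "k * k"
  have "c\<^sup>\<star> * z * c = q *\<^sub>R (c\<^sup>\<star> * c) - (c\<^sup>\<star> * c) * (c\<^sup>\<star> * c)" by (simp add: z_def algebra_simps mult.assoc)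
  also have "\<dots> = - (q *\<^sub>R ?k2 + ?k2 * ?k2)" unfolding cc by simp
  finally have "norm (q *\<^sub>R ?k2 + ?k2 * ?k2) = norm (c\<^sup>\<star> * z * c)" by (metis norm_minus_cancel)
  also have "\<dots> \<le> norm (c\<^sup>\<star>) * norm z * norm c"
    by (rule order.trans[OF norm_mult_ineq mult_right_mono[OF norm_mult_ineq norm_ge_zero]])
  also have "\<dots> \<le> norm c * q * norm c" using nz by (intro mult_mono) (auto simp: q_def)
  finally have le: "norm (q *\<^sub>R ?k2 + ?k2 * ?k2) \<le> q * q" by (simp add: q power2_eq_square mult_ac)
  have "q *\<^sub>R ?k2 + ?k2 * ?k2 - 2 *\<^sub>R (?k2 * ?k2) = k * (q *\<^sub>R 1 - ?k2) * k" by (simp add: algebra_simps mult.assoc scaleR_2)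
  moreover have "pos (k * (q *\<^sub>R 1 - ?k2) * k)"
  proof -
    have "pos (q *\<^sub>R 1 - ?k2)" using k by (intro pos_norm_minus) (auto simp: q_def star_simps)
    then obtain w where w: "w\<^sup>\<star> = w" "q *\<^sub>R 1 - ?k2 = w * w"
       "\<And>y. y * (q *\<^sub>R 1 - ?k2) = (q *\<^sub>R 1 - ?k2) * y \<Longrightarrow> y * w = w * y"
      using pos_sqrt[OF cstar_subalgebra_UNIV UNIV_I] by metis
    have kw: "k * w = w * k" by (rule w(3)) (simp add: algebra_simps mult.assoc)
    have "k * (q *\<^sub>R 1 - ?k2) * k = (k * w) * (w * k)" unfolding w by (simp add: mult.assoc)
    hence "k * (q *\<^sub>R 1 - ?k2) * k = (k * w) * (k * w)" by (simp only: kw)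
    moreover have "(k * w)\<^sup>\<star> = k * w" by (simp add: star_simps k w(1) kw)
    ultimately show ?thesis using pos_square[of "k * w"] by (simp only:)
  qed
  moreover have "pos (2 *\<^sub>R (?k2 * ?k2))" using k by (intro pos_scaleR pos_square) (auto simp: star_simps)
  ultimately have "norm (2 *\<^sub>R (?k2 * ?k2)) \<le> norm (q *\<^sub>R ?k2 + ?k2 * ?k2)" by (intro norm_mono_pos) auto
  moreover have "norm (?k2 * ?k2) = q * q" using cstar_identity[of ?k2] k by (simp add: q_def star_simps power2_eq_square)
  ultimately have "2 * (q * q) \<le> q * q" using le by simp
  hence "q * q \<le> 0" by linarith
  hence "q = 0" by (metis mult_eq_0_iff order.antisym zero_le_square)
  thus "c = 0" using q by simp
qed

text \<open>
  Cutting \<open>b\<close> down by the negative part \<open>n\<close> of \<open>b\<^sup>\<star> b\<close> gives an element \<open>c = b n\<close> with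
  \<open>c\<^sup>\<star> c = - n\<^sup>3\<close>, a negative square; hence \<open>n = 0\<close>.
\<close>
theorem pos_star_mult_self: "pos ((b::'a::cstar_algebra)\<^sup>\<star> * b)"
proof -
  define h where "h = b\<^sup>\<star> * b"
  have sa: "h\<^sup>\<star> = h" by (simp add: h_def star_simps)
  obtain p n r where P: "h = p - n" "p * n = 0" "n * p = 0" "p\<^sup>\<star> = p" "n\<^sup>\<star> = n" "r\<^sup>\<star> = r" "pos (p + n)"
    "p + n = r * r" and comm: "\<And>y. y * h = h * y \<Longrightarrow> y * p = p * y \<and> y * n = n * y \<and> y * r = r * y"
    using pos_parts[OF sa cstar_subalgebra_UNIV UNIV_I] by metis
  have "r * h = h * r" using comm[of h] by simp
  hence nr: "r * n = n * r" using comm[of r] by simp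
  define c where "c = b * n"
  have cc: "c\<^sup>\<star> * c = n * h * n" using P(5) by (simp add: c_def h_def star_simps mult.assoc)
  also have nhn: "n * h * n = - (n * n * n)" unfolding P(1) by (simp add: algebra_simps P(2,3))
  also have "n * n * n = n * (p + n) * n" by (simp add: algebra_simps P(2,3))
  also have "\<dots> = (n * r) * (r * n)" unfolding P(8) by (simp add: mult.assoc)
  also have "\<dots> = (n * r) * (n * r)" by (simp only: nr)
  finally have "c\<^sup>\<star> * c = - ((n * r) * (n * r))" .
  moreover have "(n * r)\<^sup>\<star> = n * r" using P(5,6) nr by (simp add: star_simps)
  ultimately have "c = 0" by (rule no_negative_star_square)
  hence "n * h * n = 0" using cc by simp
  hence nnn: "n * n * n = 0" using nhn by simp
  have "(n * n)\<^sup>\<star> * (n * n) = n * n * n * n" by (simp add: P(5) star_simps mult.assoc)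
  hence "(n * n)\<^sup>\<star> * (n * n) = 0" using nnn by simp
  hence "n * n = 0" by (rule star_mult_self_eq_0)
  hence "n = 0" using P(5) star_mult_self_eq_0[of n] by simp
  thus ?thesis using P(1,7) by (simp flip: h_def)
qed

lemma pos_conj: "pos h \<Longrightarrow> pos (y\<^sup>\<star> * h * y)"
proof -
  assume "pos h"
  then obtain w where "w\<^sup>\<star> = w" "h = w * w" by (auto simp: pos_def)
  hence "y\<^sup>\<star> * h * y = (w * y)\<^sup>\<star> * (w * y)" by (simp add: star_simps mult.assoc)
  thus ?thesis using pos_star_mult_self[of "w * y"] by simp
qed

lemma pos_normsq_minus: "pos ((norm x)\<^sup>2 *\<^sub>R 1 - x\<^sup>\<star> * x)"
  by (rule pos_norm_minus) (auto simp: star_simps cstar_identity)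

section \<open>The centre of a simple C*-algebra\<close>

text \<open>
  The annihilator of the central negative part of \<open>x\<close> is a closed ideal that contains the positive
  part; by simplicity one of the two parts vanishes.
\<close>
lemma simple_centre_comparable:
  assumes S: "simple_cstar S" and x: "x \<in> rel_commutant S S" and sa: "x\<^sup>\<star> = x"
  shows "pos x \<or> pos (- x)"
proof -
  have sub: "cstar_subalgebra S" using S by (simp add: simple_cstar_def)
  obtain p n where P: "p \<in> S" "n \<in> S" "x = p - n" "n * p = 0" "pos (p + n)"
     and comm: "\<And>y. y * x = x * y \<Longrightarrow> y * p = p * y \<and> y * n = n * y"
    using pos_parts[OF sa sub rel_commutant_mem[OF x]] by metis
  have cn: "y * n = n * y" if "y \<in> S" for y using comm[of y] rel_commutant_comm[OF x that] by simp
  define I where "I = {y \<in> S. n * y = 0}"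
  have "closed_ideal S I" unfolding closed_ideal_def
  proof (intro conjI ballI allI)
    have "I = S \<inter> {y. n * y = 0}" by (auto simp: I_def)
    thus "closed I" using subalg_closed[OF sub]
      by (auto intro!: closed_Int closed_Collect_eq continuous_intros)
    show "I \<subseteq> S" "0 \<in> I" using subalg_zero[OF sub] by (auto simp: I_def)
    fix y assume y: "y \<in> I"
    show "c *\<^sub>C y \<in> I" for c using y sub by (auto simp: I_def subalg_intros mult_scaleC_right)
    show "y + z \<in> I" if "z \<in> I" for z using that y sub by (auto simp: I_def subalg_intros algebra_simps)
    fix s assume s: "s \<in> S"
    have "n * (s * y) = s * (n * y)" using cn[OF s] by (metis mult.assoc)
    thus "s * y \<in> I" using s y sub by (auto simp: I_def subalg_intros)
    have "n * (y * s) = n * y * s" by (simp add: mult.assoc)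
    thus "y * s \<in> I" using s y sub by (auto simp: I_def subalg_intros)
  qed
  hence "I = {0} \<or> I = S" using S by (simp add: simple_cstar_def)
  moreover have "p \<in> I" using P by (simp add: I_def)
  moreover have "1 \<in> S" using subalg_one[OF sub] .
  ultimately have "p = 0 \<or> 1 \<in> I" by blast
  hence "p = 0 \<or> n * 1 = 0" by (auto simp: I_def)
  thus ?thesis using P by auto
qed

text \<open>
  A self-adjoint central element is comparable with every real scalar, and the cut that it
  defines in the reals determines a scalar equal to it.
\<close>
lemma simple_centre_scalar:
  assumes S: "simple_cstar S" and x: "x \<in> rel_commutant S S" and sa: "x\<^sup>\<star> = x"
  obtains t :: real where "x = t *\<^sub>R 1"
proof -
  have sub: "cstar_subalgebra S" using S by (simp add: simple_cstar_def)
  define T where "T = {t::real. pos (x - t *\<^sub>R 1)}"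
  have cmp: "pos (x - t *\<^sub>R 1) \<or> pos (t *\<^sub>R 1 - x)" for t
  proof -
    have "x - t *\<^sub>R 1 \<in> rel_commutant S S"
      using x sub by (auto simp: rel_commutant_def subalg_intros algebra_simps)
    from simple_centre_comparable[OF S this] show ?thesis by (simp add: sa star_simps)
  qed
  have bd: "t \<le> norm x" if "t \<in> T" for t
  proof (rule ccontr)
    assume "\<not> t \<le> norm x"
    have "pos ((x - t *\<^sub>R 1) + (norm x *\<^sub>R 1 - x))"
      using that sa by (intro pos_add pos_norm_minus) (auto simp: T_def)
    hence "pos (- ((t - norm x) *\<^sub>R (1::'a)))" by (simp add: algebra_simps)
    moreover have "pos ((t - norm x) *\<^sub>R (1::'a))"
      using \<open>\<not> t \<le> norm x\<close> pos_square[of "1::'a"] by (intro pos_scaleR) auto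
    ultimately have "(t - norm x) *\<^sub>R (1::'a) = 0" using pos_antisym by blast
    thus False using \<open>\<not> t \<le> norm x\<close> by simp
  qed
  have ne: "- norm x \<in> T" using pos_norm_minus[of "-x" "norm x"] sa by (simp add: T_def add.commute)
  have bdd: "bdd_above T" using bd by (auto simp: bdd_above_def)
  define s where "s = Sup T"
  have "\<exists>t\<in>T. s - 1 / real (Suc n) < t" for n
  proof (subst less_cSup_iff[OF _ bdd, symmetric])
    show "T \<noteq> {}" using ne by blast
    show "s - 1 / real (Suc n) < Sup T" by (simp add: s_def)
  qed
  then obtain f where "\<forall>n. f n \<in> T \<and> s - 1 / real (Suc n) < f n" by metis
  hence f: "f n \<in> T" "s - 1 / real (Suc n) < f n" for n by blast+
  have lim0: "(\<lambda>n. 1 / real (Suc n)) \<longlonglongrightarrow> 0" using LIMSEQ_inverse_real_of_nat by (simp add: inverse_eq_divide)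
  have "f \<longlonglongrightarrow> s"
  proof (rule tendsto_sandwich)
    show "(\<lambda>n. s - 1 / real (Suc n)) \<longlonglongrightarrow> s" using tendsto_diff[OF tendsto_const lim0] by simp
    show "\<forall>\<^sub>F n in sequentially. s - 1 / real (Suc n) \<le> f n" using f by (auto intro!: always_eventually less_imp_le)
    show "\<forall>\<^sub>F n in sequentially. f n \<le> s" using cSup_upper[OF f(1) bdd] by (auto simp: s_def)
  qed auto
  hence "(\<lambda>n. x - f n *\<^sub>R 1) \<longlonglongrightarrow> x - s *\<^sub>R 1" by (intro tendsto_intros)
  moreover have "pos (x - f n *\<^sub>R 1)" for n using f(1)[of n] by (simp add: T_def)
  ultimately have p1: "pos (x - s *\<^sub>R 1)" by (rule pos_LIMSEQ[rotated])
  have "(\<lambda>n. (s + 1 / real (Suc n)) *\<^sub>R 1 - x) \<longlonglongrightarrow> (s + 0) *\<^sub>R 1 - x" by (intro tendsto_intros lim0)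
  moreover have "pos ((s + 1 / real (Suc n)) *\<^sub>R 1 - x)" for n
  proof -
    have "s + 1 / real (Suc n) \<notin> T"
    proof
      assume "s + 1 / real (Suc n) \<in> T"
      hence "s + 1 / real (Suc n) \<le> s" unfolding s_def by (rule cSup_upper) (rule bdd)
      thus False by (simp add: field_simps)
    qed
    thus ?thesis using cmp by (auto simp: T_def)
  qed
  ultimately have "pos ((s + 0) *\<^sub>R 1 - x)" by (rule pos_LIMSEQ[rotated])
  hence "pos (- (x - s *\<^sub>R 1))" by simp
  hence "x - s *\<^sub>R 1 = 0" using p1 pos_antisym by blast
  thus thesis using that[of s] by simp
qed

section \<open>Conditional expectations and quasi-bases\<close>

text \<open>
  A conditional expectation with positivity in the form \<open>pos\<close>.  Contractivity is a consequence of
  the Schwarz inequality (\<open>E_norm\<close>), so \<open>cond_exp\<close> can be verified through these algebraic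
  conditions.
\<close>
locale expectation =
  fixes A B :: "'a::cstar_algebra set" and E :: "'a \<Rightarrow> 'a"
  assumes A: "cstar_subalgebra A" and B: "cstar_subalgebra B" and BA: "B \<subseteq> A"
    and E_in: "x \<in> A \<Longrightarrow> E x \<in> B"
    and E_fix: "b \<in> B \<Longrightarrow> E b = b"
    and E_add: "x \<in> A \<Longrightarrow> y \<in> A \<Longrightarrow> E (x + y) = E x + E y"
    and E_scaleC: "x \<in> A \<Longrightarrow> E (z *\<^sub>C x) = z *\<^sub>C E x"
    and E_pos: "x \<in> A \<Longrightarrow> pos (E (x\<^sup>\<star> * x))"
    and E_bimod: "a \<in> B \<Longrightarrow> b \<in> B \<Longrightarrow> x \<in> A \<Longrightarrow> E (a * x * b) = a * E x * b"
begin

lemma B_in_A: "b \<in> B \<Longrightarrow> b \<in> A" using BA by blast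

lemma E_in_A: "x \<in> A \<Longrightarrow> E x \<in> A" by (rule B_in_A[OF E_in])

lemmas A_intros = subalg_intros[OF A]
lemmas B_intros = subalg_intros[OF B]

lemma E_one: "E 1 = 1" by (intro E_fix B_intros)

lemma E_zero: "E 0 = 0" by (intro E_fix B_intros)

lemma E_scaleR: "x \<in> A \<Longrightarrow> E (r *\<^sub>R x) = r *\<^sub>R E x" by (simp add: scaleR_scaleC E_scaleC)

lemma E_minus: "x \<in> A \<Longrightarrow> E (- x) = - E x" using E_scaleR[of x "-1"] by simp

lemma E_diff: "x \<in> A \<Longrightarrow> y \<in> A \<Longrightarrow> E (x - y) = E x - E y"
  using E_add[of x "-y"] E_minus[of y] A_intros by simp

lemma E_sum: "(\<And>i. i \<in> J \<Longrightarrow> f i \<in> A) \<Longrightarrow> E (\<Sum>i\<in>J. f i) = (\<Sum>i\<in>J. E (f i))"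
  by (induction J rule: infinite_finite_induct) (auto simp: E_add E_zero A_intros)

lemma E_left: "a \<in> B \<Longrightarrow> x \<in> A \<Longrightarrow> E (a * x) = a * E x"
  using E_bimod[of a 1 x] B_intros(1) by simp

lemma E_right: "b \<in> B \<Longrightarrow> x \<in> A \<Longrightarrow> E (x * b) = E x * b"
  using E_bimod[of 1 b x] B_intros(1) by simp

text \<open>
  Positive elements have self-adjoint images; apply this to \<open>(1 + y)\<^sup>\<star> (1 + y)\<close> for \<open>y = x\<close> and
  \<open>y = \<i> x\<close>.
\<close>
lemma E_star:
  assumes x: "x \<in> A" shows "E (x\<^sup>\<star>) = (E x)\<^sup>\<star>"
proof -
  have *: "E y + E (y\<^sup>\<star>) = (E y)\<^sup>\<star> + (E (y\<^sup>\<star>))\<^sup>\<star>" if y: "y \<in> A" for y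
  proof -
    have "E ((1 + y)\<^sup>\<star> * (1 + y)) = E (1 + (y + y\<^sup>\<star>) + y\<^sup>\<star> * y)" by (simp add: star_simps algebra_simps)
    also have "\<dots> = 1 + (E y + E (y\<^sup>\<star>)) + E (y\<^sup>\<star> * y)" using y by (simp add: E_add A_intros E_one)
    finally have "E y + E (y\<^sup>\<star>) = E ((1 + y)\<^sup>\<star> * (1 + y)) - 1 - E (y\<^sup>\<star> * y)" by simp
    moreover have "(E ((1 + y)\<^sup>\<star> * (1 + y)) - 1 - E (y\<^sup>\<star> * y))\<^sup>\<star> = E ((1 + y)\<^sup>\<star> * (1 + y)) - 1 - E (y\<^sup>\<star> * y)"
      using pos_star[OF E_pos[of y]] pos_star[OF E_pos[of "1 + y"]] y
      by (simp only: star_diff star_one A_intros)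
    ultimately show ?thesis by (metis star_add)
  qed
  have ix: "\<i> *\<^sub>C x \<in> A" using x by (intro A_intros)
  have "E (\<i> *\<^sub>C x) + E ((\<i> *\<^sub>C x)\<^sup>\<star>) = \<i> *\<^sub>C (E x - E (x\<^sup>\<star>))"
    using x by (simp add: star_scaleC E_scaleC E_minus A_intros scaleC_diff_right scaleC_minus_left)
  moreover have "(E (\<i> *\<^sub>C x))\<^sup>\<star> + (E ((\<i> *\<^sub>C x)\<^sup>\<star>))\<^sup>\<star> = \<i> *\<^sub>C ((E (x\<^sup>\<star>))\<^sup>\<star> - (E x)\<^sup>\<star>)"
    using x by (simp add: star_scaleC E_scaleC E_minus A_intros scaleC_diff_right scaleC_minus_left)
  ultimately have "\<i> *\<^sub>C \<i> *\<^sub>C (E x - E (x\<^sup>\<star>)) = \<i> *\<^sub>C \<i> *\<^sub>C ((E (x\<^sup>\<star>))\<^sup>\<star> - (E x)\<^sup>\<star>)"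
    using *[OF ix] by simp
  hence "- (E x - E (x\<^sup>\<star>)) = - ((E (x\<^sup>\<star>))\<^sup>\<star> - (E x)\<^sup>\<star>)"
    by (simp add: scaleC_scaleC scaleC_minus_left)
  hence "E x - E (x\<^sup>\<star>) = (E (x\<^sup>\<star>))\<^sup>\<star> - (E x)\<^sup>\<star>" by (simp only: neg_equal_iff_equal)
  hence "(E x + E (x\<^sup>\<star>)) - (E x - E (x\<^sup>\<star>)) = ((E x)\<^sup>\<star> + (E (x\<^sup>\<star>))\<^sup>\<star>) - ((E (x\<^sup>\<star>))\<^sup>\<star> - (E x)\<^sup>\<star>)"
    using *[OF x] by (simp only:)
  hence "2 *\<^sub>R E (x\<^sup>\<star>) = 2 *\<^sub>R (E x)\<^sup>\<star>" by (simp add: scaleR_2)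
  thus ?thesis by simp
qed

lemma E_pos_of_pos: "h \<in> A \<Longrightarrow> pos h \<Longrightarrow> pos (E h)"
proof -
  assume "h \<in> A" "pos h"
  then obtain w where "w \<in> A" "w\<^sup>\<star> = w" "w * w = h" using pos_sqrt[OF A] by metis
  thus ?thesis using E_pos[of w] by simp
qed

text \<open>
  Positivity of \<open>E\<close> on \<open>(x - E x)\<^sup>\<star> (x - E x)\<close>.
\<close>
lemma E_schwarz:
  assumes x: "x \<in> A" shows "pos (E (x\<^sup>\<star> * x) - (E x)\<^sup>\<star> * E x)"
proof -
  let ?b = "E x"
  have b: "?b \<in> B" "?b \<in> A" using x by (auto simp: E_in E_in_A)
  have "(x - ?b)\<^sup>\<star> * (x - ?b) = x\<^sup>\<star> * x - x\<^sup>\<star> * ?b - ?b\<^sup>\<star> * x + ?b\<^sup>\<star> * ?b"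
    by (simp add: star_simps algebra_simps)
  also have "E \<dots> = E (x\<^sup>\<star> * x) - E (x\<^sup>\<star> * ?b) - E (?b\<^sup>\<star> * x) + E (?b\<^sup>\<star> * ?b)"
    using x b by (simp add: E_add E_diff A_intros)
  also have "E (x\<^sup>\<star> * ?b) = ?b\<^sup>\<star> * ?b" using x b by (simp add: E_right E_star A_intros)
  also have "E (?b\<^sup>\<star> * x) = ?b\<^sup>\<star> * ?b" using x b by (simp add: E_left B_intros)
  also have "E (?b\<^sup>\<star> * ?b) = ?b\<^sup>\<star> * ?b" using b by (intro E_fix B_intros)
  finally have "E ((x - ?b)\<^sup>\<star> * (x - ?b)) = E (x\<^sup>\<star> * x) - ?b\<^sup>\<star> * ?b" by simp
  thus ?thesis using E_pos[of "x - ?b"] x b by (simp add: A_intros)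
qed

lemma E_norm:
  assumes x: "x \<in> A" shows "norm (E x) \<le> norm x"
proof -
  have "norm ((E x)\<^sup>\<star> * E x) \<le> norm (E (x\<^sup>\<star> * x))"
    by (intro norm_mono_pos pos_star_mult_self E_schwarz x)
  also have "\<dots> \<le> norm (((norm x)\<^sup>2) *\<^sub>R (1::'a))"
  proof (rule norm_mono_pos)
    show "pos (E (x\<^sup>\<star> * x))" by (rule E_pos[OF x])
    have "pos (E ((norm x)\<^sup>2 *\<^sub>R 1 - x\<^sup>\<star> * x))" using x by (intro E_pos_of_pos pos_normsq_minus A_intros)
    thus "pos ((norm x)\<^sup>2 *\<^sub>R 1 - E (x\<^sup>\<star> * x))" using x by (simp add: E_diff A_intros E_scaleR E_one)
  qed
  finally have "(norm (E x))\<^sup>2 \<le> (norm x)\<^sup>2" by (simp add: cstar_identity)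
  thus ?thesis by (simp add: power2_le_iff_abs_le)
qed

lemma cond_exp: "cond_exp A B E"
proof -
  have "\<exists>b\<in>B. E (x\<^sup>\<star> * x) = b\<^sup>\<star> * b" if "x \<in> A" for x
  proof -
    have "x\<^sup>\<star> * x \<in> A" using that by (intro A_intros)
    note p = pos_sqrt[OF B E_in[OF this] E_pos[OF that]]
    obtain w where "w \<in> B" "w\<^sup>\<star> = w" "w * w = E (x\<^sup>\<star> * x)"
      by (rule p)
    thus ?thesis by (intro bexI[of _ w]) auto
  qed
  thus ?thesis unfolding cond_exp_def by (auto simp: E_in E_fix E_add E_scaleC E_norm E_bimod)
qed

end

lemma expectation_of_cond_exp:
  assumes "cstar_subalgebra A" "cstar_subalgebra B" "B \<subseteq> A" "cond_exp A B E"
  shows "expectation A B E"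
proof
  fix x assume "x \<in> A"
  then obtain b where "E (x\<^sup>\<star> * x) = b\<^sup>\<star> * b" using assms(4) unfolding cond_exp_def by blast
  thus "pos (E (x\<^sup>\<star> * x))" by (simp add: pos_star_mult_self)
qed (use assms in \<open>auto simp: cond_exp_def\<close>)

text \<open>
  A quasi-basis over an arbitrary finite index set, so that products of quasi-bases need no
  renumbering.  One of the two reconstruction formulas is required; \<open>frame'\<close> is its adjoint.
\<close>
locale framed = expectation A B E for A B :: "'a::cstar_algebra set" and E +
  fixes I :: "'i set" and l :: "'i \<Rightarrow> 'a"
  assumes fin: "finite I" and l_in: "i \<in> I \<Longrightarrow> l i \<in> A"
    and frame: "x \<in> A \<Longrightarrow> (\<Sum>i\<in>I. l i * E ((l i)\<^sup>\<star> * x)) = x"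
begin

lemma frame': "x \<in> A \<Longrightarrow> (\<Sum>i\<in>I. E (x * l i) * (l i)\<^sup>\<star>) = x"
proof -
  assume x: "x \<in> A"
  have "(\<Sum>i\<in>I. l i * E ((l i)\<^sup>\<star> * x\<^sup>\<star>))\<^sup>\<star> = x" using x frame[of "x\<^sup>\<star>"] by (simp add: A_intros star_star)
  moreover have "(l i * E ((l i)\<^sup>\<star> * x\<^sup>\<star>))\<^sup>\<star> = E (x * l i) * (l i)\<^sup>\<star>" if "i \<in> I" for i
    using x that E_star[of "x * l i"] l_in[OF that] by (simp add: A_intros star_simps)
  ultimately show ?thesis by (simp add: star_sum)
qed

lemma nondegenerate: "x \<in> A \<Longrightarrow> (\<And>y. y \<in> A \<Longrightarrow> E (y * x) = 0) \<Longrightarrow> x = 0"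
  using frame[of x] l_in by (simp add: A_intros)

lemma nondegenerate_eq:
  assumes "x \<in> A" "y \<in> A" "\<And>z. z \<in> A \<Longrightarrow> E (z * x) = E (z * y)" shows "x = y"
proof -
  have "x - y = 0"
    by (rule nondegenerate) (use assms in \<open>auto simp: A_intros right_diff_distrib E_diff\<close>)
  thus ?thesis by simp
qed

text \<open>
  By the Schwarz inequality \<open>E (y x)\<close> is controlled by \<open>E (x\<^sup>\<star> y\<^sup>\<star> y x)\<close>, which is at most a multiple
  of \<open>E (x\<^sup>\<star> x) = 0\<close>, and \<open>x\<close> is reconstructed from such values.
\<close>
lemma faithful:
  assumes x: "x \<in> A" and 0: "E (x\<^sup>\<star> * x) = 0" shows "x = 0"
proof (rule nondegenerate[OF x])
  fix y assume y: "y \<in> A"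
  have "norm ((E (y * x))\<^sup>\<star> * E (y * x)) \<le> norm (E ((y * x)\<^sup>\<star> * (y * x)))"
    by (intro norm_mono_pos pos_star_mult_self E_schwarz A_intros x y)
  also have "\<dots> \<le> norm (((norm y)\<^sup>2) *\<^sub>R E (x\<^sup>\<star> * x))"
  proof (rule norm_mono_pos)
    show "pos (E ((y * x)\<^sup>\<star> * (y * x)))" by (intro E_pos A_intros x y)
    have "pos (E (x\<^sup>\<star> * ((norm y)\<^sup>2 *\<^sub>R 1 - y\<^sup>\<star> * y) * x))"
      by (intro E_pos_of_pos pos_conj pos_normsq_minus A_intros x y)
    also have "x\<^sup>\<star> * ((norm y)\<^sup>2 *\<^sub>R 1 - y\<^sup>\<star> * y) * x = (norm y)\<^sup>2 *\<^sub>R (x\<^sup>\<star> * x) - (y * x)\<^sup>\<star> * (y * x)"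
      by (simp add: algebra_simps star_simps)
    also have "E \<dots> = (norm y)\<^sup>2 *\<^sub>R E (x\<^sup>\<star> * x) - E ((y * x)\<^sup>\<star> * (y * x))"
      using x y by (simp add: E_diff E_scaleR A_intros)
    finally show "pos ((norm y)\<^sup>2 *\<^sub>R E (x\<^sup>\<star> * x) - E ((y * x)\<^sup>\<star> * (y * x)))" .
  qed
  finally have "norm ((E (y * x))\<^sup>\<star> * E (y * x)) \<le> 0" using 0 by simp
  hence "(E (y * x))\<^sup>\<star> * E (y * x) = 0" by simp
  thus "E (y * x) = 0" by (rule star_mult_self_eq_0)
qed

definition Phi :: "'a \<Rightarrow> 'a" where "Phi x = (\<Sum>i\<in>I. l i * x * (l i)\<^sup>\<star>)"

text \<open>
  Expand \<open>y l\<^sub>i\<close> in the quasi-basis, move the coefficients in \<open>B\<close> past \<open>x\<close>, and contract the other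
  way.  The element \<open>x\<close> may lie in any larger algebra.
\<close>
lemma Phi_comm:
  assumes x: "\<And>b. b \<in> B \<Longrightarrow> b * x = x * b" and y: "y \<in> A"
  shows "y * Phi x = Phi x * y"
proof -
  have "y * Phi x = (\<Sum>i\<in>I. y * l i * x * (l i)\<^sup>\<star>)" by (simp add: Phi_def sum_distrib_left mult.assoc)
  also have "\<dots> = (\<Sum>i\<in>I. (\<Sum>j\<in>I. l j * E ((l j)\<^sup>\<star> * (y * l i))) * x * (l i)\<^sup>\<star>)"
    using y by (intro sum.cong refl) (simp add: frame l_in A_intros)
  also have "\<dots> = (\<Sum>i\<in>I. \<Sum>j\<in>I. l j * x * (E ((l j)\<^sup>\<star> * y * l i) * (l i)\<^sup>\<star>))"
  proof (intro sum.cong refl)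
    fix i assume i: "i \<in> I"
    show "(\<Sum>j\<in>I. l j * E ((l j)\<^sup>\<star> * (y * l i))) * x * (l i)\<^sup>\<star> = (\<Sum>j\<in>I. l j * x * (E ((l j)\<^sup>\<star> * y * l i) * (l i)\<^sup>\<star>))"
      unfolding sum_distrib_right
    proof (intro sum.cong refl)
      fix j assume j: "j \<in> I"
      have "E ((l j)\<^sup>\<star> * (y * l i)) * x = x * E ((l j)\<^sup>\<star> * (y * l i))"
        using i j y by (intro x E_in A_intros l_in)
      thus "l j * E ((l j)\<^sup>\<star> * (y * l i)) * x * (l i)\<^sup>\<star> = l j * x * (E ((l j)\<^sup>\<star> * y * l i) * (l i)\<^sup>\<star>)"
        by (metis mult.assoc)
    qed
  qed
  also have "\<dots> = (\<Sum>j\<in>I. l j * x * (\<Sum>i\<in>I. E ((l j)\<^sup>\<star> * y * l i) * (l i)\<^sup>\<star>))"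
    by (subst sum.swap) (simp add: sum_distrib_left)
  also have "\<dots> = (\<Sum>j\<in>I. l j * x * ((l j)\<^sup>\<star> * y))"
    using y by (intro sum.cong refl) (simp add: frame' l_in A_intros)
  also have "\<dots> = Phi x * y" by (simp add: Phi_def sum_distrib_right mult.assoc)
  finally show ?thesis .
qed

lemma Phi_in:
  assumes C: "cstar_subalgebra C" "A \<subseteq> C" and x: "x \<in> rel_commutant B C"
  shows "Phi x \<in> rel_commutant A C"
proof (rule rel_commutantI)
  show "Phi x \<in> C" unfolding Phi_def using assms l_in
    by (intro subalg_sum subalg_mult[OF C(1)] subalg_star[OF C(1)] rel_commutant_mem[OF x]) auto
qed (use Phi_comm rel_commutant_comm[OF x] in auto)

lemma Phi_add: "Phi (x + y) = Phi x + Phi y"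
  by (simp add: Phi_def algebra_simps sum.distrib)

lemma Phi_scaleC: "Phi (z *\<^sub>C x) = z *\<^sub>C Phi x"
  by (simp add: Phi_def scaleC_sum mult_scaleC_left mult_scaleC_right)

lemma Phi_scaleR: "Phi (z *\<^sub>R x) = z *\<^sub>R Phi x"
  by (simp add: scaleR_scaleC Phi_scaleC)

lemma Phi_star: "Phi (x\<^sup>\<star>) = (Phi x)\<^sup>\<star>"
  by (simp add: Phi_def star_simps mult.assoc)

lemma Phi_pos: "pos (Phi (x\<^sup>\<star> * x))"
proof -
  have "Phi (x\<^sup>\<star> * x) = (\<Sum>i\<in>I. (x * (l i)\<^sup>\<star>)\<^sup>\<star> * (x * (l i)\<^sup>\<star>))" by (simp add: Phi_def star_simps mult.assoc)
  thus ?thesis by (simp only: pos_sum pos_star_mult_self)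
qed

end

section \<open>The Markov condition and traciality\<close>

text \<open>
  The first-order condition for a minimal index: \<open>Phi\<close> is proportional to \<open>E\<close> on the relative
  commutant.
\<close>
locale markov = framed A B E I l for A B :: "'a::cstar_algebra set" and E and I :: "'i set" and l +
  fixes c :: real
  assumes c_pos: "c > 0"
    and index: "Phi 1 = c *\<^sub>R 1"
    and Phi_eq: "x \<in> rel_commutant B A \<Longrightarrow> Phi x = c *\<^sub>R E x"
begin

text \<open>
  Let \<open>\<theta>\<close> be the modular automorphism, \<open>E (v z) = E (z (\<theta> v))\<close>.  The map \<open>Phi\<close> satisfies the same
  relation with the opposite direction, \<open>Phi ((\<theta> v) y) = Phi (y v)\<close>.  As \<open>Phi\<close> and \<open>E\<close> are proportional,
  \<open>\<theta>\<close> is an involution.  On its eigenvectors \<open>w\<close> for the value \<open>-1\<close> the positive elements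
  \<open>E (w w\<^sup>\<star>)\<close> and \<open>E (w\<^sup>\<star> w)\<close> are opposite, so there are none.
\<close>
lemma tracial:
  assumes x: "x \<in> rel_commutant B A" and z: "z \<in> A"
  shows "E (x * z) = E (z * x)"
proof -
  define \<theta> where "\<theta> v = (\<Sum>i\<in>I. l i * E (v * (l i)\<^sup>\<star>))" for v
  have \<theta>A: "\<theta> v \<in> A" if "v \<in> A" for v
    unfolding \<theta>_def using that by (intro A_intros l_in E_in_A)
  have mod: "E (v * z) = E (z * \<theta> v)" if v: "v \<in> rel_commutant B A" and z: "z \<in> A" for v z
  proof -
    have vA: "v \<in> A" using rel_commutant_mem[OF v] .
    have "v * z = (\<Sum>i\<in>I. E (z * l i) * (v * (l i)\<^sup>\<star>))"
    proof -
      have "v * z = (\<Sum>i\<in>I. v * (E (z * l i) * (l i)\<^sup>\<star>))" using frame'[OF z] by (simp flip: sum_distrib_left)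
      also have "\<dots> = (\<Sum>i\<in>I. E (z * l i) * (v * (l i)\<^sup>\<star>))"
      proof (intro sum.cong refl)
        fix i assume "i \<in> I"
        hence "E (z * l i) * v = v * E (z * l i)" using z by (intro rel_commutant_comm[OF v] E_in A_intros l_in)
        thus "v * (E (z * l i) * (l i)\<^sup>\<star>) = E (z * l i) * (v * (l i)\<^sup>\<star>)" by (metis mult.assoc)
      qed
      finally show ?thesis .
    qed
    hence "E (v * z) = (\<Sum>i\<in>I. E (E (z * l i) * (v * (l i)\<^sup>\<star>)))"
      using z vA by (simp add: E_sum A_intros E_in_A l_in)
    also have "\<dots> = (\<Sum>i\<in>I. E (z * l i) * E (v * (l i)\<^sup>\<star>))"
      using z vA by (intro sum.cong refl E_left E_in A_intros l_in)
    also have "\<dots> = (\<Sum>i\<in>I. E (z * l i * E (v * (l i)\<^sup>\<star>)))"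
      using z vA by (intro sum.cong refl E_right[symmetric] E_in A_intros l_in)
    also have "\<dots> = E (\<Sum>i\<in>I. z * l i * E (v * (l i)\<^sup>\<star>))"
      using z vA by (intro E_sum[symmetric] E_in_A A_intros l_in)
    also have "(\<Sum>i\<in>I. z * l i * E (v * (l i)\<^sup>\<star>)) = z * \<theta> v" by (simp add: \<theta>_def sum_distrib_left mult.assoc)
    finally show ?thesis .
  qed
  have \<theta>C: "\<theta> v \<in> rel_commutant B A" if v: "v \<in> rel_commutant B A" for v
  proof (rule rel_commutantI)
    have vA: "v \<in> A" using rel_commutant_mem[OF v] .
    show "\<theta> v \<in> A" by (rule \<theta>A[OF vA])
    fix b assume b: "b \<in> B"
    show "b * \<theta> v = \<theta> v * b"
    proof (rule nondegenerate_eq)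
      show "b * \<theta> v \<in> A" "\<theta> v * b \<in> A" using \<theta>A[OF vA] B_in_A[OF b] by (simp_all add: A_intros)
      fix y assume y: "y \<in> A"
      have "E (y * (b * \<theta> v)) = E (v * (y * b))" using mod[OF v, of "y * b"] y b by (simp add: mult.assoc A_intros B_in_A)
      also have "\<dots> = E (v * y) * b" using y vA b E_right[of b "v * y"] by (simp add: mult.assoc A_intros)
      also have "\<dots> = E (y * \<theta> v) * b" using mod[OF v y] by simp
      also have "\<dots> = E (y * (\<theta> v * b))" using y vA b E_right[of b "y * \<theta> v"] by (simp add: mult.assoc A_intros \<theta>A)
      finally show "E (y * (b * \<theta> v)) = E (y * (\<theta> v * b))" .
    qed
  qed
  have RC: "cstar_subalgebra (rel_commutant B A)"
    by (intro cstar_subalgebra_rel_commutant A B_intros)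
  have PhiT: "Phi (\<theta> v * y) = Phi (y * v)"
    if v: "v \<in> rel_commutant B A" and y: "y \<in> rel_commutant B A" for v y
  proof -
    have vA: "v \<in> A" "y \<in> A" using rel_commutant_mem v y by auto
    have "Phi (\<theta> v * y) = (\<Sum>i\<in>I. (\<Sum>j\<in>I. l j * E ((l j)\<^sup>\<star> * (l i * \<theta> v))) * y * (l i)\<^sup>\<star>)"
      unfolding Phi_def using vA by (intro sum.cong refl) (simp add: frame l_in A_intros \<theta>A mult.assoc)
    also have "\<dots> = (\<Sum>i\<in>I. \<Sum>j\<in>I. l j * y * (E (v * (l j)\<^sup>\<star> * l i) * (l i)\<^sup>\<star>))"
    proof (intro sum.cong refl)
      fix i assume i: "i \<in> I"
      show "(\<Sum>j\<in>I. l j * E ((l j)\<^sup>\<star> * (l i * \<theta> v))) * y * (l i)\<^sup>\<star> = (\<Sum>j\<in>I. l j * y * (E (v * (l j)\<^sup>\<star> * l i) * (l i)\<^sup>\<star>))"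
        unfolding sum_distrib_right
      proof (intro sum.cong refl)
        fix j assume j: "j \<in> I"
        have 1: "E ((l j)\<^sup>\<star> * (l i * \<theta> v)) = E (v * (l j)\<^sup>\<star> * l i)"
          using mod[OF v, of "(l j)\<^sup>\<star> * l i"] i j by (simp add: mult.assoc A_intros l_in)
        have "E ((l j)\<^sup>\<star> * (l i * \<theta> v)) * y = y * E ((l j)\<^sup>\<star> * (l i * \<theta> v))"
          using i j vA by (intro rel_commutant_comm[OF y] E_in A_intros l_in \<theta>A)
        thus "l j * E ((l j)\<^sup>\<star> * (l i * \<theta> v)) * y * (l i)\<^sup>\<star> = l j * y * (E (v * (l j)\<^sup>\<star> * l i) * (l i)\<^sup>\<star>)"
          unfolding 1 by (metis mult.assoc)
      qed
    qed
    also have "\<dots> = (\<Sum>j\<in>I. l j * y * (\<Sum>i\<in>I. E (v * (l j)\<^sup>\<star> * l i) * (l i)\<^sup>\<star>))"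
      by (subst sum.swap) (simp add: sum_distrib_left)
    also have "\<dots> = (\<Sum>j\<in>I. l j * y * (v * (l j)\<^sup>\<star>))"
      using vA by (intro sum.cong refl) (simp add: frame' l_in A_intros)
    also have "\<dots> = Phi (y * v)" by (simp add: Phi_def mult.assoc)
    finally show ?thesis .
  qed
  have Et: "E (\<theta> v * y) = E (y * v)" if v: "v \<in> rel_commutant B A" and y: "y \<in> rel_commutant B A" for v y
  proof -
    have "c *\<^sub>R E (\<theta> v * y) = c *\<^sub>R E (y * v)"
      using PhiT[OF v y] Phi_eq[OF subalg_mult[OF RC \<theta>C[OF v] y]] Phi_eq[OF subalg_mult[OF RC y v]] by simp
    thus ?thesis using c_pos by simp
  qed
  have invol: "\<theta> (\<theta> v) = v" if v: "v \<in> rel_commutant B A" for v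
  proof -
    define u where "u = \<theta> (\<theta> v) - v"
    have uC: "u \<in> rel_commutant B A" unfolding u_def using v by (intro subalg_diff[OF RC] \<theta>C)
    have us: "u\<^sup>\<star> \<in> rel_commutant B A" by (rule subalg_star[OF RC uC])
    have "E (u\<^sup>\<star> * u) = E (u\<^sup>\<star> * \<theta> (\<theta> v)) - E (u\<^sup>\<star> * v)"
      unfolding right_diff_distrib[symmetric] u_def[symmetric]
      using rel_commutant_mem[OF us] rel_commutant_mem[OF v] E_diff[of "u\<^sup>\<star> * \<theta> (\<theta> v)" "u\<^sup>\<star> * v"]
      by (simp add: A_intros \<theta>A right_diff_distrib[symmetric] flip: u_def)
    also have "E (u\<^sup>\<star> * \<theta> (\<theta> v)) = E (\<theta> v * u\<^sup>\<star>)" using mod[OF \<theta>C[OF v]] rel_commutant_mem[OF us] by simp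
    also have "\<dots> = E (u\<^sup>\<star> * v)" by (rule Et[OF v us])
    finally have "E (u\<^sup>\<star> * u) = 0" by simp
    hence "u = 0" using faithful[OF rel_commutant_mem[OF uC]] by simp
    thus ?thesis by (simp add: u_def)
  qed
  have \<theta>_diff: "\<theta> (v - y) = \<theta> v - \<theta> y" if "v \<in> A" "y \<in> A" for v y
    unfolding \<theta>_def sum_subtractf[symmetric] using that
    by (intro sum.cong refl) (simp add: left_diff_distrib right_diff_distrib E_diff A_intros l_in)
  \<comment> \<open>an eigenvector of the involution for the value \<open>-1\<close>\<close>
  define w where "w = \<theta> x - x"
  have wC: "w \<in> rel_commutant B A" unfolding w_def using x by (intro subalg_diff[OF RC] \<theta>C)
  have wA: "w \<in> A" and xA: "x \<in> A" using wC x rel_commutant_mem by auto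
  have "\<theta> w = x - \<theta> x" unfolding w_def using xA by (simp add: \<theta>_diff \<theta>A invol[OF x])
  hence \<theta>w: "\<theta> w = - w" by (simp add: w_def)
  have "E (w * w\<^sup>\<star>) = - E (w\<^sup>\<star> * w)"
    using mod[OF wC, of "w\<^sup>\<star>"] wA E_minus[of "w\<^sup>\<star> * w"] by (simp add: \<theta>w A_intros)
  hence "E (w\<^sup>\<star> * w) + E (w * w\<^sup>\<star>) = 0" by simp
  moreover have "pos (E (w\<^sup>\<star> * w))" using wA by (rule E_pos)
  moreover have "pos (E (w * w\<^sup>\<star>))" using wA E_pos[of "w\<^sup>\<star>"] by (simp add: A_intros star_star)
  ultimately have "E (w\<^sup>\<star> * w) = 0" using pos_add_eq_0 by blast
  hence "w = 0" using faithful wA by blast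
  hence "\<theta> x = x" by (simp add: w_def)
  thus ?thesis using mod[OF x z] by simp
qed

end

text \<open>
  The map \<open>Phi\<close> of the composed expectation is the composition of the two maps: the inner one sends
  \<open>B' \<inter> C\<close> to \<open>A' \<inter> C\<close>, where the outer one is a multiple of \<open>E1\<close>, and \<open>E1\<close> commutes with
  the inner map because the \<open>l i\<close> lie in \<open>A\<close>.
\<close>
lemma markov_comp:
  assumes "markov A B E I l c" and "markov C A E1 J m d"
  shows "markov C B (E \<circ> E1) (J \<times> I) (\<lambda>(j, i). m j * l i) (d * c)"
proof -
  interpret a: markov A B E I l c by fact
  interpret b: markov C A E1 J m d by fact
  have expn: "expectation C B (E \<circ> E1)"
  proof
    show "B \<subseteq> C" using a.BA b.BA by blast
    fix x assume x: "x \<in> C"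
    show "pos ((E \<circ> E1) (x\<^sup>\<star> * x))" using x by (auto intro!: a.E_pos_of_pos b.E_pos b.E_in b.A_intros)
    show "(E \<circ> E1) (r * x * s) = r * (E \<circ> E1) x * s" if "r \<in> B" "s \<in> B" for r s
      using that x by (simp add: b.E_bimod a.B_in_A a.E_bimod b.E_in)
  qed (auto simp: a.A b.A a.B a.B_in_A a.E_in b.E_in a.E_add b.E_add a.E_scaleC b.E_scaleC a.E_fix b.E_fix)
  interpret ab: expectation C B "E \<circ> E1" by (rule expn)
  have ml: "l i \<in> A" "l i \<in> C" if "i \<in> I" for i using a.l_in[OF that] b.B_in_A by auto
  interpret ab: framed C B "E \<circ> E1" "J \<times> I" "\<lambda>(j, i). m j * l i"
  proof
    show "finite (J \<times> I)" using a.fin b.fin by simp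
    show "(case p of (j, i) \<Rightarrow> m j * l i) \<in> C" if "p \<in> J \<times> I" for p
      using that by (auto intro!: b.A_intros b.l_in ml)
    fix x assume x: "x \<in> C"
    have "(\<Sum>p\<in>J \<times> I. (case p of (j, i) \<Rightarrow> m j * l i) * (E \<circ> E1) ((case p of (j, i) \<Rightarrow> m j * l i)\<^sup>\<star> * x))
       = (\<Sum>j\<in>J. \<Sum>i\<in>I. m j * l i * E (E1 ((m j * l i)\<^sup>\<star> * x)))"
      by (simp add: sum.cartesian_product case_prod_unfold)
    also have "\<dots> = (\<Sum>j\<in>J. m j * (\<Sum>i\<in>I. l i * E ((l i)\<^sup>\<star> * E1 ((m j)\<^sup>\<star> * x))))"
      unfolding sum_distrib_left
    proof (intro sum.cong refl)
      fix j i assume ij: "j \<in> J" "i \<in> I"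
      have "E1 ((m j * l i)\<^sup>\<star> * x) = (l i)\<^sup>\<star> * E1 ((m j)\<^sup>\<star> * x)"
        using ij x b.E_left[of "(l i)\<^sup>\<star>" "(m j)\<^sup>\<star> * x"] by (simp add: star_simps mult.assoc a.A_intros ml b.A_intros b.l_in)
      thus "m j * l i * E (E1 ((m j * l i)\<^sup>\<star> * x)) = m j * (l i * E ((l i)\<^sup>\<star> * E1 ((m j)\<^sup>\<star> * x)))" by (simp add: mult.assoc)
    qed
    also have "\<dots> = (\<Sum>j\<in>J. m j * E1 ((m j)\<^sup>\<star> * x))"
      using x by (intro sum.cong refl) (simp add: a.frame b.E_in b.A_intros b.l_in)
    also have "\<dots> = x" by (rule b.frame[OF x])
    finally show "(\<Sum>p\<in>J \<times> I. (case p of (j, i) \<Rightarrow> m j * l i) * (E \<circ> E1) ((case p of (j, i) \<Rightarrow> m j * l i)\<^sup>\<star> * x)) = x" .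
  qed
  have Phi: "ab.Phi x = b.Phi (a.Phi x)" for x
  proof -
    have "ab.Phi x = (\<Sum>j\<in>J. \<Sum>i\<in>I. m j * l i * x * (m j * l i)\<^sup>\<star>)"
      unfolding ab.Phi_def by (simp add: sum.cartesian_product case_prod_unfold)
    also have "\<dots> = b.Phi (a.Phi x)"
      by (simp add: a.Phi_def b.Phi_def star_simps sum_distrib_left sum_distrib_right mult.assoc)
    finally show ?thesis .
  qed
  show ?thesis
  proof
    show "d * c > 0" using a.c_pos b.c_pos by simp
    show "ab.Phi 1 = (d * c) *\<^sub>R 1" unfolding Phi a.index b.Phi_scaleR b.index by (simp add: mult.commute)
    fix x assume x: "x \<in> rel_commutant B C"
    have xC: "x \<in> C" using rel_commutant_mem[OF x] .
    have "a.Phi x \<in> rel_commutant A C" by (rule a.Phi_in[OF b.A b.BA x])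
    hence "ab.Phi x = d *\<^sub>R E1 (a.Phi x)" unfolding Phi by (rule b.Phi_eq)
    also have "E1 (a.Phi x) = (\<Sum>i\<in>I. E1 (l i * x * (l i)\<^sup>\<star>))"
      unfolding a.Phi_def using xC ml by (intro b.E_sum b.A_intros) auto
    also have "\<dots> = a.Phi (E1 x)" unfolding a.Phi_def using xC ml
      by (intro sum.cong refl b.E_bimod a.A_intros) auto
    also have "E1 x \<in> rel_commutant B A"
    proof (rule rel_commutantI)
      fix r assume r: "r \<in> B"
      hence rA: "r \<in> A" by (rule a.B_in_A)
      have "E1 (r * x) = E1 (x * r)" using rel_commutant_comm[OF x r] by simp
      thus "r * E1 x = E1 x * r" using rA xC by (simp add: b.E_left b.E_right)
    qed (use xC b.E_in in auto)
    hence "a.Phi (E1 x) = c *\<^sub>R E (E1 x)" by (rule a.Phi_eq)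
    finally show "ab.Phi x = (d * c) *\<^sub>R (E \<circ> E1) x" by simp
  qed
qed

section \<open>The basic construction\<close>

text \<open>
  The algebraic content of a basic construction \<open>C\<close> of \<open>B \<subseteq> A\<close> with projection \<open>e\<close> and dual
  expectation \<open>E1\<close>.  The last two conditions together say that \<open>C\<close> is the span of \<open>A e A\<close>: by \<open>push\<close>,
  multiplying the representation of \<open>1\<close> in \<open>unit\<close> from the left stays within that span.
\<close>
locale jones = markov A B E I l c
  for A B :: "'a::cstar_algebra set" and E and I :: "'i set" and l c +
  fixes C :: "'a set" and e :: 'a and E1 :: "'a \<Rightarrow> 'a"
  assumes E1_expectation: "expectation C A E1"
    and e_in: "e \<in> C" and e_star: "e\<^sup>\<star> = e"
    and e_compress: "a \<in> A \<Longrightarrow> e * a * e = E a * e"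
    and E1_e: "x \<in> A \<Longrightarrow> y \<in> A \<Longrightarrow> E1 (x * e * y) = (1 / c) *\<^sub>R (x * y)"
    and push: "x \<in> C \<Longrightarrow> \<exists>a\<in>A. x * e = a * e"
    and unit: "1 \<in> span {a * e * b |a b. a \<in> A \<and> b \<in> A}"
begin

sublocale up: expectation C A E1 by (rule E1_expectation)

lemma e_idem: "e * e = e"
  using e_compress[of 1] by (simp add: E_one A_intros)

lemma e_comm: "b \<in> B \<Longrightarrow> b * e = e * b"
proof -
  have *: "e * b * e = b * e" if "b \<in> B" for b
    using e_compress[of b] that by (simp add: B_in_A E_fix)
  assume b: "b \<in> B"
  have "(e * b\<^sup>\<star> * e)\<^sup>\<star> = (b\<^sup>\<star> * e)\<^sup>\<star>" using *[of "b\<^sup>\<star>"] b by (simp add: B_intros)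
  thus ?thesis using *[OF b] by (simp add: star_simps e_star mult.assoc)
qed

text \<open>
  The element of \<open>A\<close> provided by \<open>push\<close> is recovered with \<open>E1\<close>.
\<close>
lemma push_eq: assumes x: "x \<in> C" shows "x * e = (c *\<^sub>R E1 (x * e)) * e"
proof -
  obtain a where a: "a \<in> A" "x * e = a * e" using push[OF x] by blast
  have "E1 (a * e) = (1/c) *\<^sub>R a" using E1_e[of a 1] a by (simp add: A_intros)
  thus ?thesis using a c_pos by simp
qed

lemma push_eq': assumes x: "x \<in> C" shows "e * x = c *\<^sub>R (e * E1 (e * x))"
proof -
  have "(x\<^sup>\<star> * e)\<^sup>\<star> = ((c *\<^sub>R E1 (x\<^sup>\<star> * e)) * e)\<^sup>\<star>" using push_eq[of "x\<^sup>\<star>"] x by (simp add: up.A_intros)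
  also have "\<dots> = c *\<^sub>R (e * (E1 (x\<^sup>\<star> * e))\<^sup>\<star>)" by (simp add: star_simps e_star)
  also have "(E1 (x\<^sup>\<star> * e))\<^sup>\<star> = E1 ((x\<^sup>\<star> * e)\<^sup>\<star>)" using x e_in by (intro up.E_star[symmetric] up.A_intros)
  finally show ?thesis by (simp add: star_simps e_star)
qed

text \<open>
  By the quasi-basis property the sum is a left unit for every \<open>a e b\<close>, hence on their span, which
  contains \<open>1\<close>.
\<close>
lemma resolution: "(\<Sum>i\<in>I. l i * e * (l i)\<^sup>\<star>) = 1"
proof -
  let ?u = "\<Sum>i\<in>I. l i * e * (l i)\<^sup>\<star>"
  have "?u * x = x" if "x \<in> span {a * e * b |a b. a \<in> A \<and> b \<in> A}" for x
    using that
  proof (induction rule: span_induct)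
    case base
    show ?case unfolding subspace_def by (simp add: distrib_left)
  next
    case (step x)
    then obtain a b where ab: "x = a * e * b" "a \<in> A" by blast
    have "?u * (a * e * b) = (\<Sum>i\<in>I. l i * (e * ((l i)\<^sup>\<star> * a) * e) * b)"
      by (simp add: sum_distrib_right mult.assoc)
    also have "\<dots> = (\<Sum>i\<in>I. l i * E ((l i)\<^sup>\<star> * a)) * (e * b)"
      unfolding sum_distrib_right
    proof (intro sum.cong refl)
      fix i assume "i \<in> I"
      hence "e * ((l i)\<^sup>\<star> * a) * e = E ((l i)\<^sup>\<star> * a) * e" using ab by (intro e_compress A_intros l_in)
      thus "l i * (e * ((l i)\<^sup>\<star> * a) * e) * b = l i * E ((l i)\<^sup>\<star> * a) * (e * b)"
        by (simp only: mult.assoc)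
    qed
    also have "\<dots> = a * e * b" by (simp add: frame[OF ab(2)] mult.assoc)
    finally show ?case unfolding ab(1) .
  qed
  from this[OF unit] show ?thesis by simp
qed

text \<open>
  The operator on the module \<open>A\<close> represented by \<open>x\<close>: it is determined by \<open>x a e = (act x a) e\<close>.
\<close>
definition act :: "'a \<Rightarrow> 'a \<Rightarrow> 'a" where "act x a = c *\<^sub>R E1 (x * a * e)"

lemma act_in: "x \<in> C \<Longrightarrow> a \<in> A \<Longrightarrow> act x a \<in> A"
  unfolding act_def by (simp add: A_intros up.E_in up.A_intros up.B_in_A e_in)

lemma act_push: "x \<in> C \<Longrightarrow> a \<in> A \<Longrightarrow> x * a * e = act x a * e"
  unfolding act_def by (rule push_eq) (simp add: up.A_intros up.B_in_A)

lemma act_unique: "x \<in> C \<Longrightarrow> a \<in> A \<Longrightarrow> y \<in> A \<Longrightarrow> x * a * e = y * e \<Longrightarrow> act x a = y"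
  using E1_e[of y 1] c_pos by (simp add: act_def A_intros)

lemma expand: "x = (\<Sum>i\<in>I. (x * l i * e) * (l i)\<^sup>\<star>)"
proof -
  have "x = x * (\<Sum>i\<in>I. l i * e * (l i)\<^sup>\<star>)" by (simp add: resolution)
  thus ?thesis by (simp add: sum_distrib_left mult.assoc)
qed

text \<open>
  An element of \<open>C\<close> is reconstructed from its action through the resolution of the identity.
\<close>
lemma act_eqI:
  assumes "x \<in> C" "y \<in> C" "\<And>a. a \<in> A \<Longrightarrow> act x a = act y a" shows "x = y"
proof -
  have "x = (\<Sum>i\<in>I. (act x (l i) * e) * (l i)\<^sup>\<star>)"
    using assms by (subst expand) (simp add: act_push l_in)
  also have "\<dots> = (\<Sum>i\<in>I. (act y (l i) * e) * (l i)\<^sup>\<star>)" using assms(3) l_in by simp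
  also have "\<dots> = y" using assms by (subst (2) expand) (simp add: act_push l_in)
  finally show ?thesis .
qed

lemma act_mult: "x \<in> C \<Longrightarrow> y \<in> C \<Longrightarrow> a \<in> A \<Longrightarrow> act (x * y) a = act x (act y a)"
proof (rule act_unique)
  assume x: "x \<in> C" "y \<in> C" "a \<in> A"
  have "x * y * a * e = x * (y * a * e)" by (simp add: mult.assoc)
  also have "\<dots> = x * act y a * e" unfolding act_push[OF x(2,3)] by (simp add: mult.assoc)
  also have "\<dots> = act x (act y a) * e" using x by (intro act_push act_in)
  finally show "x * y * a * e = act x (act y a) * e" .
qed (auto simp: up.A_intros act_in)

lemma act_add: "x \<in> C \<Longrightarrow> y \<in> C \<Longrightarrow> a \<in> A \<Longrightarrow> act (x + y) a = act x a + act y a"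
  by (simp add: act_def distrib_right up.E_add up.A_intros up.B_in_A e_in scaleR_add_right)

lemma act_scaleC: "x \<in> C \<Longrightarrow> a \<in> A \<Longrightarrow> act (z *\<^sub>C x) a = z *\<^sub>C act x a"
  by (simp add: act_def mult_scaleC_left up.E_scaleC up.A_intros up.B_in_A e_in scaleC_scaleR)

lemma act_right: "x \<in> C \<Longrightarrow> a \<in> A \<Longrightarrow> b \<in> B \<Longrightarrow> act x (a * b) = act x a * b"
proof (rule act_unique)
  assume x: "x \<in> C" "a \<in> A" "b \<in> B"
  have "x * (a * b) * e = (x * a * e) * b" using e_comm[OF x(3)] by (simp add: mult.assoc)
  also have "\<dots> = act x a * b * e" unfolding act_push[OF x(1,2)] using e_comm[OF x(3)] by (simp add: mult.assoc)
  finally show "x * (a * b) * e = act x a * b * e" .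
qed (auto simp: A_intros act_in B_in_A)

lemma act_left: "x \<in> rel_commutant B C \<Longrightarrow> a \<in> A \<Longrightarrow> b \<in> B \<Longrightarrow> act x (b * a) = b * act x a"
proof (rule act_unique)
  assume x: "x \<in> rel_commutant B C" "a \<in> A" "b \<in> B"
  show "x * (b * a) * e = b * act x a * e"
    using act_push[OF rel_commutant_mem[OF x(1)] x(2)] rel_commutant_comm[OF x(1,3)] by (metis mult.assoc)
qed (auto simp: A_intros act_in B_in_A rel_commutant_mem)

lemma act_sum:
  assumes x: "x \<in> C" and a: "\<And>j. j \<in> J \<Longrightarrow> a j \<in> A"
  shows "act x (\<Sum>j\<in>J. a j) = (\<Sum>j\<in>J. act x (a j))"
  unfolding act_def sum_distrib_left sum_distrib_right scaleR_sum_right[symmetric] using x a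
  by (subst up.E_sum) (auto simp: up.A_intros up.B_in_A e_in)

lemma act_adjoint:
  assumes x: "x \<in> C" and ab: "a \<in> A" "b \<in> A"
  shows "E ((act x b)\<^sup>\<star> * a) = E (b\<^sup>\<star> * act (x\<^sup>\<star>) a)"
proof -
  have xs: "x\<^sup>\<star> \<in> C" using x by (intro up.A_intros)
  have "e * b\<^sup>\<star> * x\<^sup>\<star> = (x * b * e)\<^sup>\<star>" by (simp add: star_simps e_star mult.assoc)
  also have "\<dots> = e * (act x b)\<^sup>\<star>" using x ab by (simp add: act_push star_simps e_star)
  finally have 1: "e * b\<^sup>\<star> * x\<^sup>\<star> = e * (act x b)\<^sup>\<star>" .
  have "e * ((act x b)\<^sup>\<star> * a) * e = e * b\<^sup>\<star> * x\<^sup>\<star> * a * e" unfolding 1 by (simp add: mult.assoc)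
  also have "\<dots> = e * (b\<^sup>\<star> * (x\<^sup>\<star> * a * e))" by (simp add: mult.assoc)
  also have "\<dots> = e * (b\<^sup>\<star> * act (x\<^sup>\<star>) a) * e" unfolding act_push[OF xs ab(1)] by (simp add: mult.assoc)
  finally have "E ((act x b)\<^sup>\<star> * a) * e = E (b\<^sup>\<star> * act (x\<^sup>\<star>) a) * e"
    using x xs ab by (simp add: e_compress A_intros act_in)
  hence "E1 (E ((act x b)\<^sup>\<star> * a) * e * 1) = E1 (E (b\<^sup>\<star> * act (x\<^sup>\<star>) a) * e * 1)" by simp
  thus ?thesis using x xs ab c_pos by (subst (asm) (1 2) E1_e) (auto intro!: E_in_A A_intros act_in)
qed

text \<open>
  The scaled elements \<open>l\<^sub>i e\<close> form a quasi-basis of \<open>E1\<close>.  For \<open>z\<close> commuting with \<open>A\<close> put \<open>w = act z 1\<close>,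
  so that \<open>z\<close> acts as right multiplication by \<open>w\<close>.  Then \<open>e z e = (E w) e\<close>, and
  the proportionality of \<open>Phi\<close> and \<open>E\<close> at \<open>w\<close> both makes \<open>E w\<close> commute with \<open>A\<close> and identifies it
  with \<open>E1 z\<close>.
\<close>
theorem dual_markov: "markov C A E1 I (\<lambda>i. sqrt c *\<^sub>R (l i * e)) c"
proof -
  have ss: "sqrt c * sqrt c = c" using c_pos by simp
  have lC: "l i \<in> C" if "i \<in> I" for i using up.B_in_A[OF l_in[OF that]] .
  interpret d: framed C A E1 I "\<lambda>i. sqrt c *\<^sub>R (l i * e)"
  proof
    show "finite I" by (rule fin)
    show "sqrt c *\<^sub>R (l i * e) \<in> C" if "i \<in> I" for i using lC[OF that] e_in by (intro up.A_intros)
    fix x assume x: "x \<in> C"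
    have "(\<Sum>i\<in>I. sqrt c *\<^sub>R (l i * e) * E1 ((sqrt c *\<^sub>R (l i * e))\<^sup>\<star> * x))
       = (\<Sum>i\<in>I. l i * (c *\<^sub>R (e * E1 (e * ((l i)\<^sup>\<star> * x)))))"
    proof (intro sum.cong refl)
      fix i assume i: "i \<in> I"
      have "E1 ((sqrt c *\<^sub>R (l i * e))\<^sup>\<star> * x) = sqrt c *\<^sub>R E1 (e * ((l i)\<^sup>\<star> * x))"
        using lC[OF i] e_in x by (simp add: star_simps e_star mult.assoc up.E_scaleR up.A_intros)
      thus "sqrt c *\<^sub>R (l i * e) * E1 ((sqrt c *\<^sub>R (l i * e))\<^sup>\<star> * x) = l i * (c *\<^sub>R (e * E1 (e * ((l i)\<^sup>\<star> * x))))"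
        using ss by (simp add: mult.assoc)
    qed
    also have "\<dots> = (\<Sum>i\<in>I. l i * (e * ((l i)\<^sup>\<star> * x)))"
      using x lC by (intro sum.cong refl) (simp flip: push_eq' add: up.A_intros)
    also have "\<dots> = x" using resolution by (simp flip: mult.assoc sum_distrib_right)
    finally show "(\<Sum>i\<in>I. sqrt c *\<^sub>R (l i * e) * E1 ((sqrt c *\<^sub>R (l i * e))\<^sup>\<star> * x)) = x" .
  qed
  have dPhi: "d.Phi x = c *\<^sub>R (\<Sum>i\<in>I. l i * (e * x * e) * (l i)\<^sup>\<star>)" for x
    unfolding d.Phi_def scaleR_sum_right using ss
    by (intro sum.cong refl) (simp add: star_simps e_star mult.assoc)
  show ?thesis
  proof
    show "c > 0" by (rule c_pos)
    show "d.Phi 1 = c *\<^sub>R 1" unfolding dPhi by (simp add: e_idem resolution)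
    fix z assume z: "z \<in> rel_commutant A C"
    have zC: "z \<in> C" using rel_commutant_mem[OF z] .
    define w where "w = act z 1"
    have w: "w \<in> A" "z * e = w * e" using zC act_push[OF zC, of 1] by (auto simp: w_def act_in A_intros)
    have wC: "w \<in> rel_commutant B A"
    proof (rule rel_commutantI[OF w(1)])
      fix b assume b: "b \<in> B"
      have bA: "b \<in> A" using b by (rule B_in_A)
      have zB: "z \<in> rel_commutant B C" using z BA by (auto simp: rel_commutant_def)
      have "b * w = act z (b * 1)" unfolding w_def using b zB by (intro act_left[symmetric] A_intros)
      also have "\<dots> = act z (1 * b)" by simp
      also have "\<dots> = w * b" unfolding w_def using b zC by (intro act_right A_intros)
      finally show "b * w = w * b" .
    qed
    have Ew: "E w = (1/c) *\<^sub>R Phi w" using Phi_eq[OF wC] c_pos by simp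
    have Ewc: "a * E w = E w * a" if "a \<in> A" for a
      using Phi_comm[of w a] rel_commutant_comm[OF wC] that by (simp add: Ew)
    have "d.Phi z = c *\<^sub>R (\<Sum>i\<in>I. l i * (E w * e) * (l i)\<^sup>\<star>)"
      using w e_compress[OF w(1)] by (simp add: dPhi mult.assoc)
    also have "(\<Sum>i\<in>I. l i * (E w * e) * (l i)\<^sup>\<star>) = E w * (\<Sum>i\<in>I. l i * e * (l i)\<^sup>\<star>)"
      unfolding sum_distrib_left
    proof (intro sum.cong refl)
      fix i assume "i \<in> I"
      hence "l i * E w = E w * l i" by (intro Ewc l_in)
      thus "l i * (E w * e) * (l i)\<^sup>\<star> = E w * (l i * e * (l i)\<^sup>\<star>)" by (metis mult.assoc)
    qed
    also have "\<dots> = E w" by (simp add: resolution)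
    also have "E w = E1 z"
    proof -
      have "z = (\<Sum>i\<in>I. l i * w * e * (l i)\<^sup>\<star>)"
      proof -
        have "z * l i * e = l i * w * e" if "i \<in> I" for i
          using w rel_commutant_comm[OF z l_in[OF that]] by (metis mult.assoc)
        thus ?thesis using expand[of z] by (simp cong: sum.cong)
      qed
      hence "E1 z = (\<Sum>i\<in>I. E1 (l i * w * e * (l i)\<^sup>\<star>))"
        using w(1) lC e_in up.B_in_A by (simp add: up.E_sum up.A_intros)
      also have "\<dots> = (\<Sum>i\<in>I. (1/c) *\<^sub>R (l i * w * (l i)\<^sup>\<star>))"
        using w l_in by (intro sum.cong refl E1_e A_intros)
      also have "\<dots> = E w" by (simp add: Ew Phi_def scaleR_sum_right)
      finally show ?thesis by simp
    qed
    finally show "d.Phi z = c *\<^sub>R E1 z" .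
  qed
qed

end

section \<open>Conjugation by the involution of the module\<close>

text \<open>
  Two consecutive basic constructions: \<open>B \<subseteq> A \<subseteq> C \<subseteq> D\<close> with projections \<open>e\<close> in \<open>C\<close> and \<open>f\<close> in \<open>D\<close>.
\<close>
locale two_steps = jones A B E I l c C e E1 + up2: jones C A E1 J m c D f E2
  for A B :: "'a::cstar_algebra set" and E and I :: "'i set" and l c
    and C e E1 and J :: "'j set" and m and D f E2
begin

lemma markov_comp_up: "markov C B (E \<circ> E1) (J \<times> I) (\<lambda>(j, i). m j * l i) (c * c)"
  by (rule markov_comp) unfold_locales

text \<open>
  The rotation in quasi-basis form; since \<open>act x\<^sup>\<star> l\<^sub>i\<^sup>\<star>\<close> is \<open>c E1 (x\<^sup>\<star> l\<^sub>i\<^sup>\<star> e)\<close>, this is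
  \<open>c \<Sum> E1 (e l\<^sub>i x) e l\<^sub>i\<^sup>\<star>\<close>.
\<close>
definition \<gamma> :: "'a \<Rightarrow> 'a" where "\<gamma> x = (\<Sum>i\<in>I. (act (x\<^sup>\<star>) ((l i)\<^sup>\<star>))\<^sup>\<star> * e * (l i)\<^sup>\<star>)"

lemma \<gamma>_in: "x \<in> C \<Longrightarrow> \<gamma> x \<in> C"
  unfolding \<gamma>_def by (intro up.A_intros up.B_in_A[OF act_in] A_intros e_in l_in up.B_in_A[OF l_in])

text \<open>
  The rotation conjugates the operator \<open>x\<^sup>\<star>\<close> by \<open>a \<mapsto> a\<^sup>\<star>\<close>: the coefficients \<open>E (a\<^sup>\<star> l\<^sub>i)\<close> can be
  absorbed into the action because \<open>x\<^sup>\<star>\<close> is left \<open>B\<close>-linear, and then they reassemble \<open>a\<^sup>\<star>\<close>.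
\<close>
lemma act_\<gamma>:
  assumes x: "x \<in> rel_commutant B C" and a: "a \<in> A"
  shows "act (\<gamma> x) a = (act (x\<^sup>\<star>) (a\<^sup>\<star>))\<^sup>\<star>"
proof (rule act_unique)
  have xC: "x \<in> C" using rel_commutant_mem[OF x] .
  have RC: "cstar_subalgebra (rel_commutant B C)" by (intro cstar_subalgebra_rel_commutant up.A B_intros)
  have xs: "x\<^sup>\<star> \<in> rel_commutant B C" by (rule subalg_star[OF RC x])
  have xsC: "x\<^sup>\<star> \<in> C" using rel_commutant_mem[OF xs] .
  show "\<gamma> x \<in> C" "a \<in> A" by (intro \<gamma>_in xC a)+
  show "(act (x\<^sup>\<star>) (a\<^sup>\<star>))\<^sup>\<star> \<in> A" using xsC a by (intro A_intros act_in)
  have "\<gamma> x * a * e = (\<Sum>i\<in>I. (act (x\<^sup>\<star>) ((l i)\<^sup>\<star>))\<^sup>\<star> * (e * ((l i)\<^sup>\<star> * a) * e))"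
    by (simp add: \<gamma>_def sum_distrib_right mult.assoc)
  also have "\<dots> = (\<Sum>i\<in>I. (act (x\<^sup>\<star>) (E (a\<^sup>\<star> * l i) * (l i)\<^sup>\<star>))\<^sup>\<star> * e)"
  proof (intro sum.cong refl)
    fix i assume i: "i \<in> I"
    have "act (x\<^sup>\<star>) (E (a\<^sup>\<star> * l i) * (l i)\<^sup>\<star>) = E (a\<^sup>\<star> * l i) * act (x\<^sup>\<star>) ((l i)\<^sup>\<star>)"
      using i a by (intro act_left xs E_in A_intros l_in)
    moreover have "(E (a\<^sup>\<star> * l i))\<^sup>\<star> = E ((l i)\<^sup>\<star> * a)"
      using i a E_star[of "a\<^sup>\<star> * l i"] l_in by (simp add: A_intros star_simps)
    moreover have "e * ((l i)\<^sup>\<star> * a) * e = E ((l i)\<^sup>\<star> * a) * e"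
      using i a by (intro e_compress A_intros l_in)
    ultimately show "(act (x\<^sup>\<star>) ((l i)\<^sup>\<star>))\<^sup>\<star> * (e * ((l i)\<^sup>\<star> * a) * e) = (act (x\<^sup>\<star>) (E (a\<^sup>\<star> * l i) * (l i)\<^sup>\<star>))\<^sup>\<star> * e"
      by (simp only: star_mult mult.assoc)
  qed
  also have "\<dots> = (\<Sum>i\<in>I. act (x\<^sup>\<star>) (E (a\<^sup>\<star> * l i) * (l i)\<^sup>\<star>))\<^sup>\<star> * e"
    by (simp add: star_sum sum_distrib_right)
  also have "(\<Sum>i\<in>I. act (x\<^sup>\<star>) (E (a\<^sup>\<star> * l i) * (l i)\<^sup>\<star>)) = act (x\<^sup>\<star>) (\<Sum>i\<in>I. E (a\<^sup>\<star> * l i) * (l i)\<^sup>\<star>)"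
    using a by (intro act_sum[symmetric] xsC A_intros E_in_A l_in)
  also have "(\<Sum>i\<in>I. E (a\<^sup>\<star> * l i) * (l i)\<^sup>\<star>) = a\<^sup>\<star>" by (intro frame' A_intros a)
  finally show "\<gamma> x * a * e = (act (x\<^sup>\<star>) (a\<^sup>\<star>))\<^sup>\<star> * e" .
qed

text \<open>
  Everything is checked on the module through \<open>act_\<gamma>\<close>.  Preservation of adjoints
  reduces, by \<open>act_adjoint\<close>, to the traciality of \<open>E \<circ> E1\<close> with respect to \<open>B' \<inter> C\<close>.
\<close>
theorem \<gamma>_anti_automorphism: "star_anti_automorphism (rel_commutant B C) \<gamma>"
proof -
  interpret comp: markov C B "E \<circ> E1" "J \<times> I" "\<lambda>(j, i). m j * l i" "c * c" by (rule markov_comp_up)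
  let ?R = "rel_commutant B C"
  have RC: "cstar_subalgebra ?R" by (intro cstar_subalgebra_rel_commutant up.A B_intros)
  note R_intros = subalg_intros[OF RC]
  have RiC: "x \<in> C" if "x \<in> ?R" for x using rel_commutant_mem[OF that] .
  have g_in: "\<gamma> x \<in> ?R" if x: "x \<in> ?R" for x
  proof (rule rel_commutantI)
    show gC: "\<gamma> x \<in> C" by (intro \<gamma>_in RiC x)
    fix b assume b: "b \<in> B"
    have bA: "b \<in> A" and bC: "b \<in> C" using b B_in_A up.B_in_A by auto
    have xs: "x\<^sup>\<star> \<in> C" by (intro RiC R_intros x)
    show "b * \<gamma> x = \<gamma> x * b"
    proof (rule act_eqI)
      show "b * \<gamma> x \<in> C" "\<gamma> x * b \<in> C" using bC gC by (auto intro: up.A_intros(3))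
      fix a assume a: "a \<in> A"
      have ac: "act y a' = y * a'" if "y \<in> A" "a' \<in> A" for y a'
        using that by (intro act_unique) (auto simp: up.B_in_A A_intros)
      have "act (b * \<gamma> x) a = b * (act (x\<^sup>\<star>) (a\<^sup>\<star>))\<^sup>\<star>"
        using a bA bC gC x xs by (simp add: act_mult act_\<gamma> ac A_intros act_in)
      also have "\<dots> = (act (x\<^sup>\<star>) (a\<^sup>\<star>) * b\<^sup>\<star>)\<^sup>\<star>" by (simp add: star_simps)
      also have "act (x\<^sup>\<star>) (a\<^sup>\<star>) * b\<^sup>\<star> = act (x\<^sup>\<star>) (a\<^sup>\<star> * b\<^sup>\<star>)"
        using a b xs by (intro act_right[symmetric] A_intros B_intros)
      also have "(act (x\<^sup>\<star>) (a\<^sup>\<star> * b\<^sup>\<star>))\<^sup>\<star> = act (\<gamma> x) (b * a)"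
        using a bA x by (subst act_\<gamma>) (auto simp: A_intros star_simps)
      also have "\<dots> = act (\<gamma> x * b) a"
        using a bA bC gC by (simp add: act_mult ac)
      finally show "act (b * \<gamma> x) a = act (\<gamma> x * b) a" .
    qed
  qed
  have g_mult: "\<gamma> (x * y) = \<gamma> y * \<gamma> x" if x: "x \<in> ?R" and y: "y \<in> ?R" for x y
  proof (rule act_eqI)
    have C: "x \<in> C" "y \<in> C" "x\<^sup>\<star> \<in> C" "y\<^sup>\<star> \<in> C" "\<gamma> x \<in> C" "\<gamma> y \<in> C"
      using x y by (auto intro!: RiC g_in subalg_star[OF RC])
    show "\<gamma> (x * y) \<in> C" "\<gamma> y * \<gamma> x \<in> C" using C by (auto intro: up.A_intros(3) \<gamma>_in)
    fix a assume a: "a \<in> A"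
    have "act (\<gamma> (x * y)) a = (act (y\<^sup>\<star>) (act (x\<^sup>\<star>) (a\<^sup>\<star>)))\<^sup>\<star>"
      using x y a C by (simp add: act_\<gamma> subalg_mult[OF RC] star_mult act_mult A_intros)
    also have "\<dots> = act (\<gamma> y) ((act (x\<^sup>\<star>) (a\<^sup>\<star>))\<^sup>\<star>)"
      using y a C by (simp add: act_\<gamma> act_in A_intros star_star)
    also have "\<dots> = act (\<gamma> y * \<gamma> x) a" using x a C by (simp add: act_mult act_\<gamma>)
    finally show "act (\<gamma> (x * y)) a = act (\<gamma> y * \<gamma> x) a" .
  qed
  have g_add: "\<gamma> (x + y) = \<gamma> x + \<gamma> y" if x: "x \<in> ?R" and y: "y \<in> ?R" for x y
  proof (rule act_eqI)
    have C: "x \<in> C" "y \<in> C" "x\<^sup>\<star> \<in> C" "y\<^sup>\<star> \<in> C" "\<gamma> x \<in> C" "\<gamma> y \<in> C"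
      using x y by (auto intro!: RiC g_in subalg_star[OF RC])
    show "\<gamma> (x + y) \<in> C" "\<gamma> x + \<gamma> y \<in> C" using C by (auto intro: up.A_intros(2) \<gamma>_in)
    show "act (\<gamma> (x + y)) a = act (\<gamma> x + \<gamma> y) a" if a: "a \<in> A" for a
      using x y a C by (simp add: act_\<gamma> subalg_add[OF RC] star_add act_add A_intros)
  qed
  have g_scale: "\<gamma> (z *\<^sub>C x) = z *\<^sub>C \<gamma> x" if x: "x \<in> ?R" for x z
  proof (rule act_eqI)
    have C: "x \<in> C" "x\<^sup>\<star> \<in> C" "\<gamma> x \<in> C"
      using x by (auto intro!: RiC g_in subalg_star[OF RC])
    show "\<gamma> (z *\<^sub>C x) \<in> C" "z *\<^sub>C \<gamma> x \<in> C" using C by (auto intro: up.A_intros(4) \<gamma>_in)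
    show "act (\<gamma> (z *\<^sub>C x)) a = act (z *\<^sub>C \<gamma> x) a" if a: "a \<in> A" for a
      using x a C by (simp add: act_\<gamma> subalg_scaleC[OF RC] star_scaleC act_scaleC A_intros)
  qed
  have g_star: "\<gamma> (x\<^sup>\<star>) = (\<gamma> x)\<^sup>\<star>" if x: "x \<in> ?R" for x
  proof (rule act_eqI)
    have R: "x\<^sup>\<star> \<in> ?R" "\<gamma> x \<in> ?R" using x by (auto intro: g_in subalg_star[OF RC])
    have C: "x \<in> C" "x\<^sup>\<star> \<in> C" "\<gamma> x \<in> C" "(\<gamma> x)\<^sup>\<star> \<in> C" "\<gamma> (x\<^sup>\<star>) \<in> C"
      using x R by (auto intro!: RiC g_in subalg_star[OF RC])
    show "\<gamma> (x\<^sup>\<star>) \<in> C" "(\<gamma> x)\<^sup>\<star> \<in> C" by fact+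
    fix a assume a: "a \<in> A"
    have as: "a\<^sup>\<star> \<in> A" using a by (intro A_intros)
    have "act (\<gamma> (x\<^sup>\<star>)) a = (act x (a\<^sup>\<star>))\<^sup>\<star>" using R a by (simp add: act_\<gamma> star_star)
    also have "\<dots> = act ((\<gamma> x)\<^sup>\<star>) a"
    proof (rule nondegenerate_eq)
      show "(act x (a\<^sup>\<star>))\<^sup>\<star> \<in> A" "act ((\<gamma> x)\<^sup>\<star>) a \<in> A" using C as a by (auto intro!: A_intros(5) act_in)
      fix y assume y: "y \<in> A"
      have ys: "y\<^sup>\<star> \<in> A" using y by (intro A_intros)
      have eC: "y * e * a \<in> C" using y a e_in up.B_in_A by (simp add: up.A_intros)
      have "E (y * act ((\<gamma> x)\<^sup>\<star>) a) = E ((act (\<gamma> x) (y\<^sup>\<star>))\<^sup>\<star> * a)"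
        using act_adjoint[OF C(3) a ys] by (simp add: star_star)
      also have "(act (\<gamma> x) (y\<^sup>\<star>))\<^sup>\<star> * a = act (x\<^sup>\<star>) y * a"
        using x ys by (simp add: act_\<gamma> star_star)
      also have "\<dots> = c *\<^sub>R E1 (x\<^sup>\<star> * (y * e * a))"
        using y a C e_in up.B_in_A by (simp add: act_def up.E_right[symmetric] up.A_intros mult.assoc)
      also have "E \<dots> = c *\<^sub>R (E \<circ> E1) (x\<^sup>\<star> * (y * e * a))"
        using eC C by (simp add: E_scaleR up.E_in up.A_intros)
      also have "(E \<circ> E1) (x\<^sup>\<star> * (y * e * a)) = (E \<circ> E1) ((y * e * a) * x\<^sup>\<star>)"
        by (rule comp.tracial[OF R(1) eC])
      also have "c *\<^sub>R (E \<circ> E1) ((y * e * a) * x\<^sup>\<star>) = E (y * (c *\<^sub>R E1 (e * a * x\<^sup>\<star>)))"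
        using y a C e_in up.B_in_A by (simp add: up.E_left[symmetric] up.A_intros mult.assoc E_scaleR[symmetric] A_intros up.E_in)
      also have "c *\<^sub>R E1 (e * a * x\<^sup>\<star>) = (act x (a\<^sup>\<star>))\<^sup>\<star>"
        using C a e_in up.B_in_A up.E_star[of "x * a\<^sup>\<star> * e"]
        by (simp add: act_def up.A_intros star_simps e_star mult.assoc)
      finally show "E (y * (act x (a\<^sup>\<star>))\<^sup>\<star>) = E (y * act ((\<gamma> x)\<^sup>\<star>) a)" by simp
    qed
    finally show "act (\<gamma> (x\<^sup>\<star>)) a = act ((\<gamma> x)\<^sup>\<star>) a" .
  qed
  have g_g: "\<gamma> (\<gamma> x) = x" if x: "x \<in> ?R" for x
  proof (rule act_eqI)
    have R: "\<gamma> x \<in> ?R" "x\<^sup>\<star> \<in> ?R" using x by (auto intro: g_in subalg_star[OF RC])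
    show "\<gamma> (\<gamma> x) \<in> C" "x \<in> C" using R x by (auto intro: RiC g_in)
    show "act (\<gamma> (\<gamma> x)) a = act x a" if a: "a \<in> A" for a
      using R x a by (simp add: act_\<gamma> g_star[symmetric] A_intros star_star)
  qed
  have "bij_betw \<gamma> ?R ?R"
    by (rule bij_betwI[of _ _ _ \<gamma>]) (auto intro: g_in g_g)
  thus ?thesis unfolding star_anti_automorphism_def using g_add g_scale g_mult g_star by blast
qed

end

section \<open>The Fourier transform\<close>

context two_steps
begin

text \<open>
  Compare both sides after multiplication by \<open>m\<^sub>j f\<close>: by \<open>up2.e_compress\<close> the left side becomes
  \<open>e E1 (e m\<^sub>j) f\<close>, and \<open>push_eq'\<close> turns this into the right side.
\<close>
lemma efe: "e * f * e = (1/c) *\<^sub>R e"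
proof -
  have fm: "e * f * e * m j * f = ((1/c) *\<^sub>R e) * m j * f" if j: "j \<in> J" for j
  proof -
    have mC: "m j \<in> C" using up2.l_in[OF j] .
    have "e * f * e * m j * f = e * (f * (e * m j) * f)" by (simp add: mult.assoc)
    also have "f * (e * m j) * f = E1 (e * m j) * f" using mC e_in by (intro up2.e_compress up.A_intros)
    also have "e * (E1 (e * m j) * f) = (1/c) *\<^sub>R (c *\<^sub>R (e * E1 (e * m j))) * f" using c_pos by (simp add: mult.assoc)
    also have "c *\<^sub>R (e * E1 (e * m j)) = e * m j" by (rule push_eq'[OF mC, symmetric])
    finally show ?thesis by simp
  qed
  have "e * f * e = (\<Sum>j\<in>J. (e * f * e * m j * f) * (m j)\<^sup>\<star>)" by (rule up2.expand)
  also have "\<dots> = (\<Sum>j\<in>J. (((1/c) *\<^sub>R e) * m j * f) * (m j)\<^sup>\<star>)" by (intro sum.cong refl) (simp only: fm)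
  also have "\<dots> = (1/c) *\<^sub>R e" by (rule up2.expand[symmetric])
  finally show ?thesis .
qed

lemma fef: "f * e * f = (1/c) *\<^sub>R f"
  using up2.e_compress[OF e_in] E1_e[of 1 1] by (simp add: A_intros)

lemma markov_comp_up2: "markov D B ((E \<circ> E1) \<circ> E2) (J \<times> (J \<times> I)) (\<lambda>(k, p). (sqrt c *\<^sub>R (m k * f)) * (case p of (j, i) \<Rightarrow> m j * l i)) (c * (c * c))"
  by (rule markov_comp[OF markov_comp_up up2.dual_markov])

lemma AD: "A \<subseteq> D" using up.B_in_A up2.up.B_in_A by blast

lemma commutant_algebras:
  "cstar_subalgebra (rel_commutant B D)" "cstar_subalgebra (rel_commutant A D)"
  "rel_commutant A D \<subseteq> rel_commutant B D"
proof -
  show "cstar_subalgebra (rel_commutant B D)"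
    by (rule cstar_subalgebra_rel_commutant[OF up2.up.A B_intros(5)])
  show "cstar_subalgebra (rel_commutant A D)"
    by (rule cstar_subalgebra_rel_commutant[OF up2.up.A A_intros(5)])
  show "rel_commutant A D \<subseteq> rel_commutant B D" using BA by (auto simp: rel_commutant_def)
qed

text \<open>
  Elements commuting with \<open>A\<close> commute with the \<open>l i\<close> and can be pulled out of \<open>Phi\<close>.
\<close>
lemma commutant_expectation: "expectation (rel_commutant B D) (rel_commutant A D) (\<lambda>x. (1/c) *\<^sub>R Phi x)"
proof
  note RC = commutant_algebras
  show "cstar_subalgebra (rel_commutant B D)" "cstar_subalgebra (rel_commutant A D)"
    "rel_commutant A D \<subseteq> rel_commutant B D" by (rule RC)+
  have comm: "l i * y = y * l i" if "i \<in> I" "y \<in> rel_commutant A D" for i y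
    using rel_commutant_comm[OF that(2) l_in[OF that(1)]] .
  have comm': "y * (l i)\<^sup>\<star> = (l i)\<^sup>\<star> * y" if "i \<in> I" "y \<in> rel_commutant A D" for i y
    using rel_commutant_comm[OF that(2), of "(l i)\<^sup>\<star>"] l_in[OF that(1)] by (simp add: A_intros)
  have bimod: "Phi (a * x * b) = a * Phi x * b" if "a \<in> rel_commutant A D" "b \<in> rel_commutant A D" for a b x
    unfolding Phi_def sum_distrib_left sum_distrib_right
  proof (intro sum.cong refl)
    fix i assume i: "i \<in> I"
    show "l i * (a * x * b) * (l i)\<^sup>\<star> = a * (l i * x * (l i)\<^sup>\<star>) * b"
      using comm[OF i that(1)] comm'[OF i that(2)] by (metis mult.assoc)
  qed
  show "(1/c) *\<^sub>R Phi b = b" if b: "b \<in> rel_commutant A D" for b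
  proof -
    have "Phi (b * 1 * 1) = b * Phi 1 * 1" by (rule bimod[OF b subalg_one[OF RC(2)]])
    thus ?thesis using c_pos by (simp add: index)
  qed
  fix x assume x: "x \<in> rel_commutant B D"
  show "(1/c) *\<^sub>R Phi x \<in> rel_commutant A D"
    using Phi_in[OF up2.up.A AD x] by (rule subalg_scaleR[OF RC(2)])
  show "(1/c) *\<^sub>R Phi (x + y) = (1/c) *\<^sub>R Phi x + (1/c) *\<^sub>R Phi y" for y by (simp add: Phi_add scaleR_add_right)
  show "(1/c) *\<^sub>R Phi (z *\<^sub>C x) = z *\<^sub>C (1/c) *\<^sub>R Phi x" for z by (simp add: Phi_scaleC scaleC_scaleR)
  show "pos ((1/c) *\<^sub>R Phi (x\<^sup>\<star> * x))" using c_pos by (intro pos_scaleR Phi_pos) auto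
  show "(1/c) *\<^sub>R Phi (a * x * b) = a * ((1/c) *\<^sub>R Phi x) * b"
    if "a \<in> rel_commutant A D" "b \<in> rel_commutant A D" for a b
    using bimod[OF that] by simp
qed

text \<open>
  The expectations \<open>E1\<close> and \<open>E2\<close> can be carried under the sum since the \<open>l i\<close> lie in \<open>A\<close>; this reduces
  the claim to \<open>Phi = c E\<close> on \<open>B' \<inter> A\<close>.
\<close>
lemma trace_Phi:
  assumes x: "x \<in> rel_commutant B D"
  shows "E (E1 (E2 ((1/c) *\<^sub>R Phi x))) = E (E1 (E2 x))"
proof -
  have xD: "x \<in> D" using rel_commutant_mem[OF x] .
  have lC: "l i \<in> C" "l i \<in> D" if "i \<in> I" for i using up.B_in_A[OF l_in[OF that]] up2.up.B_in_A by auto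
  have PD: "l i * x * (l i)\<^sup>\<star> \<in> D" if "i \<in> I" for i
    by (intro up2.up.A_intros(3) up2.up.A_intros(5) lC that xD)
  have x2: "E2 x \<in> C" by (intro up2.up.E_in xD)
  have P2: "l i * E2 x * (l i)\<^sup>\<star> \<in> C" if "i \<in> I" for i
    by (intro up.A_intros(3) up.A_intros(5) lC that x2)
  have "E2 (Phi x) = (\<Sum>i\<in>I. E2 (l i * x * (l i)\<^sup>\<star>))" unfolding Phi_def by (intro up2.up.E_sum PD)
  also have "\<dots> = (\<Sum>i\<in>I. l i * E2 x * (l i)\<^sup>\<star>)"
    by (intro sum.cong refl up2.up.E_bimod up.A_intros(5) lC xD)
  finally have 2: "E2 (Phi x) = Phi (E2 x)" by (simp add: Phi_def)
  have "E1 (Phi (E2 x)) = (\<Sum>i\<in>I. E1 (l i * E2 x * (l i)\<^sup>\<star>))" unfolding Phi_def by (intro up.E_sum P2)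
  also have "\<dots> = (\<Sum>i\<in>I. l i * E1 (E2 x) * (l i)\<^sup>\<star>)"
    by (intro sum.cong refl up.E_bimod A_intros(5) l_in x2)
  finally have 1: "E1 (Phi (E2 x)) = Phi (E1 (E2 x))" by (simp add: Phi_def)
  have y: "E1 (E2 x) \<in> A" by (intro up.E_in x2)
  have "E1 (E2 x) \<in> rel_commutant B A"
  proof (rule rel_commutantI[OF y])
    fix b assume b: "b \<in> B"
    have bA: "b \<in> A" "b \<in> C" using B_in_A[OF b] up.B_in_A by auto
    have "E1 (E2 (b * x)) = E1 (E2 (x * b))" using rel_commutant_comm[OF x b] by simp
    thus "b * E1 (E2 x) = E1 (E2 x) * b"
      using bA xD x2 by (simp add: up2.up.E_left up2.up.E_right up.E_left up.E_right)
  qed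
  hence "Phi (E1 (E2 x)) = c *\<^sub>R E (E1 (E2 x))" by (rule Phi_eq)
  moreover have PhiD: "Phi x \<in> D" unfolding Phi_def by (intro up2.up.A_intros PD)
  hence "E1 (E2 ((1/c) *\<^sub>R Phi x)) = (1/c) *\<^sub>R E1 (E2 (Phi x))"
    by (simp add: up2.up.E_scaleR up.E_scaleR up2.up.E_in)
  ultimately have "E1 (E2 ((1/c) *\<^sub>R Phi x)) = E (E1 (E2 x))" using c_pos by (simp add: 1 2)
  thus ?thesis using y by (simp add: E_fix E_in)
qed

text \<open>
  The difference \<open>d\<close> of the two expectations at \<open>x\<close> commutes with \<open>A\<close>, so by the bimodule
  property the traces of \<open>(G x) d\<^sup>\<star>\<close> and \<open>(1/c) (Phi x) d\<^sup>\<star>\<close> both equal that of \<open>x d\<^sup>\<star>\<close>.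
  Hence \<open>d d\<^sup>\<star>\<close> has trace \<open>0\<close>.
\<close>
lemma commutant_expectation_unique:
  assumes G: "cond_exp (rel_commutant B D) (rel_commutant A D) G"
    and tr: "\<And>x. x \<in> rel_commutant B D \<Longrightarrow> E (E1 (E2 (G x))) = E (E1 (E2 x))"
    and x: "x \<in> rel_commutant B D"
  shows "G x = (1/c) *\<^sub>R Phi x"
proof -
  interpret F: expectation "rel_commutant B D" "rel_commutant A D" "\<lambda>x. (1/c) *\<^sub>R Phi x"
    by (rule commutant_expectation)
  interpret G: expectation "rel_commutant B D" "rel_commutant A D" G
    by (rule expectation_of_cond_exp) (use commutant_algebras G in auto)
  interpret T: markov D B "(E \<circ> E1) \<circ> E2" "J \<times> (J \<times> I)" "\<lambda>(k, p). (sqrt c *\<^sub>R (m k * f)) * (case p of (j, i) \<Rightarrow> m j * l i)" "c * (c * c)"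
    by (rule markov_comp_up2)
  define d where "d = G x - (1/c) *\<^sub>R Phi x"
  have dA: "d \<in> rel_commutant A D" unfolding d_def using x by (intro F.B_intros G.E_in F.E_in)
  hence ds: "d\<^sup>\<star> \<in> rel_commutant A D" by (intro F.B_intros)
  have dsB: "d\<^sup>\<star> \<in> rel_commutant B D" using F.B_in_A[OF ds] .
  have Gx: "G x \<in> D" "(1/c) *\<^sub>R Phi x \<in> D" "d\<^sup>\<star> \<in> D" "d \<in> D"
    using rel_commutant_mem F.E_in[OF x] G.E_in[OF x] ds dA by blast+
  have g1: "G x * d\<^sup>\<star> = G (x * d\<^sup>\<star>)" by (rule G.E_right[OF ds x, symmetric])
  have g2: "((1/c) *\<^sub>R Phi x) * d\<^sup>\<star> = (1/c) *\<^sub>R Phi (x * d\<^sup>\<star>)" by (rule F.E_right[OF ds x, symmetric])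
  have xd: "x * d\<^sup>\<star> \<in> rel_commutant B D" using x dsB by (rule F.A_intros(3))
  have eq: "E (E1 (E2 (G x * d\<^sup>\<star>))) = E (E1 (E2 (((1/c) *\<^sub>R Phi x) * d\<^sup>\<star>)))"
    by (simp only: g1 g2 tr[OF xd] trace_Phi[OF xd])
  have "((E \<circ> E1) \<circ> E2) (d * d\<^sup>\<star>) = ((E \<circ> E1) \<circ> E2) (G x * d\<^sup>\<star>) - ((E \<circ> E1) \<circ> E2) (((1/c) *\<^sub>R Phi x) * d\<^sup>\<star>)"
    unfolding T.E_diff[OF T.A_intros(3)[OF Gx(1,3)] T.A_intros(3)[OF Gx(2,3)], symmetric]
    by (simp add: d_def left_diff_distrib)
  hence "((E \<circ> E1) \<circ> E2) ((d\<^sup>\<star>)\<^sup>\<star> * d\<^sup>\<star>) = 0" using eq by (simp add: star_star)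
  hence "d\<^sup>\<star> = 0" by (rule T.faithful[OF Gx(3)])
  hence "(d\<^sup>\<star>)\<^sup>\<star> = 0" by simp
  thus ?thesis by (simp add: d_def star_star)
qed

text \<open>
  The composition of the Fourier transform, the adjoint, the inverse transform and the adjoint,
  without the normalising powers of the index: \<open>f\<close> compresses \<open>x\<^sup>\<star> l\<^sub>i\<^sup>\<star> e\<close> to its image under \<open>E1\<close>.
\<close>
lemma rotation_formula:
  assumes x: "x \<in> rel_commutant B C"
  shows "(E2 (((1/c) *\<^sub>R Phi (x * (f * e)))\<^sup>\<star> * (e * f)))\<^sup>\<star> = (1 / c^3) *\<^sub>R \<gamma> x"
proof -
  have xC: "x \<in> C" using rel_commutant_mem[OF x] .
  have xs: "x\<^sup>\<star> \<in> C" using xC by (intro up.A_intros)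
  have lC: "l i \<in> C" if "i \<in> I" for i using up.B_in_A[OF l_in[OF that]] .
  have xle: "x\<^sup>\<star> * (l i)\<^sup>\<star> * e \<in> C" if "i \<in> I" for i
    by (rule up.A_intros(3)[OF up.A_intros(3)[OF xs up.A_intros(5)[OF lC[OF that]]] e_in])
  have st: "((1/c) *\<^sub>R Phi (x * (f * e)))\<^sup>\<star> = (1/c) *\<^sub>R Phi (e * f * x\<^sup>\<star>)"
    unfolding star_scaleR Phi_star[symmetric] by (simp add: star_mult e_star up2.e_star)
  have "((1/c) *\<^sub>R Phi (x * (f * e)))\<^sup>\<star> * (e * f) = (1/c) *\<^sub>R (\<Sum>i\<in>I. l i * e * (f * (x\<^sup>\<star> * (l i)\<^sup>\<star> * e) * f))"
    unfolding st by (simp add: Phi_def sum_distrib_right mult.assoc)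
  also have "(\<Sum>i\<in>I. l i * e * (f * (x\<^sup>\<star> * (l i)\<^sup>\<star> * e) * f)) = (\<Sum>i\<in>I. (l i * e * E1 (x\<^sup>\<star> * (l i)\<^sup>\<star> * e)) * f)"
  proof (intro sum.cong refl)
    fix i assume "i \<in> I"
    hence "f * (x\<^sup>\<star> * (l i)\<^sup>\<star> * e) * f = E1 (x\<^sup>\<star> * (l i)\<^sup>\<star> * e) * f"
      by (intro up2.e_compress xle)
    thus "l i * e * (f * (x\<^sup>\<star> * (l i)\<^sup>\<star> * e) * f) = (l i * e * E1 (x\<^sup>\<star> * (l i)\<^sup>\<star> * e)) * f" by (simp only: mult.assoc)
  qed
  also have "\<dots> = (\<Sum>i\<in>I. l i * e * E1 (x\<^sup>\<star> * (l i)\<^sup>\<star> * e)) * f" by (simp only: sum_distrib_right)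
  finally have 1: "((1/c) *\<^sub>R Phi (x * (f * e)))\<^sup>\<star> * (e * f) = (1/c) *\<^sub>R ((\<Sum>i\<in>I. l i * e * E1 (x\<^sup>\<star> * (l i)\<^sup>\<star> * e)) * f)" .
  define S where "S = (\<Sum>i\<in>I. l i * e * E1 (x\<^sup>\<star> * (l i)\<^sup>\<star> * e))"
  have E1C: "E1 (x\<^sup>\<star> * (l i)\<^sup>\<star> * e) \<in> C" if "i \<in> I" for i
    by (rule up.E_in_A[OF xle[OF that]])
  have SC: "S \<in> C" unfolding S_def using E1C lC e_in by (intro up.A_intros)
  have "E2 (S * f) = (1/c) *\<^sub>R S" using up2.E1_e[of S 1] SC by (simp add: up.A_intros)
  moreover have "S * f \<in> D" using up2.up.B_in_A[OF SC] up2.e_in by (intro up2.up.A_intros)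
  ultimately have 2: "E2 ((1/c) *\<^sub>R (S * f)) = (1 / c^2) *\<^sub>R S" by (simp add: up2.up.E_scaleR power2_eq_square)
  have "\<gamma> x = (\<Sum>i\<in>I. (c *\<^sub>R (l i * e * E1 (x\<^sup>\<star> * (l i)\<^sup>\<star> * e)))\<^sup>\<star>)"
    by (simp add: \<gamma>_def act_def star_mult e_star mult.assoc)
  also have "\<dots> = c *\<^sub>R S\<^sup>\<star>" by (simp add: S_def star_sum scaleR_sum_right)
  finally have 3: "\<gamma> x = c *\<^sub>R S\<^sup>\<star>" .
  show ?thesis unfolding 1 S_def[symmetric] 2 3 using c_pos by (simp add: power2_eq_square power3_eq_cube)
qed

text \<open>
  First \<open>z f g = y g\<close> with \<open>y\<close> in \<open>D\<close>, and since \<open>e\<close> and \<open>g\<close> commute, \<open>z f e g f = y e g f\<close>.  To bring back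
  the missing \<open>f\<close>, expand \<open>y\<close> over \<open>C f C\<close>; the right-hand factors, multiplied by \<open>e\<close>, are pushed
  into \<open>A\<close>, and \<open>A\<close> commutes with \<open>f\<close>.
\<close>
lemma double_push:
  assumes "jones D C E2 K n c D' g E3" and z: "z \<in> D'"
  shows "\<exists>a\<in>C. z * (c *\<^sub>R (f * e * g * f)) = a * (c *\<^sub>R (f * e * g * f))"
proof -
  interpret g: jones D C E2 K n c D' g E3 by fact
  have "z * f \<in> D'" by (rule g.up.A_intros(3)[OF z g.up.B_in_A[OF up2.e_in]])
  then obtain y where y: "y \<in> D" "z * f * g = y * g" using g.push by blast
  define p where "p j = up2.act y (m j)" for j
  have p: "p j \<in> C" "y * m j * f = p j * f" if "j \<in> J" for j
    using y(1) up2.l_in[OF that] by (auto simp: p_def up2.act_in up2.act_push)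
  have "\<exists>a\<in>A. (m j)\<^sup>\<star> * e = a * e" if "j \<in> J" for j
    using up2.l_in[OF that] by (intro push up.A_intros)
  then obtain a where a: "\<And>j. j \<in> J \<Longrightarrow> a j \<in> A \<and> (m j)\<^sup>\<star> * e = a j * e" by metis
  have eg: "e * g = g * e" by (rule g.e_comm[OF e_in])
  have "y * e = (\<Sum>j\<in>J. y * m j * f * (m j)\<^sup>\<star>) * e" by (subst up2.expand[of y]) simp
  also have "\<dots> = (\<Sum>j\<in>J. p j * a j * (f * e))"
    unfolding sum_distrib_right
  proof (intro sum.cong refl)
    fix j assume j: "j \<in> J"
    have "y * m j * f * (m j)\<^sup>\<star> * e = p j * f * ((m j)\<^sup>\<star> * e)" using p[OF j] by (simp add: mult.assoc)
    also have "\<dots> = p j * (f * a j) * e" using a[OF j] by (simp add: mult.assoc)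
    also have "f * a j = a j * f" using up2.e_comm[of "a j"] a[OF j] by simp
    finally show "y * m j * f * (m j)\<^sup>\<star> * e = p j * a j * (f * e)" by (simp add: mult.assoc)
  qed
  finally have ye: "y * e = (\<Sum>j\<in>J. p j * a j) * (f * e)" by (simp add: sum_distrib_right)
  have "z * (f * e * g * f) = (z * f * g) * e * f" using eg by (metis mult.assoc)
  also have "\<dots> = y * e * g * f" unfolding y(2) using eg by (metis mult.assoc)
  also have "\<dots> = (\<Sum>j\<in>J. p j * a j) * (f * e * g * f)" unfolding ye by (simp only: mult.assoc)
  finally have "z * (c *\<^sub>R (f * e * g * f)) = (\<Sum>j\<in>J. p j * a j) * (c *\<^sub>R (f * e * g * f))" by simp
  moreover have "p j * a j \<in> C" if "j \<in> J" for j
    using up.A_intros(3)[OF p(1)[OF that] up.B_in_A] a[OF that] by blast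
  hence "(\<Sum>j\<in>J. p j * a j) \<in> C" by (rule up.A_intros(10))
  ultimately show ?thesis by blast
qed

end

section \<open>Composing two basic constructions\<close>

text \<open>
  The basic construction of \<open>B \<subseteq> A\<^sub>1\<close> sits inside the original tower as \<open>A\<^sub>3\<close>.
  Compression and the formula for the dual expectation follow from the Temperley--Lieb relations, and \<open>double_push\<close> gives the pushing property.  For the
  unit, resolve \<open>1 = \<Sum> l\<^sub>i e\<^sub>1 l\<^sub>i\<^sup>\<star>\<close>, replace \<open>e\<^sub>1\<close> by \<open>c e\<^sub>1 e\<^sub>2 e\<^sub>1\<close> and \<open>e\<^sub>2\<close> by \<open>c e\<^sub>2 e\<^sub>3 e\<^sub>2\<close>, and insert
  the same resolution once more between \<open>e\<^sub>2\<close> and \<open>e\<^sub>3\<close>.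
\<close>
theorem jones_two_step:
  assumes j1: "jones A0 B E0 I l c A1 e1 E1" and j2: "jones A1 A0 E1 J m c A2 e2 E2"
    and j3: "jones A2 A1 E2 K n c A3 e3 E3"
  shows "jones A1 B (E0 \<circ> E1) (J \<times> I) (\<lambda>(j, i). m j * l i) (c * c) A3 (c *\<^sub>R (e2 * e1 * e3 * e2)) (E2 \<circ> E3)"
proof -
  interpret a: two_steps A0 B E0 I l c A1 e1 E1 J m A2 e2 E2 by (intro two_steps.intro j1 j2)
  interpret b: two_steps A1 A0 E1 J m c A2 e2 E2 K n A3 e3 E3 by (intro two_steps.intro j2 j3)
  interpret M: markov A1 B "E0 \<circ> E1" "J \<times> I" "\<lambda>(j, i). m j * l i" "c * c" by (rule a.markov_comp_up)
  interpret up: markov A3 A1 "E2 \<circ> E3" "K \<times> K" "\<lambda>(j, i). sqrt c *\<^sub>R (n j * e3) * n i" "c * c"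
    by (rule markov_comp[OF b.up2.markov_axioms b.up2.dual_markov])
  let ?p = "e2 * e1 * e3 * e2"
  have c: "c > 0" by (rule a.c_pos)
  have mem: "e1 \<in> A1" "e1 \<in> A3" "e2 \<in> A2" "e2 \<in> A3" "e3 \<in> A3"
    using a.e_in a.up2.e_in b.up2.e_in up.B_in_A b.up2.up.B_in_A by auto
  have 13: "e1 * e3 = e3 * e1" by (rule b.up2.e_comm[OF mem(1)])
  have p_in: "?p \<in> A3" using mem by (simp add: up.A_intros)
  show ?thesis
  proof
    show "c *\<^sub>R ?p \<in> A3" using p_in by (rule up.A_intros)
    show "(c *\<^sub>R ?p)\<^sup>\<star> = c *\<^sub>R ?p" using 13
      by (simp add: star_mult a.e_star a.up2.e_star b.up2.e_star) (metis mult.assoc)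
    fix x assume x: "x \<in> A1"
    have y: "E1 x \<in> A0" "E1 x \<in> A1" "E1 x * e1 \<in> A1" using x by (auto intro: a.up.E_in a.up.E_in_A a.up.A_intros(3) mem)
    have "?p * x * ?p = e2 * e1 * e3 * (e2 * x * e2) * e1 * e3 * e2" by (simp add: mult.assoc)
    also have "\<dots> = e2 * e1 * e3 * E1 x * (e2 * e1 * e3 * e2)" unfolding a.up2.e_compress[OF x] by (simp add: mult.assoc)
    also have "\<dots> = e2 * e1 * (e3 * E1 x) * (e2 * e1 * e3 * e2)" by (simp only: mult.assoc)
    also have "e3 * E1 x = E1 x * e3" by (rule b.up2.e_comm[OF y(2), symmetric])
    also have "e2 * e1 * (E1 x * e3) * (e2 * e1 * e3 * e2) = e2 * e1 * E1 x * (e3 * e2 * (e1 * e3)) * e2" by (simp only: mult.assoc)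
    also have "\<dots> = e2 * e1 * E1 x * (e3 * e2 * e3) * e1 * e2" unfolding 13 by (simp only: mult.assoc)
    also have "e3 * e2 * e3 = (1/c) *\<^sub>R e3" by (rule b.fef)
    also have "e2 * e1 * E1 x * ((1/c) *\<^sub>R e3) * e1 * e2 = (1/c) *\<^sub>R (e2 * e1 * E1 x * (e3 * e1) * e2)" by (simp add: mult.assoc)
    also have "\<dots> = (1/c) *\<^sub>R (e2 * (e1 * E1 x * e1) * e3 * e2)" unfolding 13[symmetric] by (simp only: mult.assoc)
    also have "e1 * E1 x * e1 = E0 (E1 x) * e1" by (rule a.e_compress[OF y(1)])
    also have "(1/c) *\<^sub>R (e2 * (E0 (E1 x) * e1) * e3 * e2) = (1/c) *\<^sub>R ((e2 * E0 (E1 x)) * e1 * e3 * e2)" by (simp only: mult.assoc)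
    also have "e2 * E0 (E1 x) = E0 (E1 x) * e2" by (rule a.up2.e_comm[OF a.E_in_A[OF y(1)], symmetric])
    finally have "?p * x * ?p = (1/c) *\<^sub>R (E0 (E1 x) * ?p)" by (simp only: mult.assoc)
    thus "c *\<^sub>R ?p * x * (c *\<^sub>R ?p) = (E0 \<circ> E1) x * (c *\<^sub>R ?p)" using c by simp
  next
    have "E3 ?p = (1/c) *\<^sub>R (e2 * e1 * e2)"
      using mem a.up2.up.B_in_A a.up2.up.A_intros(3) by (intro b.up2.E1_e) auto
    hence 1: "E3 ?p = (1/(c*c)) *\<^sub>R e2" unfolding a.fef by simp
    have "E2 e2 = (1/c) *\<^sub>R 1" using a.up2.E1_e[of 1 1] by (simp add: a.up.A_intros)
    hence 2: "(E2 \<circ> E3) (c *\<^sub>R ?p) = (1/(c*c)) *\<^sub>R 1"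
      using p_in mem c by (simp add: b.up2.up.E_scaleR 1 a.up2.up.E_scaleR)
    fix x y assume xy: "x \<in> A1" "y \<in> A1"
    show "(E2 \<circ> E3) (x * (c *\<^sub>R ?p) * y) = (1 / (c * c)) *\<^sub>R (x * y)"
      using up.E_bimod[OF xy up.A_intros(6)[OF p_in], of c] unfolding 2 by simp
  next
    fix z assume "z \<in> A3"
    thus "\<exists>a\<in>A1. z * (c *\<^sub>R ?p) = a * (c *\<^sub>R ?p)" by (rule a.double_push[OF j3])
  next
    let ?S = "{a * (c *\<^sub>R ?p) * b |a b. a \<in> A1 \<and> b \<in> A1}"
    have e232: "e2 * e3 * e2 = (1/c) *\<^sub>R e2" by (rule b.efe)
    have e121: "e1 * e2 * e1 = (1/c) *\<^sub>R e1" by (rule a.efe)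
    have lA: "l i \<in> A1" "l i \<in> A0" if "i \<in> I" for i using a.up.B_in_A[OF a.l_in[OF that]] a.l_in[OF that] by auto
    have e2: "e2 = c *\<^sub>R (\<Sum>j\<in>I. l j * ?p * (l j)\<^sup>\<star>)"
    proof -
      have "e2 * e3 * e2 = e2 * (\<Sum>j\<in>I. l j * e1 * (l j)\<^sup>\<star>) * e3 * e2" by (simp add: a.resolution)
      also have "\<dots> = (\<Sum>j\<in>I. l j * ?p * (l j)\<^sup>\<star>)"
        unfolding sum_distrib_left sum_distrib_right
      proof (intro sum.cong refl)
        fix j assume j: "j \<in> I"
        have 1: "e2 * l j = l j * e2" by (rule a.up2.e_comm[OF lA(2)[OF j], symmetric])
        have 2: "(l j)\<^sup>\<star> * e2 = e2 * (l j)\<^sup>\<star>" by (rule a.up2.e_comm[OF a.A_intros(5)[OF lA(2)[OF j]]])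
        have 3: "(l j)\<^sup>\<star> * e3 = e3 * (l j)\<^sup>\<star>" by (rule b.up2.e_comm[OF a.up.A_intros(5)[OF lA(1)[OF j]]])
        have "e2 * (l j * e1 * (l j)\<^sup>\<star>) * e3 * e2 = (e2 * l j) * e1 * ((l j)\<^sup>\<star> * e3) * e2" by (simp only: mult.assoc)
        also have "\<dots> = l j * e2 * e1 * e3 * ((l j)\<^sup>\<star> * e2)" unfolding 1 3 by (simp only: mult.assoc)
        also have "\<dots> = l j * ?p * (l j)\<^sup>\<star>" unfolding 2 by (simp only: mult.assoc)
        finally show "e2 * (l j * e1 * (l j)\<^sup>\<star>) * e3 * e2 = l j * ?p * (l j)\<^sup>\<star>" .
      qed
      finally have "c *\<^sub>R (1/c) *\<^sub>R e2 = c *\<^sub>R (\<Sum>j\<in>I. l j * ?p * (l j)\<^sup>\<star>)" unfolding e232 by (simp only:)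
      thus ?thesis using c by simp
    qed
    have "(\<Sum>i\<in>I. \<Sum>j\<in>I. (c *\<^sub>R (l i * e1 * l j)) * (c *\<^sub>R ?p) * ((l j)\<^sup>\<star> * e1 * (l i)\<^sup>\<star>))
       = (\<Sum>i\<in>I. c *\<^sub>R (l i * e1 * (c *\<^sub>R (\<Sum>j\<in>I. l j * ?p * (l j)\<^sup>\<star>)) * e1 * (l i)\<^sup>\<star>))"
      by (simp add: sum_distrib_left sum_distrib_right scaleR_sum_right mult.assoc)
    also have "\<dots> = (\<Sum>i\<in>I. l i * (c *\<^sub>R (e1 * e2 * e1)) * (l i)\<^sup>\<star>)"
      unfolding e2[symmetric] by (simp add: mult.assoc)
    also have "\<dots> = 1" unfolding e121 using c by (simp add: a.resolution)
    finally have 1: "1 = (\<Sum>i\<in>I. \<Sum>j\<in>I. (c *\<^sub>R (l i * e1 * l j)) * (c *\<^sub>R ?p) * ((l j)\<^sup>\<star> * e1 * (l i)\<^sup>\<star>))" ..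
    show "1 \<in> span ?S"
      unfolding 1
    proof (intro span_sum)
      fix i j assume ij: "i \<in> I" "j \<in> I"
      have "c *\<^sub>R (l i * e1 * l j) \<in> A1" "(l j)\<^sup>\<star> * e1 * (l i)\<^sup>\<star> \<in> A1"
        using lA ij mem by (auto simp: a.up.A_intros)
      thus "(c *\<^sub>R (l i * e1 * l j)) * (c *\<^sub>R ?p) * ((l j)\<^sup>\<star> * e1 * (l i)\<^sup>\<star>) \<in> span ?S"
        by (intro span_base) blast
    qed
  qed
qed

section \<open>The rotation of an abstract tower\<close>

lemma star_anti_automorphism_cong:
  assumes S: "cstar_subalgebra S" and eq: "\<And>x. x \<in> S \<Longrightarrow> f x = g x"
    and g: "star_anti_automorphism S g"
  shows "star_anti_automorphism S f"
proof -
  have "bij_betw f S S = bij_betw g S S" by (rule bij_betw_cong) (rule eq)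
  thus ?thesis using g eq S unfolding star_anti_automorphism_def
    by (simp add: subalg_intros)
qed

text \<open>
  The expectation in the definition of the Fourier transform is chosen by \<open>SOME\<close>; existence and
  uniqueness identify it on \<open>B' \<inter> A 2\<close>, and the powers of the index cancel against those in
  \<open>rotation_formula\<close>.
\<close>
theorem rotation_star_anti_automorphism:
  fixes A :: "nat \<Rightarrow> 'a::cstar_algebra set"
  assumes two: "two_steps (A 0) B (E 0) I l c (A 1) (e 1) (E 1) J m (A 2) (e 2) (E 2)"
    and tau: "tau A E = 1 / c"
  shows "star_anti_automorphism (rel_commutant B (A 1)) (rotation B A E e 1)"
proof -
  interpret t: two_steps "A 0" B "E 0" I l c "A 1" "e 1" "E 1" J m "A 2" "e 2" "E 2" by (rule two)
  let ?R = "rel_commutant B (A 2)"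
  have tr: "trace_upto E 2 x = E 0 (E 1 (E 2 x))" for x by (simp add: numeral_2_eq_2)
  let ?P = "\<lambda>F. cond_exp ?R (rel_commutant (A 0) (A 2)) F \<and> (\<forall>x\<in>?R. trace_upto E 2 (F x) = trace_upto E 2 x)"
  have "?P (\<lambda>x. (1/c) *\<^sub>R t.Phi x)"
    using expectation.cond_exp[OF t.commutant_expectation] t.trace_Phi by (simp add: tr)
  hence "?P (commutant_exp B A E 2)" unfolding commutant_exp_def by (rule someI[where P = ?P])
  hence ce: "commutant_exp B A E 2 x = (1/c) *\<^sub>R t.Phi x" if "x \<in> ?R" for x
    using that by (intro t.commutant_expectation_unique) (auto simp: tr)
  have "rotation B A E e 1 x = t.\<gamma> x" if x: "x \<in> rel_commutant B (A 1)" for x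
  proof -
    have xC: "x \<in> A 1" using rel_commutant_mem[OF x] .
    have mem: "x \<in> A 2" "e 1 \<in> A 2" "e 2 \<in> A 2" using xC t.e_in t.up2.up.B_in_A t.up2.e_in by auto
    have x2: "x * (e 2 * e 1) \<in> ?R"
    proof (rule rel_commutantI)
      show "x * (e 2 * e 1) \<in> A 2" using mem by (intro t.up2.up.A_intros)
      fix b assume b: "b \<in> B"
      have "b * (x * (e 2 * e 1)) = x * (b * e 2) * e 1" using rel_commutant_comm[OF x b] by (metis mult.assoc)
      also have "\<dots> = x * e 2 * (b * e 1)" using t.up2.e_comm[OF t.B_in_A[OF b]] by (simp add: mult.assoc)
      also have "\<dots> = x * (e 2 * e 1) * b" using t.e_comm[OF b] by (simp add: mult.assoc)
      finally show "b * (x * (e 2 * e 1)) = x * (e 2 * e 1) * b" .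
    qed
    let ?T = "tau A E powr (- ((real 1 + 2) / 2))"
    have "?T * ?T = (1/c) powr (-3)" unfolding tau by (simp flip: powr_add)
    also have "\<dots> = c ^ 3" using t.c_pos by (simp add: powr_minus powr_numeral inverse_eq_divide field_simps)
    finally have TT: "?T * ?T = c ^ 3" .
    have F: "fourier B A E e 1 x = ?T *\<^sub>R (1/c) *\<^sub>R t.Phi (x * (e 2 * e 1))"
      using ce[OF x2] by (simp add: fourier_def numeral_2_eq_2)
    have PhiD: "t.Phi (x * (e 2 * e 1)) \<in> A 2"
      using t.Phi_in[OF t.up2.up.A t.AD x2] rel_commutant_mem by blast
    let ?y = "((1/c) *\<^sub>R t.Phi (x * (e 2 * e 1)))\<^sup>\<star> * (e 1 * e 2)"
    have y: "?y \<in> A 2" using PhiD mem by (intro t.up2.up.A_intros)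
    have "rotation B A E e 1 x = (?T *\<^sub>R E 2 (?T *\<^sub>R ?y))\<^sup>\<star>"
      unfolding rotation_def inv_fourier_def F by (simp add: numeral_2_eq_2)
    also have "\<dots> = (?T * ?T) *\<^sub>R (E 2 ?y)\<^sup>\<star>" unfolding t.up2.up.E_scaleR[OF y] by simp
    also have "\<dots> = t.\<gamma> x" unfolding TT t.rotation_formula[OF x] using t.c_pos by simp
    finally show ?thesis .
  qed
  moreover have "cstar_subalgebra (rel_commutant B (A 1))"
    by (rule cstar_subalgebra_rel_commutant[OF t.up.A t.B_intros(5)])
  ultimately show ?thesis
    using t.\<gamma>_anti_automorphism star_anti_automorphism_cong[of "rel_commutant B (A 1)" "rotation B A E e 1" t.\<gamma>]
    by blast
qed

section \<open>Minimality of the index\<close>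

context framed
begin

text \<open>
  Expanding the second quasi-basis in the first one.
\<close>
lemma index_independent:
  assumes "framed A B E J m"
  shows "(\<Sum>j\<in>J. m j * (m j)\<^sup>\<star>) = (\<Sum>i\<in>I. l i * (l i)\<^sup>\<star>)"
proof -
  interpret J: framed A B E J m by fact
  have "(\<Sum>j\<in>J. m j * (m j)\<^sup>\<star>) = (\<Sum>j\<in>J. (\<Sum>i\<in>I. l i * E ((l i)\<^sup>\<star> * m j)) * (m j)\<^sup>\<star>)"
    by (intro sum.cong refl) (simp add: frame J.l_in)
  also have "\<dots> = (\<Sum>i\<in>I. l i * (\<Sum>j\<in>J. E ((l i)\<^sup>\<star> * m j) * (m j)\<^sup>\<star>))"
    unfolding sum_distrib_right sum_distrib_left by (subst sum.swap) (simp add: mult.assoc)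
  also have "\<dots> = (\<Sum>i\<in>I. l i * (l i)\<^sup>\<star>)"
    by (intro sum.cong refl) (simp add: J.frame' l_in A_intros)
  finally show ?thesis .
qed

lemma framed_of_quasi_basis: "quasi_basis A E n m \<Longrightarrow> framed A B E {..<n} m"
  by unfold_locales (auto simp: quasi_basis_def)

lemma ex_quasi_basis: "\<exists>n m. quasi_basis A E n m"
proof -
  obtain h where h: "bij_betw h {0..<card I} I" using ex_bij_betw_nat_finite[OF fin] by blast
  have re: "(\<Sum>i<card I. f (h i)) = (\<Sum>i\<in>I. f i)" for f :: "'i \<Rightarrow> 'a"
    using sum.reindex_bij_betw[OF h, of f] by (simp add: atLeast0LessThan)
  have hI: "h i \<in> I" if "i < card I" for i using bij_betwE[OF h] that by simp
  have "quasi_basis A E (card I) (l \<circ> h)"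
    unfolding quasi_basis_def
  proof (intro conjI allI impI ballI)
    fix x assume x: "x \<in> A"
    show "x = (\<Sum>i<card I. (l \<circ> h) i * E (((l \<circ> h) i)\<^sup>\<star> * x))"
      using re[of "\<lambda>i. l i * E ((l i)\<^sup>\<star> * x)"] frame[OF x] by simp
    show "x = (\<Sum>i<card I. E (x * (l \<circ> h) i) * ((l \<circ> h) i)\<^sup>\<star>)"
      using re[of "\<lambda>i. E (x * l i) * (l i)\<^sup>\<star>"] frame'[OF x] by simp
  qed (simp add: l_in hI)
  thus ?thesis by blast
qed

lemma Ind_eq: "Ind A E = Phi 1"
  unfolding Ind_def
proof (rule the_equality)
  have *: "(\<Sum>i<n. m i * (m i)\<^sup>\<star>) = Phi 1" if "quasi_basis A E n m" for n m
    using index_independent[OF framed_of_quasi_basis[OF that]] by (simp add: Phi_def)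
  show "\<exists>n m. quasi_basis A E n m \<and> Phi 1 = (\<Sum>i<n. m i * (m i)\<^sup>\<star>)"
    using ex_quasi_basis * by metis
  show "s = Phi 1" if "\<exists>n m. quasi_basis A E n m \<and> s = (\<Sum>i<n. m i * (m i)\<^sup>\<star>)" for s
    using that * by blast
qed

lemma scalar_index_eq: "Phi 1 = c *\<^sub>R 1 \<Longrightarrow> scalar_index A E = c"
  unfolding scalar_index_def Ind_eq by (rule the_equality) auto

end

text \<open>
  The Neumann series, summed inside \<open>S\<close>.
\<close>
lemma inverse_one_plus:
  fixes y :: "'a::cstar_algebra"
  assumes S: "cstar_subalgebra S" "y \<in> S" and sa: "y\<^sup>\<star> = y" and y: "norm y \<le> 1/2"
  obtains v where "v \<in> S" "v\<^sup>\<star> = v" "(1 + y) * v = 1" "v * (1 + y) = 1" "norm v \<le> 2"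
proof -
  define x where "x = - y"
  have xS: "x \<in> S" using S by (simp add: x_def subalg_uminus)
  have sm: "summable (\<lambda>n. x ^ n)" using y by (intro complete_algebra_summable_geometric) (simp add: x_def)
  define v where "v = (\<Sum>n. x ^ n)"
  have v1: "v = 1 + x * v"
    using suminf_split_head[OF sm] suminf_mult[OF sm, of x] by (simp add: v_def)
  have v2: "v = 1 + v * x"
    using suminf_split_head[OF sm] suminf_mult2[OF sm, of x] by (simp add: v_def power_commutes)
  have iv: "(1 + y) * v = 1" "v * (1 + y) = 1" using v1 v2 by (simp_all add: x_def algebra_simps eq_diff_eq)
  show thesis
  proof (rule that)
    have "x ^ n \<in> S" for n by (induction n) (auto simp: S xS subalg_one subalg_mult)
    hence "(\<Sum>n<k. x ^ n) \<in> S" for k by (intro subalg_sum[OF S(1)])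
    thus "v \<in> S" unfolding v_def
      using closed_sequentially[OF subalg_closed[OF S(1)], of "\<lambda>k. \<Sum>n<k. x ^ n"] summable_LIMSEQ[OF sm] by simp
    have "v\<^sup>\<star> * (1 + y) = ((1 + y) * v)\<^sup>\<star>" by (simp add: star_simps sa)
    hence vs: "v\<^sup>\<star> * (1 + y) = 1" by (simp add: iv)
    have "v\<^sup>\<star> = v\<^sup>\<star> * ((1 + y) * v)" by (simp add: iv)
    also have "\<dots> = v" using vs by (simp add: mult.assoc[symmetric])
    finally show "v\<^sup>\<star> = v" .
    show "(1 + y) * v = 1" "v * (1 + y) = 1" by (rule iv)+
    have "norm v \<le> 1 + norm x * norm v"
      using norm_triangle_ineq[of 1 "x * v"] norm_mult_ineq[of x v] v1 by simp
    also have "norm x * norm v \<le> 1/2 * norm v" using y by (intro mult_right_mono) (auto simp: x_def)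
    finally show "norm v \<le> 2" by simp
  qed
qed

text \<open>
  For \<open>a = 1\<close>, \<open>v = 1 / (1 + y)\<close> and \<open>w = v\<^sup>2\<close> the first bracket is \<open>y\<^sup>2 v\<^sup>2\<close> and the second
  is \<open>y\<^sup>3 v\<^sup>2\<close>; the identity is the Taylor formula for \<open>v\<^sup>2\<close> with remainder \<open>(3 y\<^sup>2 + 2 y\<^sup>3) v\<^sup>2\<close>.
\<close>
lemma inverse_square_remainder:
  fixes a v w y :: "'a::real_vector"
  shows "3 *\<^sub>R ((a - v) - (v - w)) + 2 *\<^sub>R (y - 2 *\<^sub>R (a - v) + (v - w)) = w - a + 2 *\<^sub>R y"
proof -
  have "3 *\<^sub>R x = x + x + x" for x :: 'a using scaleR_left_distrib[of 2 1 x] by (simp add: scaleR_2)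
  thus ?thesis by (simp add: scaleR_2)
qed

lemma first_order_zero:
  fixes D K d :: real
  assumes "d > 0" and "\<And>t. \<bar>t\<bar> \<le> d \<Longrightarrow> 0 \<le> t * D + K * t\<^sup>2"
  shows "D = 0"
proof (rule ccontr)
  assume "D \<noteq> 0"
  define s where "s = min (d / \<bar>D\<bar>) (1 / (2 * (\<bar>K\<bar> + 1)))"
  have s: "s > 0" using assms(1) \<open>D \<noteq> 0\<close> by (simp add: s_def)
  have "s * \<bar>D\<bar> \<le> d" using \<open>D \<noteq> 0\<close> by (simp add: s_def min_def field_simps)
  hence "\<bar>- (s * D)\<bar> \<le> d" using s by (simp add: abs_mult)
  from assms(2)[OF this] have "0 \<le> (s * D\<^sup>2) * (K * s - 1)" by (simp add: power2_eq_square algebra_simps)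
  hence "(s * D\<^sup>2) * 0 \<le> (s * D\<^sup>2) * (K * s - 1)" by simp
  moreover have "0 < s * D\<^sup>2" using s \<open>D \<noteq> 0\<close> by simp
  ultimately have "0 \<le> K * s - 1" by (simp only: mult_le_cancel_left_pos)
  hence "1 \<le> K * s" by simp
  also have "K * s \<le> \<bar>K\<bar> * s" using s by (intro mult_right_mono) auto
  also have "\<dots> \<le> \<bar>K\<bar> * (1 / (2 * (\<bar>K\<bar> + 1)))" by (intro mult_left_mono) (auto simp: s_def)
  also have "\<dots> < 1" by (simp add: field_simps)
  finally show False by simp
qed

context framed
begin

lemma relative_commutant_subalgebra: "cstar_subalgebra (rel_commutant B A)"
  by (rule cstar_subalgebra_rel_commutant[OF A B_intros(5)])

lemma Phi_scalar:
  assumes "simple_cstar A" "x \<in> rel_commutant B A" "x\<^sup>\<star> = x"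
  obtains r :: real where "Phi x = r *\<^sub>R 1"
proof -
  have "Phi x \<in> rel_commutant A A" by (rule Phi_in[OF A order.refl assms(2)])
  moreover have "(Phi x)\<^sup>\<star> = Phi x" using assms(3) by (simp flip: Phi_star)
  ultimately show thesis using simple_centre_scalar[OF assms(1)] that by metis
qed

lemma E_scalar:
  assumes "simple_cstar B" "x \<in> rel_commutant B A" "x\<^sup>\<star> = x"
  obtains r :: real where "E x = r *\<^sub>R 1"
proof -
  have xA: "x \<in> A" using rel_commutant_mem[OF assms(2)] .
  have "E x \<in> rel_commutant B B"
  proof (rule rel_commutantI)
    fix b assume b: "b \<in> B"
    have "E (b * x) = E (x * b)" using rel_commutant_comm[OF assms(2) b] by simp
    thus "b * E x = E x * b" using b xA by (simp add: E_left E_right)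
  qed (rule E_in[OF xA])
  moreover have "(E x)\<^sup>\<star> = E x" using assms(3) E_star[OF xA] by simp
  ultimately show thesis using simple_centre_scalar[OF assms(1)] that by metis
qed

lemma index_pos:
  assumes "Phi 1 = r *\<^sub>R 1" shows "r > 0"
proof -
  have "pos (Phi (1\<^sup>\<star> * 1))" by (rule Phi_pos)
  hence "r \<ge> 0" using assms by (intro pos_scalarD) simp
  moreover have "r \<noteq> 0"
  proof
    assume "r = 0"
    hence 0: "(\<Sum>i\<in>I. l i * (l i)\<^sup>\<star>) = 0" using assms by (simp add: Phi_def)
    have p: "pos (l i * (l i)\<^sup>\<star>)" for i using pos_star_mult_self[of "(l i)\<^sup>\<star>"] by (simp add: star_star)
    have "l i = 0" if i: "i \<in> I" for i
    proof -
      have "l i * (l i)\<^sup>\<star> + (\<Sum>j\<in>I - {i}. l j * (l j)\<^sup>\<star>) = 0" using 0 fin i by (simp add: sum.remove)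
      hence "l i * (l i)\<^sup>\<star> = 0" using p by (intro pos_add_eq_0[OF p pos_sum]) auto
      hence "((l i)\<^sup>\<star>)\<^sup>\<star> * (l i)\<^sup>\<star> = 0" by (simp add: star_star)
      hence "(l i)\<^sup>\<star> = 0" by (rule star_mult_self_eq_0)
      hence "((l i)\<^sup>\<star>)\<^sup>\<star> = 0" by simp
      thus ?thesis by (simp add: star_star)
    qed
    hence "(1::'a) = 0" using frame[OF A_intros(1)] by simp
    thus False by simp
  qed
  ultimately show ?thesis by simp
qed

text \<open>
  For \<open>u\<close> in \<open>B' \<inter> A\<close> with inverse \<open>v\<close>, the map \<open>x \<mapsto> E (u x u) / s\<close> is an expectation, and the
  multiples of \<open>l\<^sub>i v\<close> by the square root of \<open>s\<close> form a quasi-basis of it, with index \<open>s q\<close>.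
\<close>
lemma index_perturbed:
  assumes min: "\<And>F. finite_index_exp A B F \<Longrightarrow> scalar_index A E \<le> scalar_index A F"
    and c: "Phi 1 = c *\<^sub>R 1"
    and u: "u \<in> rel_commutant B A" "u\<^sup>\<star> = u" and v: "v \<in> A" "v\<^sup>\<star> = v" "u * v = 1" "v * u = 1"
    and s: "E (u * u) = s *\<^sub>R 1" and q: "Phi (v * v) = q *\<^sub>R 1"
  shows "c \<le> s * q"
proof -
  have uA: "u \<in> A" using rel_commutant_mem[OF u(1)] .
  have ub: "b * u = u * b" if "b \<in> B" for b using rel_commutant_comm[OF u(1) that] .
  have vb: "b * v = v * b" if "b \<in> B" for b
  proof -
    have "b * v = v * (u * b) * v" using v by (simp add: mult.assoc[symmetric])
    also have "\<dots> = v * (b * u) * v" using ub[OF that] by simp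
    also have "\<dots> = v * b" using v by (simp add: mult.assoc)
    finally show ?thesis .
  qed
  have "pos (E (u\<^sup>\<star> * u))" by (rule E_pos[OF uA])
  hence "s \<ge> 0" using u s by (intro pos_scalarD) simp
  moreover have "s \<noteq> 0"
  proof
    assume "s = 0"
    hence "u = 0" using faithful[OF uA] u s by simp
    thus False using v by simp
  qed
  ultimately have s0: "s > 0" by simp
  define F where "F x = (1/s) *\<^sub>R E (u * x * u)" for x
  define m where "m i = sqrt s *\<^sub>R (l i * v)" for i
  have ss: "sqrt s * sqrt s = s" using s0 by simp
  interpret F: expectation A B F
  proof
    fix x assume x: "x \<in> A"
    have uxu: "u * x * u \<in> A" using uA x by (intro A_intros)
    show "F x \<in> B" unfolding F_def by (intro B_intros E_in uxu)
    show "F (x + y) = F x + F y" if "y \<in> A" for y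
    proof -
      have "u * (x + y) * u = u * x * u + u * y * u" by (simp add: algebra_simps)
      thus ?thesis using uxu that uA by (simp add: F_def E_add A_intros scaleR_add_right)
    qed
    show "F (z *\<^sub>C x) = z *\<^sub>C F x" for z
      using uxu by (simp add: F_def mult_scaleC_left mult_scaleC_right E_scaleC scaleC_scaleR)
    have "u * (x\<^sup>\<star> * x) * u = (x * u)\<^sup>\<star> * (x * u)" using u by (simp add: star_simps mult.assoc)
    thus "pos (F (x\<^sup>\<star> * x))" unfolding F_def using s0 uA x by (auto intro!: pos_scaleR E_pos A_intros(3))
    show "F (a * x * b) = a * F x * b" if "a \<in> B" "b \<in> B" for a b
    proof -
      have "u * (a * x * b) * u = (u * a) * x * (b * u)" by (simp add: mult.assoc)
      also have "\<dots> = (a * u) * x * (u * b)" by (simp only: ub[OF that(1)] ub[OF that(2)])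
      also have "\<dots> = a * (u * x * u) * b" by (simp only: mult.assoc)
      finally show ?thesis using E_bimod[OF that uxu] by (simp add: F_def)
    qed
  next
    fix b assume b: "b \<in> B"
    have "u * b * u = b * u * u" by (simp only: ub[OF b])
    hence "u * b * u = b * (u * u)" by (simp only: mult.assoc)
    hence "F b = (1/s) *\<^sub>R (b * E (u * u))" using E_left[OF b] uA by (simp add: F_def A_intros)
    thus "F b = b" using s s0 by simp
  qed (rule A B BA)+
  interpret F: framed A B F I m
  proof
    show "finite I" by (rule fin)
    show mA: "m i \<in> A" if "i \<in> I" for i unfolding m_def using l_in[OF that] v by (intro A_intros) auto
    fix x assume x: "x \<in> A"
    have "(\<Sum>i\<in>I. m i * F ((m i)\<^sup>\<star> * x)) = (\<Sum>i\<in>I. l i * E ((l i)\<^sup>\<star> * (x * u)) * v)"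
    proof (intro sum.cong refl)
      fix i assume i: "i \<in> I"
      have "u * ((m i)\<^sup>\<star> * x) * u = sqrt s *\<^sub>R ((u * v) * ((l i)\<^sup>\<star> * (x * u)))"
        using v(2) by (simp add: m_def star_simps mult.assoc)
      also have "\<dots> = sqrt s *\<^sub>R ((l i)\<^sup>\<star> * (x * u))" by (simp add: v(3))
      finally have 1: "F ((m i)\<^sup>\<star> * x) = (sqrt s / s) *\<^sub>R E ((l i)\<^sup>\<star> * (x * u))"
        using l_in[OF i] x uA by (simp add: F_def E_scaleR A_intros)
      have 2: "v * E ((l i)\<^sup>\<star> * (x * u)) = E ((l i)\<^sup>\<star> * (x * u)) * v"
        using l_in[OF i] x uA by (intro vb[symmetric] E_in A_intros)
      have "sqrt s * (sqrt s / s) = 1" using s0 ss by simp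
      hence "m i * F ((m i)\<^sup>\<star> * x) = l i * (v * E ((l i)\<^sup>\<star> * (x * u)))"
        unfolding 1 unfolding m_def by (simp add: mult.assoc)
      thus "m i * F ((m i)\<^sup>\<star> * x) = l i * E ((l i)\<^sup>\<star> * (x * u)) * v"
        unfolding 2 by (simp only: mult.assoc)
    qed
    also have "\<dots> = (x * u) * v" unfolding sum_distrib_right[symmetric] using x uA by (simp add: frame A_intros)
    also have "\<dots> = x" using v by (simp add: mult.assoc)
    finally show "(\<Sum>i\<in>I. m i * F ((m i)\<^sup>\<star> * x)) = x" .
  qed
  have "F.Phi 1 = (\<Sum>i\<in>I. s *\<^sub>R (l i * (v * v) * (l i)\<^sup>\<star>))"
    unfolding F.Phi_def m_def using v ss by (intro sum.cong refl) (simp add: star_simps mult.assoc)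
  also have "\<dots> = s *\<^sub>R Phi (v * v)" by (simp add: Phi_def scaleR_sum_right)
  finally have "F.Phi 1 = (s * q) *\<^sub>R 1" using q by simp
  hence "scalar_index A F = s * q" by (rule F.scalar_index_eq)
  moreover have "finite_index_exp A B F"
    unfolding finite_index_exp_def using F.cond_exp F.ex_quasi_basis by blast
  moreover have "scalar_index A E = c" by (rule scalar_index_eq[OF c])
  ultimately show ?thesis using min by metis
qed

text \<open>
  Put \<open>u = 1 + t k\<close> in \<open>index_perturbed\<close>.  As \<open>E k = 0\<close>, the factor \<open>s\<close> is \<open>1 + O(t\<^sup>2)\<close>, and \<open>q\<close> is
  \<open>c - 2 t p + O(t\<^sup>2)\<close>, where \<open>Phi k\<close> is the scalar \<open>p\<close>.  Minimality at \<open>t = 0\<close> forces \<open>p = 0\<close>.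
\<close>
lemma Phi_zero_of_E_zero:
  assumes simple: "simple_cstar A" "simple_cstar B"
    and min: "\<And>F. finite_index_exp A B F \<Longrightarrow> scalar_index A E \<le> scalar_index A F"
    and k: "k \<in> rel_commutant B A" "k\<^sup>\<star> = k" "E k = 0"
  shows "Phi k = 0"
proof -
  note RC = relative_commutant_subalgebra
  obtain c where c: "Phi 1 = c *\<^sub>R 1" using Phi_scalar[OF simple(1) subalg_one[OF RC]] by auto
  obtain p where p: "Phi k = p *\<^sub>R 1" using Phi_scalar[OF simple(1) k(1,2)] by auto
  have kA: "k \<in> A" using rel_commutant_mem[OF k(1)] .
  have kk: "k * k \<in> rel_commutant B A" "(k * k)\<^sup>\<star> = k * k"
    using k by (auto simp: subalg_mult[OF RC] star_simps)
  obtain b where b: "E (k * k) = b *\<^sub>R 1" using E_scalar[OF simple(2) kk] by auto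
  define L where "L = (\<Sum>i\<in>I. (norm (l i))\<^sup>2)"
  have L0: "L \<ge> 0" by (simp add: L_def sum_nonneg)
  have Phi_norm: "norm (Phi z) \<le> L * norm z" for z
  proof -
    have "norm (Phi z) \<le> (\<Sum>i\<in>I. norm (l i * z * (l i)\<^sup>\<star>))" unfolding Phi_def by (rule norm_sum)
    also have "\<dots> \<le> (\<Sum>i\<in>I. (norm (l i))\<^sup>2 * norm z)"
    proof (rule sum_mono)
      fix i
      have "norm (l i * z * (l i)\<^sup>\<star>) \<le> norm (l i) * norm z * norm ((l i)\<^sup>\<star>)"
        by (rule order.trans[OF norm_mult_ineq mult_right_mono[OF norm_mult_ineq norm_ge_zero]])
      thus "norm (l i * z * (l i)\<^sup>\<star>) \<le> (norm (l i))\<^sup>2 * norm z" by (simp add: power2_eq_square mult_ac)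
    qed
    finally show ?thesis by (simp add: L_def sum_distrib_right)
  qed
  define M where "M = L * (16 * (norm k)\<^sup>2)"
  define d where "d = min 1 (1 / (2 * (norm k + 1)))"
  have d: "d > 0" "d \<le> 1" using norm_ge_zero[of k] by (auto simp: d_def simp del: norm_ge_zero intro!: divide_pos_pos)
  have "0 \<le> t * (- 2 * p) + (\<bar>b * c\<bar> + 2 * \<bar>b * p\<bar> + M * (1 + \<bar>b\<bar>)) * t\<^sup>2" if t: "\<bar>t\<bar> \<le> d" for t
  proof -
    define y where "y = t *\<^sub>R k"
    have y: "y \<in> rel_commutant B A" "y\<^sup>\<star> = y" using k by (auto simp: y_def subalg_scaleR[OF RC])
    have "\<bar>t\<bar> * norm k \<le> (1 / (2 * (norm k + 1))) * norm k" using t by (intro mult_right_mono) (auto simp: d_def)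
    also have "\<dots> \<le> 1/2" using norm_ge_zero[of k] by (simp add: divide_simps del: norm_ge_zero)
    finally have ny: "norm y \<le> 1/2" by (simp add: y_def)
    then obtain v where v: "v \<in> rel_commutant B A" "v\<^sup>\<star> = v" "(1 + y) * v = 1" "v * (1 + y) = 1" "norm v \<le> 2"
      using inverse_one_plus[OF RC y] by metis
    have vA: "v \<in> A" using rel_commutant_mem[OF v(1)] .
    \<comment> \<open>the second-order remainder of \<open>v\<^sup>2 = 1 / (1 + y)\<^sup>2\<close>\<close>
    define R where "R = y * y * (3 *\<^sub>R 1 + 2 *\<^sub>R y) * (v * v)"
    have yv: "y * v = 1 - v" using v(3) by (simp add: algebra_simps eq_diff_eq)
    have "y * (v * v) = y * v * v" by (simp only: mult.assoc)
    hence yvv: "y * (v * v) = v - v * v" by (simp only: yv left_diff_distrib mult_1_left)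
    have yyvv: "y * (y * (v * v)) = (1 - v) - (v - v * v)"
      unfolding yvv right_diff_distrib[of y v "v * v"] yv by (rule refl)
    have "y * ((1 - v) - (v - v * v)) = y - 2 *\<^sub>R (y * v) + y * (v * v)"
      by (simp add: right_diff_distrib scaleR_2)
    hence "y * ((1 - v) - (v - v * v)) = y - 2 *\<^sub>R (1 - v) + (v - v * v)"
      by (simp only: yv yvv)
    hence yyyvv: "y * (y * (y * (v * v))) = y - 2 *\<^sub>R (1 - v) + (v - v * v)"
      by (simp only: yyvv)
    have "R = 3 *\<^sub>R (y * (y * (v * v))) + 2 *\<^sub>R (y * (y * (y * (v * v))))"
      by (simp add: R_def algebra_simps)
    also have "\<dots> = v * v - 1 + 2 *\<^sub>R y"
      by (subst yyyvv, subst yyvv) (rule inverse_square_remainder)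
    finally have vv: "v * v = 1 - 2 *\<^sub>R y + R" by (simp add: algebra_simps)
    have nR: "norm R \<le> 16 * (norm k)\<^sup>2 * t\<^sup>2"
    proof -
      have "norm R \<le> norm (y * y) * norm (3 *\<^sub>R 1 + 2 *\<^sub>R y) * norm (v * v)"
        unfolding R_def by (rule order.trans[OF norm_mult_ineq mult_right_mono[OF norm_mult_ineq norm_ge_zero]])
      also have "\<dots> \<le> (norm y * norm y) * 4 * (norm v * norm v)"
      proof (intro mult_mono norm_mult_ineq)
        have "norm (3 *\<^sub>R 1 + 2 *\<^sub>R y) \<le> norm (3 *\<^sub>R (1::'a)) + norm (2 *\<^sub>R y)" by (rule norm_triangle_ineq)
        thus "norm (3 *\<^sub>R 1 + 2 *\<^sub>R y) \<le> 4" using ny by simp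
      qed auto
      also have "\<dots> \<le> (norm y * norm y) * 4 * (2 * 2)" using v(5) by (intro mult_left_mono mult_mono) auto
      also have "\<dots> = 16 * (norm k)\<^sup>2 * t\<^sup>2" by (simp add: y_def power2_eq_square)
      finally show ?thesis .
    qed
    have vvR: "v * v \<in> rel_commutant B A" "(v * v)\<^sup>\<star> = v * v"
      using v(1,2) by (auto simp: subalg_mult[OF RC] star_simps)
    obtain q where q: "Phi (v * v) = q *\<^sub>R 1" using Phi_scalar[OF simple(1) vvR] by auto
    define r where "r = q - (c - 2 * t * p)"
    have vvd: "v * v = 1 + ((- 2 * t) *\<^sub>R k + R)" unfolding vv y_def by simp
    have "Phi (v * v) = c *\<^sub>R 1 + ((- 2 * t * p) *\<^sub>R 1 + Phi R)" unfolding vvd Phi_add Phi_scaleR c p by simp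
    hence "Phi R = r *\<^sub>R 1" unfolding q by (simp add: r_def algebra_simps)
    hence "\<bar>r\<bar> = norm (Phi R)" by simp
    also have "\<dots> \<le> L * norm R" by (rule Phi_norm)
    also have "\<dots> \<le> M * t\<^sup>2" unfolding M_def using mult_left_mono[OF nR L0] by (simp add: mult_ac)
    finally have r: "\<bar>r\<bar> \<le> M * t\<^sup>2" .
    have "(1 + y) * (1 + y) = 1 + ((2 * t) *\<^sub>R k + t\<^sup>2 *\<^sub>R (k * k))"
      by (simp add: y_def algebra_simps power2_eq_square scaleR_2[symmetric])
    hence "E ((1 + y) * (1 + y)) = (1 + t\<^sup>2 * b) *\<^sub>R 1"
      using kA k(3) b by (simp add: E_add E_scaleR E_one A_intros algebra_simps)
    hence "c \<le> (1 + t\<^sup>2 * b) * q"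
      using v vA y subalg_add[OF RC subalg_one[OF RC] y(1)]
      by (intro index_perturbed[OF min c _ _ vA v(2,3,4) _ q]) (auto simp: star_simps)
    also have "q = c - 2 * t * p + r" by (simp add: r_def)
    finally have "0 \<le> - 2 * t * p + t\<^sup>2 * (b * c) + t\<^sup>2 * (- 2 * t * (b * p)) + r * (1 + t\<^sup>2 * b)"
      by (simp add: algebra_simps)
    also have "t\<^sup>2 * (b * c) \<le> t\<^sup>2 * \<bar>b * c\<bar>" by (intro mult_left_mono) auto
    also have "t\<^sup>2 * (- 2 * t * (b * p)) \<le> t\<^sup>2 * (2 * \<bar>b * p\<bar>)"
    proof (intro mult_left_mono)
      have "- 2 * t * (b * p) \<le> 2 * (\<bar>t\<bar> * \<bar>b * p\<bar>)" using abs_ge_minus_self[of "t * (b * p)"] by (simp add: abs_mult mult_ac)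
      also have "\<bar>t\<bar> * \<bar>b * p\<bar> \<le> 1 * \<bar>b * p\<bar>" using t d by (intro mult_right_mono) auto
      finally show "- 2 * t * (b * p) \<le> 2 * \<bar>b * p\<bar>" by simp
    qed auto
    also have "r * (1 + t\<^sup>2 * b) \<le> (M * t\<^sup>2) * (1 + \<bar>b\<bar>)"
    proof -
      have "r * (1 + t\<^sup>2 * b) \<le> \<bar>r\<bar> * \<bar>1 + t\<^sup>2 * b\<bar>" by (metis abs_ge_self abs_mult)
      also have "\<bar>1 + t\<^sup>2 * b\<bar> \<le> 1 + \<bar>b\<bar>"
      proof -
        have "t\<^sup>2 \<le> 1" using t d by (simp add: abs_square_le_1)
        hence "t\<^sup>2 * \<bar>b\<bar> \<le> 1 * \<bar>b\<bar>" by (intro mult_right_mono) auto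
        hence "\<bar>t\<^sup>2 * b\<bar> \<le> \<bar>b\<bar>" by (simp add: abs_mult)
        thus ?thesis by linarith
      qed
      hence "\<bar>r\<bar> * \<bar>1 + t\<^sup>2 * b\<bar> \<le> (M * t\<^sup>2) * (1 + \<bar>b\<bar>)" using r by (intro mult_mono) auto
      finally show ?thesis .
    qed
    finally show ?thesis by (simp add: algebra_simps)
  qed
  hence "- 2 * p = 0" by (rule first_order_zero[OF d(1)])
  thus ?thesis by (simp add: p)
qed

text \<open>
  Apply \<open>Phi_zero_of_E_zero\<close> to \<open>x - E x\<close> for self-adjoint \<open>x\<close>, where \<open>E x\<close> is a scalar, and extend
  by complex linearity.
\<close>
theorem markov_of_minimal:
  assumes simple: "simple_cstar A" "simple_cstar B"
    and min: "\<And>F. finite_index_exp A B F \<Longrightarrow> scalar_index A E \<le> scalar_index A F"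
  shows "\<exists>c. markov A B E I l c"
proof -
  note RC = relative_commutant_subalgebra
  obtain c where c: "Phi 1 = c *\<^sub>R 1" using Phi_scalar[OF simple(1) subalg_one[OF RC]] by auto
  have sa: "Phi x = c *\<^sub>R E x" if x: "x \<in> rel_commutant B A" "x\<^sup>\<star> = x" for x
  proof -
    obtain a where a: "E x = a *\<^sub>R 1" using E_scalar[OF simple(2) x] by auto
    have xA: "x \<in> A" using rel_commutant_mem[OF x(1)] .
    have "Phi (x + (- a) *\<^sub>R 1) = 0"
    proof (rule Phi_zero_of_E_zero[OF simple min])
      show "x + (- a) *\<^sub>R 1 \<in> rel_commutant B A" using x by (intro subalg_intros[OF RC])
      show "E (x + (- a) *\<^sub>R 1) = 0" using xA a by (simp add: E_diff A_intros E_scaleR E_one)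
    qed (use x in \<open>auto simp: star_simps\<close>)
    thus ?thesis unfolding Phi_add Phi_scaleR c a by simp
  qed
  have "markov A B E I l c"
  proof
    show "c > 0" by (rule index_pos[OF c])
    show "Phi 1 = c *\<^sub>R 1" by (rule c)
    fix x assume x: "x \<in> rel_commutant B A"
    have xA: "x \<in> A" using rel_commutant_mem[OF x] .
    define h where "h = (1/2) *\<^sub>R (x + x\<^sup>\<star>)"
    define k where "k = (1/2) *\<^sub>R ((- \<i>) *\<^sub>C (x - x\<^sup>\<star>))"
    have h: "h \<in> rel_commutant B A" unfolding h_def using x by (intro subalg_scaleR[OF RC] subalg_add[OF RC] subalg_star[OF RC])
    have k: "k \<in> rel_commutant B A" unfolding k_def using x
      by (intro subalg_scaleR[OF RC] subalg_scaleC[OF RC] subalg_diff[OF RC] subalg_star[OF RC])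
    have hs: "h\<^sup>\<star> = h" "k\<^sup>\<star> = k"
      by (simp_all add: h_def k_def star_simps star_scaleC scaleC_minus_left scaleC_diff_right add.commute)
    have "\<i> *\<^sub>C k = (1/2) *\<^sub>R (x - x\<^sup>\<star>)" by (simp add: k_def scaleC_scaleR scaleC_scaleC)
    hence "h + \<i> *\<^sub>C k = (1/2) *\<^sub>R (2 *\<^sub>R x)" unfolding h_def scaleR_2 by (simp add: algebra_simps)
    hence xhk: "x = h + \<i> *\<^sub>C k" by simp
    have hkA: "h \<in> A" "k \<in> A" using h k rel_commutant_mem by auto
    show "Phi x = c *\<^sub>R E x"
      unfolding xhk Phi_add Phi_scaleC using sa[OF h hs(1)] sa[OF k hs(2)] hkA
      by (simp add: E_add E_scaleC A_intros scaleR_add_right scaleC_scaleR)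
  qed
  thus ?thesis ..
qed

end

section \<open>The tower of C*-basic constructions\<close>

context markov
begin

text \<open>
  Elements of \<open>C\<close> are compared through the faithful representation \<open>\<pi>\<close> on the module \<open>A\<close>; in
  particular \<open>x e\<close> equals \<open>(\<pi> x 1) e\<close>, because \<open>\<pi> x\<close> is right \<open>B\<close>-linear and \<open>\<pi> e\<close> is \<open>E\<close>.
\<close>
lemma jones_of_basic_construction:
  assumes bc: "basic_construction B A E C e" and dual: "dual_exp A E C e E1"
  shows "jones A B E I l c C e E1"
proof -
  have C: "cstar_subalgebra C" "A \<subseteq> C" "e \<in> C" using bc by (auto simp: basic_construction_def)
  obtain \<pi> where bij: "bij_betw \<pi> C (basic_ops A B E)"
    and \<pi>a: "\<forall>a\<in>A. \<pi> a = restrict ((*) a) A" and \<pi>e: "\<pi> e = restrict E A"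
    and \<pi>add: "\<forall>x\<in>C. \<forall>y\<in>C. \<pi> (x + y) = restrict (\<lambda>a. \<pi> x a + \<pi> y a) A"
    and \<pi>sc: "\<forall>c. \<forall>x\<in>C. \<pi> (c *\<^sub>C x) = restrict (\<lambda>a. c *\<^sub>C \<pi> x a) A"
    and \<pi>mult: "\<forall>x\<in>C. \<forall>y\<in>C. \<pi> (x * y) = restrict (\<lambda>a. \<pi> x (\<pi> y a)) A"
    and \<pi>adj: "\<forall>x\<in>C. module_adjoint A B E (\<pi> x) (\<pi> (x\<^sup>\<star>))"
    using bc unfolding basic_construction_def by blast
  have map: "module_map A B (\<pi> x)" if "x \<in> C" for x using \<pi>adj that by (auto simp: module_adjoint_def)
  have \<pi>in: "\<pi> x a \<in> A" if "x \<in> C" "a \<in> A" for x a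
    using map[OF that(1)] that(2) by (auto simp: module_map_def)
  have \<pi>right: "\<pi> x (a * b) = \<pi> x a * b" if "x \<in> C" "a \<in> A" "b \<in> B" for x a b
    using map[OF that(1)] that(2,3) by (auto simp: module_map_def)
  have eqI: "x = y" if x: "x \<in> C" and y: "y \<in> C" and "\<And>a. a \<in> A \<Longrightarrow> \<pi> x a = \<pi> y a" for x y
  proof -
    have "\<pi> x \<in> A \<rightarrow>\<^sub>E A" "\<pi> y \<in> A \<rightarrow>\<^sub>E A" using map x y by (auto simp: module_map_def)
    hence "\<pi> x = \<pi> y" using that(3) by (rule PiE_ext)
    thus ?thesis using bij x y by (auto simp: bij_betw_def dest: inj_onD)
  qed
  have mult: "\<pi> (x * y) a = \<pi> x (\<pi> y a)" if "x \<in> C" "y \<in> C" "a \<in> A" for x y a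
    using \<pi>mult that by simp
  have left: "\<pi> x a = x * a" if "x \<in> A" "a \<in> A" for x a using \<pi>a that by simp
  have eE: "\<pi> e a = E a" if "a \<in> A" for a using \<pi>e that by simp
  have AC: "a \<in> C" if "a \<in> A" for a using C that by blast
  note C_intros = subalg_intros[OF C(1)]
  have es: "e\<^sup>\<star> = e"
  proof (rule eqI)
    show "e\<^sup>\<star> \<in> C" "e \<in> C" using C by (auto intro: C_intros)
    fix a assume a: "a \<in> A"
    show "\<pi> (e\<^sup>\<star>) a = \<pi> e a"
    proof (rule nondegenerate_eq)
      show "\<pi> (e\<^sup>\<star>) a \<in> A" "\<pi> e a \<in> A" using a C by (auto intro!: \<pi>in C_intros(5))
      fix z assume z: "z \<in> A"
      hence zs: "z\<^sup>\<star> \<in> A" by (intro A_intros)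
      have "E ((\<pi> e (z\<^sup>\<star>))\<^sup>\<star> * a) = E ((z\<^sup>\<star>)\<^sup>\<star> * \<pi> (e\<^sup>\<star>) a)"
        using \<pi>adj C(3) zs a unfolding module_adjoint_def by blast
      hence "E (z * \<pi> (e\<^sup>\<star>) a) = E ((\<pi> e (z\<^sup>\<star>))\<^sup>\<star> * a)" by (simp add: star_star)
      also have "(\<pi> e (z\<^sup>\<star>))\<^sup>\<star> = E z" using z zs by (simp add: eE E_star star_star)
      also have "E (E z * a) = E z * E a" using z a by (intro E_left E_in)
      also have "\<dots> = E (z * E a)" using z a by (intro E_right[symmetric] E_in)
      also have "E a = \<pi> e a" using a by (simp add: eE)
      finally show "E (z * \<pi> (e\<^sup>\<star>) a) = E (z * \<pi> e a)" .
    qed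
  qed
  have res: "(\<Sum>i\<in>I. l i * e * (l i)\<^sup>\<star>) = 1"
  proof (rule eqI)
    have \<pi>0: "\<pi> 0 a = 0" if "a \<in> A" for a using \<pi>sc[rule_format, of 1 0] left[of 0 a] that by (simp add: A_intros)
    have mem: "l i * e * (l i)\<^sup>\<star> \<in> C" if "i \<in> I" for i using AC l_in[OF that] C(3) by (simp add: C_intros)
    show "(\<Sum>i\<in>I. l i * e * (l i)\<^sup>\<star>) \<in> C" "1 \<in> C" using mem by (auto intro: C_intros(1,10))
    fix a assume a: "a \<in> A"
    have "\<pi> (\<Sum>i\<in>J. l i * e * (l i)\<^sup>\<star>) a = (\<Sum>i\<in>J. \<pi> (l i * e * (l i)\<^sup>\<star>) a)" if "J \<subseteq> I" "finite J" for J
      using that(2,1)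
    proof (induction J rule: finite_induct)
      case (insert j J)
      have "(\<Sum>i\<in>J. l i * e * (l i)\<^sup>\<star>) \<in> C" using insert mem by (intro C_intros(10)) auto
      thus ?case using insert mem[of j] \<pi>add a by simp
    qed (simp add: \<pi>0 a)
    hence "\<pi> (\<Sum>i\<in>I. l i * e * (l i)\<^sup>\<star>) a = (\<Sum>i\<in>I. \<pi> (l i * e * (l i)\<^sup>\<star>) a)" using fin by simp
    also have "\<dots> = (\<Sum>i\<in>I. l i * E ((l i)\<^sup>\<star> * a))"
    proof (intro sum.cong refl)
      fix i assume i: "i \<in> I"
      have L: "l i \<in> A" "(l i)\<^sup>\<star> \<in> A" using l_in[OF i] by (auto intro: A_intros(5))
      have La: "(l i)\<^sup>\<star> * a \<in> A" using L a by (intro A_intros(3))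
      have "\<pi> (l i * e * (l i)\<^sup>\<star>) a = \<pi> (l i) (\<pi> e (\<pi> ((l i)\<^sup>\<star>) a))"
        using a L AC C(3) C_intros(3) \<pi>in by (simp add: mult)
      also have "\<dots> = l i * E ((l i)\<^sup>\<star> * a)" using a L La E_in_A[OF La] by (simp add: left eE)
      finally show "\<pi> (l i * e * (l i)\<^sup>\<star>) a = l i * E ((l i)\<^sup>\<star> * a)" .
    qed
    also have "\<dots> = a" by (rule frame[OF a])
    also have "a = \<pi> 1 a" using a by (simp add: left A_intros)
    finally show "\<pi> (\<Sum>i\<in>I. l i * e * (l i)\<^sup>\<star>) a = \<pi> 1 a" .
  qed
  have E1: "expectation C A E1"
    by (rule expectation_of_cond_exp) (use C A dual in \<open>auto simp: dual_exp_def\<close>)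
  have si: "scalar_index A E = c" by (rule scalar_index_eq[OF index])
  show ?thesis
  proof (intro jones.intro jones_axioms.intro)
    show "markov A B E I l c" by unfold_locales
    show "expectation C A E1" by (rule E1)
    show "e \<in> C" "e\<^sup>\<star> = e" by (rule C es)+
    show "E1 (x * e * y) = (1 / c) *\<^sub>R (x * y)" if "x \<in> A" "y \<in> A" for x y
      using dual that unfolding dual_exp_def si by blast
    show "e * a * e = E a * e" if a: "a \<in> A" for a
    proof (rule eqI)
      show "e * a * e \<in> C" "E a * e \<in> C" using AC[OF a] AC[OF E_in_A[OF a]] C(3) by (auto simp: C_intros)
      fix x assume x: "x \<in> A"
      have "\<pi> (e * a * e) x = E (a * E x)"
        using x a AC C(3) C_intros(3) E_in_A A_intros(3) by (simp add: mult left eE)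
      also have "\<dots> = E a * E x" using x a by (intro E_right E_in)
      also have "\<dots> = \<pi> (E a * e) x" using x a AC C(3) E_in_A by (simp add: mult left eE)
      finally show "\<pi> (e * a * e) x = \<pi> (E a * e) x" .
    qed
    show "\<exists>a\<in>A. x * e = a * e" if x: "x \<in> C" for x
    proof
      have 1: "1 \<in> A" by (rule A_intros)
      show a: "\<pi> x 1 \<in> A" by (rule \<pi>in[OF x 1])
      show "x * e = \<pi> x 1 * e"
      proof (rule eqI)
        show "x * e \<in> C" "\<pi> x 1 * e \<in> C" using x AC[OF a] C(3) by (auto simp: C_intros)
        fix y assume y: "y \<in> A"
        have "\<pi> (x * e) y = \<pi> x (1 * E y)" using x C(3) y by (simp add: mult eE)
        also have "\<dots> = \<pi> x 1 * E y" by (rule \<pi>right[OF x 1 E_in[OF y]])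
        also have "\<dots> = \<pi> (\<pi> x 1 * e) y" using AC[OF a] C(3) y a E_in_A[OF y] by (simp add: mult eE left)
        finally show "\<pi> (x * e) y = \<pi> (\<pi> x 1 * e) y" .
      qed
    qed
    have "(\<Sum>i\<in>I. l i * e * (l i)\<^sup>\<star>) \<in> span {a * e * b |a b. a \<in> A \<and> b \<in> A}"
    proof (rule span_sum)
      fix i assume "i \<in> I"
      hence "l i \<in> A" "(l i)\<^sup>\<star> \<in> A" using l_in by (auto intro: A_intros(5))
      thus "l i * e * (l i)\<^sup>\<star> \<in> span {a * e * b |a b. a \<in> A \<and> b \<in> A}" by (intro span_base) blast
    qed
    thus "1 \<in> span {a * e * b |a b. a \<in> A \<and> b \<in> A}" by (simp only: res)
  qed
qed

end

text \<open>
  The index is the same at every level because the dual of a Markov expectation is Markov with the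
  same constant.
\<close>
lemma tower_jones:
  fixes A :: "nat \<Rightarrow> 'a::cstar_algebra set"
  assumes simple: "simple_cstar B" "simple_cstar (A 0)" and sub: "B \<subseteq> A 0" and tower: "jones_tower B A E e"
  obtains n :: nat and c l where
    "\<And>k. jones (A k) (below B A k) (E k) {..<n} (l k) c (A (Suc k)) (e (Suc k)) (E (Suc k))"
proof -
  have min: "minimal_exp (A 0) B (E 0)"
    and bc: "\<And>k. basic_construction (below B A k) (A k) (E k) (A (Suc k)) (e (Suc k))"
    and dual: "\<And>k. dual_exp (A k) (E k) (A (Suc k)) (e (Suc k)) (E (Suc k))"
    using tower unfolding jones_tower_def by auto
  have "cond_exp (A 0) B (E 0)" using min by (simp add: minimal_exp_def finite_index_exp_def)
  then interpret E0: expectation "A 0" B "E 0"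
    by (intro expectation_of_cond_exp) (use simple sub in \<open>auto simp: simple_cstar_def\<close>)
  obtain n m where qb: "quasi_basis (A 0) (E 0) n m" using min by (auto simp: minimal_exp_def finite_index_exp_def)
  interpret E0: framed "A 0" B "E 0" "{..<n}" m
    by unfold_locales (use qb in \<open>auto simp: quasi_basis_def\<close>)
  obtain c where c: "markov (A 0) B (E 0) {..<n} m c"
    using E0.markov_of_minimal simple min by (auto simp: minimal_exp_def)
  have mk: "\<exists>l. markov (A k) (below B A k) (E k) {..<n} l c" for k
  proof (induction k)
    case 0 thus ?case using c by (auto simp: below_def)
  next
    case (Suc k)
    then obtain l where l: "markov (A k) (below B A k) (E k) {..<n} l c" by blast
    have "jones (A k) (below B A k) (E k) {..<n} l c (A (Suc k)) (e (Suc k)) (E (Suc k))"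
      by (rule markov.jones_of_basic_construction[OF l bc dual])
    from jones.dual_markov[OF this] show ?case by (auto simp: below_def)
  qed
  then obtain l where "\<And>k. markov (A k) (below B A k) (E k) {..<n} (l k) c" by metis
  hence "jones (A k) (below B A k) (E k) {..<n} (l k) c (A (Suc k)) (e (Suc k)) (E (Suc k))" for k
    by (rule markov.jones_of_basic_construction[OF _ bc dual])
  thus thesis by (rule that)
qed

theorem theorem3p16:
  fixes B :: "'a::cstar_algebra set"
    and A :: "nat \<Rightarrow> 'a set"
    and E :: "nat \<Rightarrow> 'a \<Rightarrow> 'a"
    and e :: "nat \<Rightarrow> 'a"
  assumes "simple_cstar B" and "simple_cstar (A 0)" and "B \<subseteq> A 0"
    and "\<exists>F. finite_index_exp (A 0) B F"
    and "jones_tower B A E e"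
  shows "star_anti_automorphism (rel_commutant B (A 1)) (rotation_0 B A E e)
       \<and> star_anti_automorphism (rel_commutant B (A 3)) (rotation_1 B A E e)"
proof -
  obtain n :: nat and c l where
    j: "\<And>k. jones (A k) (below B A k) (E k) {..<n} (l k) c (A (Suc k)) (e (Suc k)) (E (Suc k))"
    using tower_jones[OF assms(1,2,3,5)] by blast
  have j0: "jones (A 0) B (E 0) {..<n} (l 0) c (A 1) (e 1) (E 1)" using j[of 0] by (simp add: below_def)
  have js: "jones (A (Suc k)) (A k) (E (Suc k)) {..<n} (l (Suc k)) c (A (Suc (Suc k))) (e (Suc (Suc k))) (E (Suc (Suc k)))" for k
    using j[of "Suc k"] by (simp add: below_def)
  have j1: "jones (A 1) (A 0) (E 1) {..<n} (l 1) c (A 2) (e 2) (E 2)"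
    and j2: "jones (A 2) (A 1) (E 2) {..<n} (l 2) c (A 3) (e 3) (E 3)"
    and j3: "jones (A 3) (A 2) (E 3) {..<n} (l 3) c (A 4) (e 4) (E 4)"
    and j4: "jones (A 4) (A 3) (E 4) {..<n} (l 4) c (A 5) (e 5) (E 5)"
    using js[of 0] js[of 1] js[of 2] js[of 3] by (simp_all add: eval_nat_numeral)
  interpret t: two_steps "A 0" B "E 0" "{..<n}" "l 0" c "A 1" "e 1" "E 1" "{..<n}" "l 1" "A 2" "e 2" "E 2"
    by (intro two_steps.intro j0 j1)
  interpret odd: markov "A 1" B "E 0 \<circ> E 1" "{..<n} \<times> {..<n}" "\<lambda>(j, i). l 1 j * l 0 i" "c * c" by (rule t.markov_comp_up)
  have tau: "tau A E = 1 / c" by (simp add: tau_def t.scalar_index_eq[OF t.index])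
  have "star_anti_automorphism (rel_commutant B (A 1)) (rotation_0 B A E e)"
    unfolding rotation_0_def by (rule rotation_star_anti_automorphism[OF t.two_steps_axioms tau])
  \<comment> \<open>the rotation of the tower \<open>B \<subseteq> A 1 \<subseteq> A 3 \<subseteq> A 5\<close>, whose index is \<open>c\<^sup>2\<close>\<close>
  moreover have "star_anti_automorphism (rel_commutant B (A 3)) (rotation_1 B A E e)"
  proof -
    have p: "odd_proj A E e 1 = c *\<^sub>R (e 2 * e 1 * e 3 * e 2)" "odd_proj A E e 2 = c *\<^sub>R (e 4 * e 3 * e 5 * e 4)"
      by (simp_all add: odd_proj_def tau)
    have a: "odd_alg A 0 = A 1" "odd_alg A 1 = A 3" "odd_alg A 2 = A 5" by (simp_all add: odd_alg_def)
    have x: "odd_exp E 0 = E 0 \<circ> E 1" "odd_exp E 1 = E 2 \<circ> E 3" "odd_exp E 2 = E 4 \<circ> E 5"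
      by (simp_all add: odd_exp_def)
    have "tau (odd_alg A) (odd_exp E) = 1 / (c * c)"
      unfolding tau_def a x by (simp only: odd.scalar_index_eq[OF odd.index])
    moreover have "two_steps (odd_alg A 0) B (odd_exp E 0) ({..<n} \<times> {..<n}) (\<lambda>(j, i). l 1 j * l 0 i) (c * c)
        (odd_alg A 1) (odd_proj A E e 1) (odd_exp E 1) ({..<n} \<times> {..<n}) (\<lambda>(j, i). l 3 j * l 2 i)
        (odd_alg A 2) (odd_proj A E e 2) (odd_exp E 2)"
      unfolding p a x by (intro two_steps.intro jones_two_step[OF j0 j1 j2] jones_two_step[OF j2 j3 j4])
    ultimately have "star_anti_automorphism (rel_commutant B (odd_alg A 1)) (rotation B (odd_alg A) (odd_exp E) (odd_proj A E e) 1)"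
      by (intro rotation_star_anti_automorphism)
    thus ?thesis unfolding rotation_1_def a .
  qed
  ultimately show ?thesis ..
qed

end
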